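(* Assume $\gamma>0$ and that $R$ is regularly varying at $\infty$ with index $\theta>1$. Let $\varphi(b)=\frac{1}{\gamma}\int_b^\infty\frac{\mathrm{d}x}{R(x)}$ and $V(z,\rho)=\sup_{x\ge z}\left(\frac{R(x)}{R(x+\rho z)}-1\right)_+$. Suppose that one of the following holds: (a) $\Psi(\lambda)-\gamma\lambda\sim c\lambda^{1+\delta}$ as $\lambda\to0+$ for some $\delta\in(0,1)$ and $c>0$, and $V(z,1/\sqrt{z})=O(z^{-\delta/2})$ as $z\to\infty$; (b) there exists $\nu\in(0,\infty)$ with $\Psi(-\nu)=0$, $\int_0^1u\,\pi(\mathrm{d}u)<\infty$, and $V\!\left(z,\frac{2\ln\ln z}{\nu z}\right)=O\big((\ln z)^{-2}\big)$ as $z\to\infty$. Then $\frac{X_t}{\varphi^{-1}(t)}\to1$ $\mathbb{P}_\infty$-almost surely as $t\to0+$, and $\varphi^{-1}$ is regularly varying at $0$ with index $-1/(\theta-1)$.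
   Context: Let $\Psi(\lambda)=\gamma\lambda+\frac{\sigma^2}{2}\lambda^2+\int_0^\infty(e^{-\lambda z}-1+\lambda z)\,\pi(\mathrm{d}z)$ for $\lambda\ge0$ (and at negative $\lambda$ by the same formula whenever it is finite), where $\gamma\in\mathbb{R}$, $\sigma\ge0$, $\pi$ a measure on $(0,\infty)$ with $\int_0^\infty(z\wedge z^2)\pi(\mathrm{d}z)<\infty$. Let $Z$ be a spectrally positive Lévy process with $\mathbb{E}[e^{-\lambda Z_1}\mid Z_0=x]=e^{-\lambda x+\Psi(\lambda)}$. Let $R$ be continuous on $[0,\infty)$, strictly positive on $(0,\infty)$. With $\tau_0^-=\inf\{t:Z_t<0\}$, $\eta(s)=\int_0^{s\wedge\tau_0^-}\frac{\mathrm{d}r}{R(Z_r)}$, $\eta^{-1}(t)=\inf\{s:\eta(s)>t\}$, the process is $X_t=Z_{\eta^{-1}(t)\wedge\tau_0^-}$. Under the hypotheses, $\infty$ is an instantaneous entrance boundary for $X$ (no explosion, and $\lim_{b\to\infty}\liminf_{x\to\infty}\mathbb{P}_x(T_b\le t)=1$ for all $t>0$, with $T_b=\inf\{t:X_t<b\}$); $\mathbb{P}_\infty$ is the law of the càdlàg strong Markov process started at $\infty$ leaving it instantaneously and evolving from finite states as $X$. A positive function $f$ is regularly varying at $\infty$ (resp. $0$) with index $\theta$ if $f(\lambda x)/f(x)\to\lambda^\theta$ as $x\to\infty$ (resp. $x\to0+$) for every $\lambda>0$. $(y)_+=\max(y,0)$. *)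

theory Defs
  imports "HOL-Probability.Probability" "HOL-Library.Landau_Symbols"
begin

text \<open>Laplace exponent Psi of a spectrally positive Levy process with
  triplet (gamma, sigma, pi); pi is a measure on the reals concentrated on (0,infinity).\<close>
definition Psi :: "real \<Rightarrow> real \<Rightarrow> real measure \<Rightarrow> real \<Rightarrow> real" where
  "Psi \<gamma> \<sigma> \<pi> l = \<gamma> * l + \<sigma>\<^sup>2 / 2 * l\<^sup>2 + (\<integral>z. exp (- l * z) - 1 + l * z \<partial>\<pi>)"

definition levy_measure :: "real measure \<Rightarrow> bool" where
  "levy_measure \<pi> \<longleftrightarrow> sets \<pi> = sets borel \<and> emeasure \<pi> {..0} = 0 \<and>
     (\<integral>\<^sup>+ z. ennreal (min z (z\<^sup>2)) \<partial>\<pi>) < \<infinity>"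

definition cadlag0 :: "(real \<Rightarrow> real) \<Rightarrow> bool" where
  "cadlag0 f \<longleftrightarrow> (\<forall>t\<ge>0. (f \<longlongrightarrow> f t) (at_right t)) \<and>
                  (\<forall>t>0. \<exists>l. (f \<longlongrightarrow> l) (at_left t))"

definition sp_levy :: "'b measure \<Rightarrow> (real \<Rightarrow> 'b \<Rightarrow> real) \<Rightarrow> real \<Rightarrow> (real \<Rightarrow> real) \<Rightarrow> bool" where
  "sp_levy N Z x \<Psi> \<longleftrightarrow> prob_space N \<and>
     (\<forall>t\<ge>0. Z t \<in> borel_measurable N) \<and>
     (\<forall>\<omega>\<in>space N. Z 0 \<omega> = x \<and> cadlag0 (\<lambda>t. Z t \<omega>)) \<and>
     (\<forall>(n::nat) (ts::nat \<Rightarrow> real). 0 \<le> ts 0 \<and> (\<forall>i<n. ts i \<le> ts (Suc i)) \<longrightarrow>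
        prob_space.indep_vars N (\<lambda>_. borel) (\<lambda>i \<omega>. Z (ts (Suc i)) \<omega> - Z (ts i) \<omega>) {..<n}) \<and>
     (\<forall>s t. 0 \<le> s \<and> s \<le> t \<longrightarrow>
        distr N borel (\<lambda>\<omega>. Z t \<omega> - Z s \<omega>) = distr N borel (\<lambda>\<omega>. Z (t - s) \<omega> - Z 0 \<omega>)) \<and>
     (\<forall>l\<ge>0. prob_space.expectation N (\<lambda>\<omega>. exp (- l * Z 1 \<omega>)) = exp (- l * x + \<Psi> l))"

definition tau0 :: "(real \<Rightarrow> 'b \<Rightarrow> real) \<Rightarrow> 'b \<Rightarrow> ereal" where
  "tau0 Z \<omega> = (if {s. 0 \<le> s \<and> Z s \<omega> < 0} = {} then \<infinity>
                else ereal (Inf {s. 0 \<le> s \<and> Z s \<omega> < 0}))"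

definition eta :: "(real \<Rightarrow> real) \<Rightarrow> (real \<Rightarrow> 'b \<Rightarrow> real) \<Rightarrow> 'b \<Rightarrow> real \<Rightarrow> ennreal" where
  "eta R Z \<omega> s = (\<integral>\<^sup>+ r. indicator {r. 0 \<le> r \<and> r \<le> s \<and> ereal r < tau0 Z \<omega>} r
                         * ennreal (1 / R (Z r \<omega>)) \<partial>lborel)"

definition eta_inv :: "(real \<Rightarrow> real) \<Rightarrow> (real \<Rightarrow> 'b \<Rightarrow> real) \<Rightarrow> 'b \<Rightarrow> real \<Rightarrow> ereal" where
  "eta_inv R Z \<omega> t = (if {s. 0 \<le> s \<and> eta R Z \<omega> s > ennreal t} = {} then \<infinity>
                      else ereal (Inf {s. 0 \<le> s \<and> eta R Z \<omega> s > ennreal t}))"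

text \<open>X_t = Z_{eta^{-1}(t) /\ tau_0^-} (value infinity only in case of explosion)\<close>
definition tc_proc :: "(real \<Rightarrow> real) \<Rightarrow> (real \<Rightarrow> 'b \<Rightarrow> real) \<Rightarrow> 'b \<Rightarrow> real \<Rightarrow> ereal" where
  "tc_proc R Z \<omega> t = (let u = min (eta_inv R Z \<omega> t) (tau0 Z \<omega>) in
                       if u = \<infinity> then \<infinity> else ereal (Z (real_of_ereal u) \<omega>))"

definition Xpath :: "(real \<Rightarrow> real) \<Rightarrow> (real \<Rightarrow> 'b \<Rightarrow> real) \<Rightarrow> 'b \<Rightarrow> real \<Rightarrow> ereal" where
  "Xpath R Z \<omega> = restrict (tc_proc R Z \<omega>) {0..}"

text \<open>(M, Y) realizes P_infinity: a cadlag process on (0,infinity) started at infinity,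
  leaving it instantaneously, finite at positive times, and Markov with respect to its
  natural filtration with transition law that of X started from finite states, where the
  law of X from y is given by the time change of the Levy process (Lev y, Zs y).\<close>
definition P_infty_process ::
  "(real \<Rightarrow> real) \<Rightarrow> (real \<Rightarrow> 'b measure) \<Rightarrow> (real \<Rightarrow> real \<Rightarrow> 'b \<Rightarrow> real)
     \<Rightarrow> 'a measure \<Rightarrow> (real \<Rightarrow> 'a \<Rightarrow> ereal) \<Rightarrow> bool" where
  "P_infty_process R Lev Zs M Y \<longleftrightarrow> prob_space M \<and>
     (\<forall>t\<ge>0. Y t \<in> borel_measurable M) \<and>
     (\<forall>\<omega>\<in>space M. Y 0 \<omega> = \<infinity> \<and> (\<forall>t>0. Y t \<omega> < \<infinity>) \<and>
        ((\<lambda>t. Y t \<omega>) \<longlongrightarrow> \<infinity>) (at_right 0) \<and>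
        (\<forall>t>0. ((\<lambda>t. Y t \<omega>) \<longlongrightarrow> Y t \<omega>) (at_right t) \<and>
               (\<exists>l::real. ((\<lambda>t. Y t \<omega>) \<longlongrightarrow> ereal l) (at_left t)))) \<and>
     (\<forall>s>0. \<forall>A \<in> sigma_sets (space M)
                {Y r -` B \<inter> space M | r B. 0 \<le> r \<and> r \<le> s \<and> B \<in> sets (borel :: ereal measure)}.
        \<forall>f \<in> borel_measurable (PiM {0..} (\<lambda>_. borel :: ereal measure)).
          (\<integral>\<^sup>+ \<omega>. indicator A \<omega> * f (restrict (\<lambda>t. Y (s + t) \<omega>) {0..}) \<partial>M) =
          (\<integral>\<^sup>+ \<omega>. indicator A \<omega> *
              (\<integral>\<^sup>+ \<omega>'. f (Xpath R (Zs (real_of_ereal (Y s \<omega>))) \<omega>')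
                   \<partial>(Lev (real_of_ereal (Y s \<omega>)))) \<partial>M))"

definition regvar_at_top :: "(real \<Rightarrow> real) \<Rightarrow> real \<Rightarrow> bool" where
  "regvar_at_top f \<theta> \<longleftrightarrow> (\<forall>\<^sub>F x in at_top. f x > 0) \<and>
     (\<forall>c>0. ((\<lambda>x. f (c * x) / f x) \<longlongrightarrow> c powr \<theta>) at_top)"

definition regvar_at_0 :: "(real \<Rightarrow> real) \<Rightarrow> real \<Rightarrow> bool" where
  "regvar_at_0 f \<theta> \<longleftrightarrow> (\<forall>\<^sub>F x in at_right 0. f x > 0) \<and>
     (\<forall>c>0. ((\<lambda>x. f (c * x) / f x) \<longlongrightarrow> c powr \<theta>) (at_right 0))"

definition phi :: "real \<Rightarrow> (real \<Rightarrow> real) \<Rightarrow> real \<Rightarrow> real" where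
  "phi \<gamma> R b = (1 / \<gamma>) * (\<integral>x\<in>{b..}. 1 / R x \<partial>lborel)"

definition phi_inv :: "real \<Rightarrow> (real \<Rightarrow> real) \<Rightarrow> real \<Rightarrow> real" where
  "phi_inv \<gamma> R t = (THE b. b > 0 \<and> phi \<gamma> R b = t)"

definition Vfun :: "(real \<Rightarrow> real) \<Rightarrow> real \<Rightarrow> real \<Rightarrow> real" where
  "Vfun R z \<rho> = (SUP x\<in>{z..}. max (R x / R (x + \<rho> * z) - 1) 0)"

end

theory Submission
  imports Defs
begin

text \<open>
  Write \<open>\<psi> l = \<Psi> l - \<gamma> l\<close>; either moment hypothesis gives \<open>0 \<le> \<psi> l \<le> C l\<^sup>1\<^sup>+\<^sup>\<delta>\<close> near \<open>0\<close>
  for some \<open>\<delta> > 0\<close>, and this makes a deviation of size \<open>d c\<close> of the Levy process from its drift line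
  over a time of order \<open>c\<close> have probability \<open>O(c\<^sup>-\<^sup>\<delta>)\<close>. Restart the Levy process from \<open>y\<close> at the first
  integer times at which it is below \<open>y / 2 ^ k\<close>: the error probabilities are summable, so with probability
  close to \<open>1\<close>, uniformly in \<open>y\<close>, the path is nearly linear on all dyadic scales above a large level \<open>B\<close>.
  Since \<open>R\<close> varies regularly (uniformly on compacts), the time-change clock along such a path is
  \<open>\<phi> (Z u) - \<phi> y\<close> up to a small multiple of \<open>\<phi> (Z u)\<close>, that is \<open>\<phi> (X t) = \<phi> y + t\<close> up to a small relative error
  until \<open>X\<close> falls below \<open>B\<close>. Applying this from time \<open>s\<close> to \<open>y = X s\<close> under the law of the process started at
  infinity and letting \<open>s\<close> tend to \<open>0\<close> gives \<open>\<phi> (X t) / t \<longlonglongrightarrow> 1\<close>; regular variation of \<open>\<phi>\<close> turns this into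
  the asymptotics of \<open>X\<close>.
\<close>

section \<open>Regularly varying rates\<close>

text \<open>The passage \<open>s -> 0\<close> dictates the form of the estimates. The starting level
  \<open>Y s\<close> tends to infinity, so \<open>B\<close>, the tolerance \<open>d\<close> and the
  failure probability have to be chosen before it; and the clock error is measured against
  \<open>phi\<close> at the current point, because \<open>phi y\<close> vanishes in the limit. One
  maximal inequality for the whole descent would control deviations only relative to
  \<open>y\<close>, which says nothing near \<open>B\<close>; hence a separate inequality for each
  scale \<open>c = y / 2 ^ k\<close>. The failure probabilities grow geometrically as the scale
  shrinks, so the lowest scale, comparable to \<open>B\<close>, dominates their sum. Regular
  variation is given pointwise in the scaling factor, whereas a random path visits a whole
  neighbourhood of its line; the Baire argument extracts the missing uniformity from the continuity
  of \<open>R\<close>.\<close>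

lemma Baire_countable_cover:
  fixes F :: "nat \<Rightarrow> real set"
  assumes cl: "\<And>n. closed (F n)" and cov: "(\<Union>n. F n) = UNIV"
  shows "\<exists>n. interior (F n) \<noteq> {}"
proof (rule ccontr)
  assume "\<not> ?thesis"
  then have e: "interior (F n) = {}" for n by auto
  have "UNIV \<subseteq> closure (\<Inter> (range (\<lambda>n. - F n)))"
  proof (rule Baire)
    fix T assume "T \<in> range (\<lambda>n. - F n)"
    then obtain n where "T = - F n" by auto
    then show "openin (top_of_set UNIV) T \<and> UNIV \<subseteq> closure T"
      using cl[of n] e[of n] by (simp add: closure_complement open_Compl)
  qed auto
  moreover have "\<Inter> (range (\<lambda>n. - F n)) = {}" using cov by auto
  ultimately show False by simp
qed

text \<open>Uniform convergence theorem in additive form. The sets \<open>F n\<close> of shifts that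
  are accurate to \<open>e / 4\<close> from \<open>n\<close> on are closed and cover the line, so
  one of them contains a ball around some \<open>u\<close>. For small \<open>v\<close> the increment
  from \<open>x\<close> to \<open>x + v\<close> is the difference of the shifts by
  \<open>u + v\<close> and \<open>u\<close> from the common base point \<open>x - u\<close>.\<close>

lemma additive_slow_variation_uniform:
  fixes k :: "real \<Rightarrow> real"
  assumes cont: "continuous_on UNIV k"
    and lim: "\<And>u. ((\<lambda>x. k (x + u) - k x) \<longlongrightarrow> \<theta> * u) at_top" and "e > 0"
  obtains d X where "d > 0" "\<And>x v. x \<ge> X \<Longrightarrow> \<bar>v\<bar> \<le> d \<Longrightarrow> \<bar>k (x + v) - k x\<bar> \<le> e"
proof -
  define F where "F n = {u. \<forall>x\<ge>real n. \<bar>k (x + u) - k x - \<theta> * u\<bar> \<le> e / 4}" for n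
  have "closed (F n)" for n
  proof -
    have "F n = (\<Inter>x\<in>{real n..}. {u. \<bar>k (x + u) - k x - \<theta> * u\<bar> \<le> e / 4})"
      by (auto simp: F_def)
    moreover have "closed {u. \<bar>k (x + u) - k x - \<theta> * u\<bar> \<le> e / 4}" for x
      by (intro closed_Collect_le continuous_intros continuous_on_compose2[OF cont]) auto
    ultimately show ?thesis by auto
  qed
  moreover have "(\<Union>n. F n) = UNIV"
  proof -
    have "\<exists>n. u \<in> F n" for u
    proof -
      have "((\<lambda>x. k (x + u) - k x - \<theta> * u) \<longlongrightarrow> 0) at_top"
        using tendsto_diff[OF lim[of u] tendsto_const[of "\<theta> * u"]] by simp
      then have "\<forall>\<^sub>F x in at_top. \<bar>k (x + u) - k x - \<theta> * u\<bar> < e / 4"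
        using \<open>e > 0\<close> by (auto simp: tendsto_iff dist_real_def dest!: spec[of _ "e / 4"])
      then obtain N where N: "\<And>x. x \<ge> N \<Longrightarrow> \<bar>k (x + u) - k x - \<theta> * u\<bar> < e / 4"
        by (auto simp: eventually_at_top_linorder)
      obtain n :: nat where "N \<le> real n" using real_arch_simple by blast
      then have "u \<in> F n" using N unfolding F_def by (auto intro: less_imp_le)
      then show ?thesis ..
    qed
    then show ?thesis by auto
  qed
  ultimately obtain n where "interior (F n) \<noteq> {}" using Baire_countable_cover by blast
  then obtain u where "u \<in> interior (F n)" by auto
  then obtain r where r: "r > 0" "ball u r \<subseteq> F n" by (auto simp: mem_interior)
  \<comment> \<open>The first term keeps \<open>u + v\<close> in the ball; the second bounds the
    linear part \<open>\<theta> * v\<close> by \<open>e / 2\<close>.\<close>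
  define d where "d = min (r / 2) (e / (2 * (\<bar>\<theta>\<bar> + 1)))"
  have d: "d > 0" using r \<open>e > 0\<close> by (auto simp: d_def)
  show ?thesis
  proof (rule that[OF d, of "real n + u"])
    fix x v :: real assume x: "real n + u \<le> x" and v: "\<bar>v\<bar> \<le> d"
    have "u \<in> F n" "u + v \<in> F n" using r v by (auto simp: d_def subset_iff dist_real_def)
    then have "\<forall>y\<ge>real n. \<bar>k (y + u) - k y - \<theta> * u\<bar> \<le> e / 4"
      "\<forall>y\<ge>real n. \<bar>k (y + (u + v)) - k y - \<theta> * (u + v)\<bar> \<le> e / 4"
      by (auto simp: F_def)
    from this[THEN spec[of _ "x - u"]] have 1: "\<bar>k x - k (x - u) - \<theta> * u\<bar> \<le> e / 4"
      "\<bar>k (x + v) - k (x - u) - \<theta> * (u + v)\<bar> \<le> e / 4"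
      using x by (simp_all add: algebra_simps)
    have "\<bar>\<theta> * v\<bar> \<le> (\<bar>\<theta>\<bar> + 1) * d"
      unfolding abs_mult using v by (intro mult_mono) auto
    also have "\<dots> \<le> (\<bar>\<theta>\<bar> + 1) * (e / (2 * (\<bar>\<theta>\<bar> + 1)))"
      by (intro mult_left_mono) (auto simp: d_def)
    also have "\<dots> = e / 2" by (simp add: field_simps)
    finally have 2: "\<bar>\<theta> * v\<bar> \<le> e / 2" .
    show "\<bar>k (x + v) - k x\<bar> \<le> e" using 1 2 unfolding distrib_left by linarith
  qed
qed

locale regular_rate =
  fixes \<gamma> \<theta> :: real and R :: "real \<Rightarrow> real"
  assumes \<gamma>: "\<gamma> > 0" and R_cont: "continuous_on {0..} R" and R_pos: "\<And>x. x > 0 \<Longrightarrow> R x > 0"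
    and \<theta>: "\<theta> > 1" and R_rv: "regvar_at_top R \<theta>"
begin

lemma R_lim: "c > 0 \<Longrightarrow> ((\<lambda>x. R (c * x) / R x) \<longlongrightarrow> c powr \<theta>) at_top"
  using R_rv by (auto simp: regvar_at_top_def)

text \<open>In the logarithmic coordinates \<open>k x = ln (R (exp x))\<close> regular variation
  becomes convergence of additive increments, and closeness of \<open>y / x\<close> to 1 becomes a
  small shift.\<close>

lemma R_ratio_near_1:
  assumes "e > 0"
  obtains d X where "d > 0" "d < 1" "X > 0"
    "\<And>x y. x \<ge> X \<Longrightarrow> \<bar>y - x\<bar> \<le> d * x \<Longrightarrow> \<bar>R x / R y - 1\<bar> \<le> e"
proof -
  define k where "k x = ln (R (exp x))" for x
  have 1: "continuous_on UNIV k"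
    unfolding k_def using R_pos[OF exp_gt_zero]
    by (intro continuous_intros continuous_on_compose2[OF R_cont]) (auto simp: less_imp_neq[symmetric])
  have 2: "((\<lambda>x. k (x + u) - k x) \<longlongrightarrow> \<theta> * u) at_top" for u
  proof -
    have "((\<lambda>x. ln (R (exp u * exp x) / R (exp x))) \<longlongrightarrow> ln (exp u powr \<theta>)) at_top"
      by (intro tendsto_ln filterlim_compose[OF R_lim exp_at_top]) auto
    moreover have "ln (R (exp u * exp x) / R (exp x)) = k (x + u) - k x" for x
      unfolding k_def using R_pos[OF exp_gt_zero, of x] R_pos[of "exp u * exp x"]
      by (simp add: ln_div exp_add mult.commute)
    ultimately show ?thesis by (simp add: powr_def)
  qed
  have "((\<lambda>w::real. exp w) \<longlongrightarrow> exp 0) (at 0)" by (intro tendsto_intros)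
  then obtain e' where e': "e' > 0" "\<And>w::real. w \<noteq> 0 \<Longrightarrow> \<bar>w\<bar> < e' \<Longrightarrow> \<bar>exp w - 1\<bar> < e"
    using assms by (auto simp: LIM_def dist_real_def)
  have e'2: "\<bar>exp w - 1\<bar> < e" if "\<bar>w\<bar> < e'" for w :: real
    using e'(2)[of w] that assms by (cases "w = 0") auto
  obtain d X where d: "d > 0" "\<And>x v. x \<ge> X \<Longrightarrow> \<bar>v\<bar> \<le> d \<Longrightarrow> \<bar>k (x + v) - k x\<bar> \<le> e' / 2"
    using additive_slow_variation_uniform[OF 1 2, of "e' / 2"] e' by auto
  have "((\<lambda>w::real. ln w) \<longlongrightarrow> ln 1) (at 1)" by (intro tendsto_intros) auto
  then obtain d' where d': "d' > 0" "\<And>w::real. w \<noteq> 1 \<Longrightarrow> \<bar>w - 1\<bar> < d' \<Longrightarrow> \<bar>ln w\<bar> < d"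
    using d(1) by (auto simp: LIM_def dist_real_def)
  have d'2: "\<bar>ln w\<bar> < d" if "\<bar>w - 1\<bar> < d'" for w :: real
    using d'(2)[of w] that d(1) by (cases "w = 1") auto
  \<comment> \<open>The cap \<open>1 / 2\<close> keeps \<open>y\<close> positive, so that its
    logarithm makes sense.\<close>
  define d2 where "d2 = min (d' / 2) (1 / 2)"
  show ?thesis
  proof (rule that[of d2 "exp X"])
    fix x y assume x: "exp X \<le> x" and y: "\<bar>y - x\<bar> \<le> d2 * x"
    have xp: "x > 0" using x by (meson exp_gt_zero less_le_trans)
    have "d2 * x \<le> (1 / 2) * x" using xp by (intro mult_right_mono) (auto simp: d2_def)
    then have yp: "y > 0" using y xp by linarith
    have "\<bar>y / x - 1\<bar> = \<bar>y - x\<bar> / x" using xp by (simp add: field_simps abs_divide)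
    also have "\<dots> \<le> d2" using y xp by (simp add: field_simps)
    also have "\<dots> < d'" using d'(1) by (simp add: d2_def)
    finally have "\<bar>ln (y / x)\<bar> < d" by (rule d'2)
    moreover have "X \<le> ln x" using x xp by (simp add: ln_ge_iff)
    ultimately have "\<bar>k (ln x + ln (y / x)) - k (ln x)\<bar> \<le> e' / 2" by (intro d(2)) auto
    moreover have "ln x + ln (y / x) = ln y" using xp yp by (simp add: ln_div)
    moreover have "k (ln x) - k (ln y) = ln (R x / R y)"
      using xp yp R_pos[OF xp] R_pos[OF yp] by (simp add: k_def ln_div)
    ultimately have "\<bar>ln (R x / R y)\<bar> < e'" using e'(1) by (simp add: abs_minus_commute)
    then have "\<bar>exp (ln (R x / R y)) - 1\<bar> < e" by (rule e'2)
    then show "\<bar>R x / R y - 1\<bar> \<le> e" using R_pos[OF xp] R_pos[OF yp] by simp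
  qed (use d' in \<open>auto simp: d2_def\<close>)
qed

end

text \<open>Ratio test over dyadic blocks: the substitution \<open>x -> 2 * x\<close> bounds the
  part beyond \<open>2 * x0\<close> by \<open>q\<close> times the whole, so the integrals stay below
  the fixed point of \<open>M = g1 + q * M\<close>. The argument runs on the truncations
  \<open>G n\<close>, because an infinite integral would satisfy the same inequality.\<close>

lemma nn_integral_doubling_finite:
  fixes g :: "real \<Rightarrow> real"
  assumes cont: "continuous_on UNIV g" and nn: "\<And>x. g x \<ge> 0" and x0: "x0 > 0"
    and q: "0 \<le> q" "q < 1" and le: "\<And>x. x \<ge> x0 \<Longrightarrow> 2 * g (2 * x) \<le> q * g x"
  shows "(\<integral>\<^sup>+x. ennreal (g x) * indicator {x0..} x \<partial>lborel) < \<infinity>"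
proof -
  have [measurable]: "g \<in> borel_measurable borel" using cont by (rule borel_measurable_continuous_onI)
  define G where "G n = (\<integral>\<^sup>+x. ennreal (g x) * indicator {x0..2^n*x0} x \<partial>lborel)" for n :: nat
  have "set_integrable lborel {x0..2*x0} g"
    by (intro borel_integrable_atLeastAtMost') (auto intro: continuous_on_subset[OF cont])
  then have "integrable lborel (\<lambda>x. g x * indicator {x0..2*x0} x)"
    by (simp add: set_integrable_def mult.commute)
  then have "(\<integral>\<^sup>+x. ennreal (g x * indicator {x0..2*x0} x) \<partial>lborel) < \<infinity>"
    using nn by (subst nn_integral_eq_integral) auto
  then have "G 1 < \<infinity>" by (simp add: G_def ennreal_mult' nn ennreal_indicator)
  then obtain g1 where g1: "g1 \<ge> 0" "G 1 = ennreal g1"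
    by (metis ennreal_cases less_irrefl infinity_ennreal_def)
  define M where "M = g1 / (1 - q)"
  have M: "M \<ge> 0" "g1 + q * M = M" using g1 q by (auto simp: M_def field_simps)
  have G: "G n \<le> ennreal M" for n
  proof (induction n)
    case 0
    have "G 0 \<le> G 1" unfolding G_def using x0
      by (intro nn_integral_mono) (auto simp: indicator_def)
    also have "\<dots> \<le> ennreal M" unfolding g1 M_def using g1 q
      by (intro ennreal_leI) (simp add: field_simps mult_left_le)
    finally show ?case .
  next
    case (Suc n)
    have "G (Suc n) \<le> (\<integral>\<^sup>+x. ennreal (g x) * indicator {x0..2*x0} x
        + ennreal (g x) * indicator {2*x0..2^Suc n*x0} x \<partial>lborel)"
      unfolding G_def by (intro nn_integral_mono) (auto simp: indicator_def)
    also have "\<dots> = G 1 + (\<integral>\<^sup>+x. ennreal (g x) * indicator {2*x0..2^Suc n*x0} x \<partial>lborel)"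
      unfolding G_def by (subst nn_integral_add) auto
    also have "(\<integral>\<^sup>+x. ennreal (g x) * indicator {2*x0..2^Suc n*x0} x \<partial>lborel)
        = 2 * (\<integral>\<^sup>+x. ennreal (g (2*x)) * indicator {2*x0..2^Suc n*x0} (2*x) \<partial>lborel)"
      by (subst nn_integral_real_affine[where c=2 and t=0]) auto
    also have "\<dots> = (\<integral>\<^sup>+x. 2 * (ennreal (g (2*x)) * indicator {2*x0..2^Suc n*x0} (2*x)) \<partial>lborel)"
      by (subst nn_integral_cmult) auto
    also have "\<dots> \<le> (\<integral>\<^sup>+x. ennreal q * (ennreal (g x) * indicator {x0..2^n*x0} x) \<partial>lborel)"
    proof (intro nn_integral_mono)
      fix x
      have "2 * ennreal (g (2*x)) \<le> ennreal q * ennreal (g x)" if "x \<ge> x0"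
        using ennreal_leI[OF le[OF that]] nn q by (simp add: ennreal_mult)
      then show "2 * (ennreal (g (2*x)) * indicator {2*x0..2^Suc n*x0} (2*x))
        \<le> ennreal q * (ennreal (g x) * indicator {x0..2^n*x0} x)"
        by (auto simp: indicator_def)
    qed
    also have "\<dots> = ennreal q * G n" unfolding G_def by (subst nn_integral_cmult) auto
    also have "G 1 + ennreal q * G n \<le> ennreal g1 + ennreal q * ennreal M"
      unfolding g1 using Suc by (intro add_left_mono mult_left_mono) auto
    also have "\<dots> = ennreal M" using M g1 q
      by (metis ennreal_mult ennreal_plus mult_nonneg_nonneg)
    finally show ?case by (simp add: add_left_mono)
  qed
  have "(\<integral>\<^sup>+x. ennreal (g x) * indicator {x0..} x \<partial>lborel)
      = (\<integral>\<^sup>+x. (SUP n. ennreal (g x) * indicator {x0..2^n*x0} x) \<partial>lborel)"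
  proof (intro nn_integral_cong antisym)
    fix x
    obtain n :: nat where n: "x / x0 < 2^n" using real_arch_pow[of 2 "x / x0"] by auto
    show "ennreal (g x) * indicator {x0..} x \<le> (SUP n. ennreal (g x) * indicator {x0..2^n*x0} x)"
      by (rule SUP_upper2[of n]) (use n x0 in \<open>auto simp: indicator_def field_simps\<close>)
    show "(SUP n. ennreal (g x) * indicator {x0..2^n*x0} x) \<le> ennreal (g x) * indicator {x0..} x"
      by (rule SUP_least) (auto simp: indicator_def)
  qed
  also have "\<dots> = (SUP n. G n)"
    unfolding G_def
  proof (rule nn_integral_monotone_convergence_SUP)
    show "incseq (\<lambda>n x. ennreal (g x) * indicator {x0..2^n*x0} x)"
    proof (intro incseq_SucI le_funI)
      fix n x
      have "2 ^ n * x0 \<le> 2 ^ Suc n * x0" using x0 by simp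
      then show "ennreal (g x) * indicator {x0..2^n*x0} x \<le> ennreal (g x) * indicator {x0..2^Suc n*x0} x"
        by (intro mult_left_mono) (auto simp: indicator_def)
    qed
  qed auto
  also have "\<dots> \<le> ennreal M" by (intro SUP_least G)
  finally show ?thesis by (simp add: le_less_trans)
qed

section \<open>The function \<open>phi\<close>: convergence, regular variation, inversion, and the
  clock along nearly linear paths\<close>

context regular_rate
begin

text \<open>Freezing the argument at \<open>b\<close> gives continuity on the whole line, hence
  Borel measurability, although \<open>R\<close> is only controlled on a half-line.\<close>

lemma R_scaled_cont: "b > 0 \<Longrightarrow> continuous_on UNIV (\<lambda>x. 1 / R (max b x))"
  using R_pos by (intro continuous_intros continuous_on_compose2[OF R_cont])
    (auto simp: less_imp_neq[symmetric] max_def)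

lemma inv_R_cont: "a > 0 \<Longrightarrow> continuous_on {a..b} (\<lambda>x. 1 / R x)"
  by (rule continuous_on_cong[THEN iffD1, OF refl _ continuous_on_subset[OF R_scaled_cont[of a] subset_UNIV]])
     (auto simp: max_def)

text \<open>The factor \<open>c\<close> is the Jacobian of \<open>x -> c * x\<close>: with it the
  inequality integrates directly into one for \<open>phi\<close>, with index
  \<open>1 - \<theta>\<close>.\<close>

lemma R_ratio_less:
  assumes "c > 0" "M > c powr (1 - \<theta>)"
  obtains X where "X > 0" "\<And>x. x \<ge> X \<Longrightarrow> c / R (c * x) \<le> M * (1 / R x)"
proof -
  have "((\<lambda>x. c / (R (c * x) / R x)) \<longlongrightarrow> c / c powr \<theta>) at_top"
    using assms by (intro tendsto_intros R_lim) auto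
  moreover have "c / c powr \<theta> < M" using assms by (simp add: powr_diff)
  ultimately have "\<forall>\<^sub>F x in at_top. c / (R (c * x) / R x) < M" by (rule order_tendstoD)
  then obtain X where X: "\<And>x. x \<ge> X \<Longrightarrow> c / (R (c * x) / R x) < M"
    by (auto simp: eventually_at_top_linorder)
  show ?thesis
  proof (rule that[of "max X 1"])
    fix x assume "max X 1 \<le> x"
    then have "c / (R (c * x) / R x) < M" "R x > 0" "R (c * x) > 0" using X R_pos assms by auto
    then show "c / R (c * x) \<le> M * (1 / R x)" by (simp add: field_simps)
  qed auto
qed

lemma R_ratio_greater:
  assumes "c > 0" "M < c powr (1 - \<theta>)"
  obtains X where "X > 0" "\<And>x. x \<ge> X \<Longrightarrow> M * (1 / R x) \<le> c / R (c * x)"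
proof -
  have "((\<lambda>x. c / (R (c * x) / R x)) \<longlongrightarrow> c / c powr \<theta>) at_top"
    using assms by (intro tendsto_intros R_lim) auto
  moreover have "M < c / c powr \<theta>" using assms by (simp add: powr_diff)
  ultimately have "\<forall>\<^sub>F x in at_top. M < c / (R (c * x) / R x)" by (rule order_tendstoD)
  then obtain X where X: "\<And>x. x \<ge> X \<Longrightarrow> M < c / (R (c * x) / R x)"
    by (auto simp: eventually_at_top_linorder)
  show ?thesis
  proof (rule that[of "max X 1"])
    fix x assume "max X 1 \<le> x"
    then have "M < c / (R (c * x) / R x)" "R x > 0" "R (c * x) > 0" using X R_pos assms by auto
    then show "M * (1 / R x) \<le> c / R (c * x)" by (simp add: field_simps)
  qed auto
qed

lemma inv_R_integrable_compact: "a > 0 \<Longrightarrow> set_integrable lborel {a..b} (\<lambda>x. 1 / R x)"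
  by (intro borel_integrable_atLeastAtMost' inv_R_cont)

lemma inv_R_integrable:
  assumes b: "b > 0" shows "set_integrable lborel {b..} (\<lambda>x. 1 / R x)"
proof -
  \<comment> \<open>Any number strictly between \<open>2 powr (1 - \<theta>)\<close> and 1 serves;
    the gap exists because \<open>\<theta> > 1\<close>, and it makes the integral converge.\<close>
  define q where "q = (1 + 2 powr (1 - \<theta>)) / 2"
  have "2 powr (1 - \<theta>) < (2::real) powr 0" using \<theta> by (intro powr_less_mono) auto
  then have q: "2 powr (1 - \<theta>) < q" "0 \<le> q" "q < 1"
    using powr_gt_zero[of 2 "1-\<theta>"] by (auto simp: q_def)
  obtain X where X: "X > 0" "\<And>x. x \<ge> X \<Longrightarrow> 2 / R (2 * x) \<le> q * (1 / R x)"
    using R_ratio_less[of 2 q] q by auto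
  define g where "g x = 1 / R (max X x)" for x
  have "set_integrable lborel {X..} g"
  proof -
    have cg: "continuous_on UNIV g" unfolding g_def by (rule R_scaled_cont[OF X(1)])
    have [measurable]: "g \<in> borel_measurable borel" by (rule borel_measurable_continuous_onI[OF cg])
    have nn: "g x \<ge> 0" for x unfolding g_def using R_pos[of "max X x"] X(1) by (simp add: less_imp_le)
    have "(\<integral>\<^sup>+x. ennreal (g x) * indicator {X..} x \<partial>lborel) < \<infinity>"
    proof (rule nn_integral_doubling_finite[OF cg nn X(1) q(2,3)])
      fix x assume x: "x \<ge> X"
      then have "max X (2 * x) = 2 * x" "max X x = x" using X(1) by auto
      then show "2 * g (2 * x) \<le> q * g x" using X(2)[OF x] by (simp add: g_def)
    qed
    moreover have "ennreal (norm (indicator {X..} x *\<^sub>R g x)) = ennreal (g x) * indicator {X..} x" for x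
      using nn by (auto simp: indicator_def)
    ultimately show ?thesis unfolding set_integrable_def by (intro integrableI_bounded) simp_all
  qed
  then have "set_integrable lborel {X..} (\<lambda>x. 1 / R x)"
    by (rule set_integrable_cong[THEN iffD1, rotated -1]) (auto simp: g_def max_def)
  from set_integrable_Un[OF this inv_R_integrable_compact[OF b, of X]]
  have "set_integrable lborel ({X..} \<union> {b..X}) (\<lambda>x. 1 / R x)" by auto
  then show ?thesis by (rule set_integrable_subset) (auto)
qed

lemma phi_diff:
  assumes "0 < a" "a \<le> b"
  shows "phi \<gamma> R a - phi \<gamma> R b = (1 / \<gamma>) * integral {a..b} (\<lambda>x. 1 / R x)"
proof -
  have eq: "{a..} = {a..b} \<union> {b<..}" using assms by auto
  have i1: "set_integrable lborel {a..b} (\<lambda>x. 1 / R x)" using inv_R_integrable_compact assms by auto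
  have i2: "set_integrable lborel {b<..} (\<lambda>x. 1 / R x)"
    by (rule set_integrable_subset[OF inv_R_integrable[of b]]) (use assms in auto)
  have "(LINT x:{a..}|lborel. 1 / R x) = (LINT x:{a..b}|lborel. 1 / R x) + (LINT x:{b<..}|lborel. 1 / R x)"
    unfolding eq by (intro set_integral_Un i1 i2) auto
  also have "(LINT x:{b<..}|lborel. 1 / R x) = (LINT x:{b..}|lborel. 1 / R x)"
    unfolding set_lebesgue_integral_def
  proof (rule integral_cong_AE)
    show "(\<lambda>x. indicat_real {b<..} x *\<^sub>R (1 / R x)) \<in> borel_measurable lborel"
      using i2 by (simp add: set_integrable_def)
    show "(\<lambda>x. indicat_real {b..} x *\<^sub>R (1 / R x)) \<in> borel_measurable lborel"
      using inv_R_integrable[of b] assms by (simp add: set_integrable_def)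
    show "AE x in lborel. indicat_real {b<..} x *\<^sub>R (1 / R x) = indicat_real {b..} x *\<^sub>R (1 / R x)"
      using AE_lborel_singleton[of b] by eventually_elim (auto simp: indicator_def)
  qed
  also have "(LINT x:{a..b}|lborel. 1 / R x) = integral {a..b} (\<lambda>x. 1 / R x)"
    by (rule set_borel_integral_eq_integral(2)[OF i1])
  finally show ?thesis by (simp add: phi_def algebra_simps)
qed

lemma phi_deriv:
  assumes x: "x > 0" shows "(phi \<gamma> R has_real_derivative - 1 / (\<gamma> * R x)) (at x)"
proof -
  \<comment> \<open>The base point \<open>x / 2\<close> and the right end \<open>x + 1\<close> put
    \<open>x\<close> in the interior, so the derivative is two-sided.\<close>
  have "((\<lambda>v. integral {x/2..v} (\<lambda>x. 1 / R x)) has_real_derivative 1 / R x) (at x within {x/2..x+1})"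
    using x by (intro integral_has_real_derivative inv_R_cont) auto
  moreover have "at x within {x/2..x+1} = at x"
    by (rule at_within_interior) (use x in \<open>simp add: interior_atLeastAtMost_real\<close>)
  ultimately have "((\<lambda>v. integral {x/2..v} (\<lambda>x. 1 / R x)) has_real_derivative 1 / R x) (at x)" by simp
  then have "((\<lambda>v. phi \<gamma> R (x/2) - (1 / \<gamma>) * integral {x/2..v} (\<lambda>x. 1 / R x)) has_real_derivative
      0 - (1 / \<gamma>) * (1 / R x)) (at x)"
    by (intro DERIV_diff DERIV_cmult DERIV_const)
  then have "((\<lambda>v. phi \<gamma> R (x/2) - (1 / \<gamma>) * integral {x/2..v} (\<lambda>x. 1 / R x)) has_real_derivative
      - 1 / (\<gamma> * R x)) (at x)" by simp
  then show ?thesis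
  proof (rule DERIV_cong_ev[THEN iffD1, rotated -1])
    show "\<forall>\<^sub>F v in nhds x. phi \<gamma> R (x/2) - (1 / \<gamma>) * integral {x/2..v} (\<lambda>x. 1 / R x) = phi \<gamma> R v"
    proof (rule eventually_mono)
      show "\<forall>\<^sub>F v in nhds x. v \<in> {x/2<..}" by (rule eventually_nhds_in_open) (use x in auto)
      fix v assume "v \<in> {x/2<..}"
      then show "phi \<gamma> R (x/2) - (1 / \<gamma>) * integral {x/2..v} (\<lambda>x. 1 / R x) = phi \<gamma> R v"
        using phi_diff[of "x/2" v] x by simp
    qed
  qed auto
qed

lemma phi_strict_antimono:
  assumes "0 < a" "a < b" shows "phi \<gamma> R b < phi \<gamma> R a"
proof (rule DERIV_neg_imp_decreasing[OF assms(2)])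
  fix x assume "a \<le> x" "x \<le> b"
  then show "\<exists>y. (phi \<gamma> R has_real_derivative y) (at x) \<and> y < 0"
    using assms \<gamma> R_pos[of x] phi_deriv[of x] by (intro exI[of _ "- 1 / (\<gamma> * R x)"]) auto
qed

lemma phi_antimono: "0 < a \<Longrightarrow> a \<le> b \<Longrightarrow> phi \<gamma> R b \<le> phi \<gamma> R a"
  using phi_strict_antimono[of a b] by (cases "a = b") auto

lemma phi_nonneg: "0 < a \<Longrightarrow> 0 \<le> phi \<gamma> R a"
  unfolding phi_def set_lebesgue_integral_def using \<gamma> R_pos
  by (intro mult_nonneg_nonneg integral_nonneg) (auto simp: indicator_def less_imp_le)

lemma phi_pos: "0 < a \<Longrightarrow> 0 < phi \<gamma> R a"
  using phi_strict_antimono[of a "a+1"] phi_nonneg[of "a+1"] by simp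

lemma phi_less_iff: "0 < a \<Longrightarrow> 0 < b \<Longrightarrow> phi \<gamma> R a < phi \<gamma> R b \<longleftrightarrow> b < a"
  by (meson phi_antimono phi_strict_antimono not_le)

lemma phi_cont: "a > 0 \<Longrightarrow> continuous_on {a..} (phi \<gamma> R)"
  by (intro continuous_at_imp_continuous_on ballI DERIV_isCont[OF phi_deriv]) auto

lemma phi_scale:
  assumes "c > 0" shows "phi \<gamma> R (c * b) = (1 / \<gamma>) * (\<integral>x\<in>{b..}. c / R (c * x) \<partial>lborel)"
proof -
  have "(LINT x:{c * b..}|lborel. 1 / R x) = c * (LINT x|lborel. indicat_real {c * b..} (c * x) *\<^sub>R (1 / R (c * x)))"
    unfolding set_lebesgue_integral_def
    using lborel_integral_real_affine[of c "\<lambda>x. indicat_real {c * b..} x *\<^sub>R (1 / R x)" 0] assms by simp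
  also have "\<dots> = (LINT x:{b..}|lborel. c / R (c * x))"
    unfolding set_lebesgue_integral_def
    by (subst integral_mult_right_zero[symmetric], rule Bochner_Integration.integral_cong)
      (use assms in \<open>auto simp: indicator_def\<close>)
  finally show ?thesis by (simp add: phi_def)
qed

lemma scaled_integrable:
  assumes "c > 0" "b > 0" shows "set_integrable lborel {b..} (\<lambda>x. c / R (c * x))"
proof -
  have "integrable lborel (\<lambda>x. indicat_real {c * b..} x *\<^sub>R (1 / R x))"
    using inv_R_integrable[of "c*b"] assms by (simp add: set_integrable_def)
  from lborel_integrable_real_affine[OF this, of c 0]
  have "integrable lborel (\<lambda>x. indicat_real {c * b..} (c * x) *\<^sub>R (1 / R (c * x)))" using assms by simp
  then have "integrable lborel (\<lambda>x. c * (indicat_real {c * b..} (c * x) *\<^sub>R (1 / R (c * x))))"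
    by (rule integrable_mult_right)
  then show ?thesis unfolding set_integrable_def
    by (rule Bochner_Integration.integrable_cong[THEN iffD1, OF refl, rotated]) (use assms in \<open>auto simp: indicator_def\<close>)
qed

text \<open>The pointwise comparison is integrated after the substitution. Together with
  \<open>phi_scale_lower\<close> this is regular variation of \<open>phi\<close> with index
  \<open>1 - \<theta>\<close>.\<close>

lemma phi_scale_upper:
  assumes "c > 0" "M > c powr (1 - \<theta>)"
  obtains X where "X > 0" "\<And>x. x \<ge> X \<Longrightarrow> phi \<gamma> R (c * x) \<le> M * phi \<gamma> R x"
proof -
  obtain X where X: "X > 0" "\<And>x. x \<ge> X \<Longrightarrow> c / R (c * x) \<le> M * (1 / R x)"
    using R_ratio_less[OF assms] by metis
  show ?thesis
  proof (rule that[OF X(1)])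
    fix b assume b: "X \<le> b"
    have "(\<integral>x\<in>{b..}. c / R (c * x) \<partial>lborel) \<le> (\<integral>x\<in>{b..}. M * (1 / R x) \<partial>lborel)"
      by (rule set_integral_mono) (use X b assms in \<open>auto intro!: scaled_integrable inv_R_integrable simp del: times_divide_eq_right\<close>)
    also have "\<dots> = M * (\<integral>x\<in>{b..}. 1 / R x \<partial>lborel)" by (simp only: set_integral_mult_right)
    finally have "(1 / \<gamma>) * (\<integral>x\<in>{b..}. c / R (c * x) \<partial>lborel) \<le> (1 / \<gamma>) * (M * (\<integral>x\<in>{b..}. 1 / R x \<partial>lborel))"
      using \<gamma> by (intro mult_left_mono) auto
    then show "phi \<gamma> R (c * b) \<le> M * phi \<gamma> R b"
      unfolding phi_scale[OF assms(1)] by (simp add: phi_def)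
  qed
qed

lemma phi_scale_lower:
  assumes "c > 0" "M < c powr (1 - \<theta>)"
  obtains X where "X > 0" "\<And>x. x \<ge> X \<Longrightarrow> M * phi \<gamma> R x \<le> phi \<gamma> R (c * x)"
proof -
  obtain X where X: "X > 0" "\<And>x. x \<ge> X \<Longrightarrow> M * (1 / R x) \<le> c / R (c * x)"
    using R_ratio_greater[OF assms] by metis
  show ?thesis
  proof (rule that[OF X(1)])
    fix b assume b: "X \<le> b"
    have "M * (\<integral>x\<in>{b..}. 1 / R x \<partial>lborel) = (\<integral>x\<in>{b..}. M * (1 / R x) \<partial>lborel)"
      by (simp only: set_integral_mult_right)
    also have "\<dots> \<le> (\<integral>x\<in>{b..}. c / R (c * x) \<partial>lborel)"
      by (rule set_integral_mono) (use X b assms in \<open>auto intro!: scaled_integrable inv_R_integrable simp del: times_divide_eq_right\<close>)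
    finally have "(1 / \<gamma>) * (M * (\<integral>x\<in>{b..}. 1 / R x \<partial>lborel)) \<le> (1 / \<gamma>) * (\<integral>x\<in>{b..}. c / R (c * x) \<partial>lborel)"
      using \<gamma> by (intro mult_left_mono) auto
    then show "M * phi \<gamma> R b \<le> phi \<gamma> R (c * b)"
      unfolding phi_scale[OF assms(1)] by (simp add: phi_def)
  qed
qed

text \<open>Each doubling of the argument contracts \<open>phi\<close> by a factor
  \<open>q < 1\<close>; monotonicity fills the gaps between the points
  \<open>2 ^ n * X\<close>.\<close>

lemma phi_tendsto_0: "(phi \<gamma> R \<longlongrightarrow> 0) at_top"
proof -
  have "2 powr (1 - \<theta>) < (2::real) powr 0" using \<theta> by (intro powr_less_mono) auto
  then obtain q where q: "2 powr (1 - \<theta>) < q" "q < 1" using dense by auto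
  have q0: "0 < q" using q(1) powr_gt_zero[of 2 "1-\<theta>"] by linarith
  obtain X where X: "X > 0" "\<And>x. x \<ge> X \<Longrightarrow> phi \<gamma> R (2 * x) \<le> q * phi \<gamma> R x"
    using phi_scale_upper[OF _ q(1)] by auto
  have b: "phi \<gamma> R (2 ^ n * X) \<le> q ^ n * phi \<gamma> R X" for n
  proof (induction n)
    case (Suc n)
    have "X \<le> 2 ^ n * X" using X(1) by simp
    then have "phi \<gamma> R (2 * (2 ^ n * X)) \<le> q * phi \<gamma> R (2 ^ n * X)" by (rule X(2))
    also have "\<dots> \<le> q * (q ^ n * phi \<gamma> R X)" using Suc q0 by (intro mult_left_mono) auto
    finally show ?case by (simp add: mult_ac)
  qed simp
  have "(\<lambda>n. q ^ n * phi \<gamma> R X) \<longlonglongrightarrow> 0"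
    using q q0 by (intro tendsto_mult_left_zero LIMSEQ_realpow_zero) auto
  show ?thesis
  proof (rule order_tendstoI)
    fix a :: real assume "a < 0"
    then show "\<forall>\<^sub>F x in at_top. a < phi \<gamma> R x"
      by (intro eventually_mono[OF eventually_gt_at_top[of 0]]) (use phi_nonneg in \<open>auto intro: less_le_trans\<close>)
  next
    fix a :: real assume "0 < a"
    then obtain n where n: "q ^ n * phi \<gamma> R X < a"
      using order_tendstoD(2)[OF \<open>(\<lambda>n. q ^ n * phi \<gamma> R X) \<longlonglongrightarrow> 0\<close>] by (auto simp: eventually_sequentially)
    show "\<forall>\<^sub>F x in at_top. phi \<gamma> R x < a"
      using eventually_ge_at_top[of "2 ^ n * X"]
    proof eventually_elim
      case (elim x)
      have "phi \<gamma> R x \<le> phi \<gamma> R (2 ^ n * X)" using X(1) elim by (intro phi_antimono) auto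
      then show ?case using b[of n] n by linarith
    qed
  qed
qed

text \<open>The definite description is legitimate: the intermediate value theorem yields a solution
  beyond \<open>B\<close>, strict monotonicity makes it the only one.\<close>

lemma phi_inv:
  assumes t: "0 < t" "t \<le> phi \<gamma> R B" and B: "B > 0"
  shows "phi_inv \<gamma> R t \<ge> B" "phi \<gamma> R (phi_inv \<gamma> R t) = t"
proof -
  have "\<forall>\<^sub>F x in at_top. phi \<gamma> R x < t" using order_tendstoD(2)[OF phi_tendsto_0 t(1)] .
  then obtain c where c: "c \<ge> B" "phi \<gamma> R c < t"
    by (metis eventually_at_top_linorder nle_le)
  have "\<exists>b\<ge>B. b \<le> c \<and> phi \<gamma> R b = t"
    by (rule IVT2') (use c t B in \<open>auto intro: continuous_on_subset[OF phi_cont]\<close>)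
  then obtain b where b: "b \<ge> B" "phi \<gamma> R b = t" by auto
  have "phi_inv \<gamma> R t = b" unfolding phi_inv_def
  proof (rule the_equality)
    fix b' assume "0 < b' \<and> phi \<gamma> R b' = t"
    then show "b' = b" using b B phi_strict_antimono[of b b'] phi_strict_antimono[of b' b]
      by (cases b b' rule: linorder_cases) auto
  qed (use b B in auto)
  then show "phi_inv \<gamma> R t \<ge> B" "phi \<gamma> R (phi_inv \<gamma> R t) = t" using b by auto
qed

lemma phi_inv_eventually:
  assumes B: "B > 0"
  shows "\<forall>\<^sub>F t in at_right 0. phi_inv \<gamma> R t \<ge> B \<and> phi \<gamma> R (phi_inv \<gamma> R t) = t"
proof -
  have "\<forall>\<^sub>F t in at_right 0. t \<in> {0<..<phi \<gamma> R B}" using phi_pos[OF B] by (rule eventually_at_right_real)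
  then show ?thesis by eventually_elim (use phi_inv[OF _ _ B] in auto)
qed

text \<open>Since \<open>phi\<close> decreases, comparing \<open>g t\<close> with
  \<open>a * phi_inv t\<close> amounts to comparing \<open>phi (g t)\<close>, about
  \<open>c * t\<close>, with \<open>phi (a * phi_inv t)\<close>, about
  \<open>a powr (1 - \<theta>) * t\<close>. The critical \<open>a\<close> solves
  \<open>a powr (1 - \<theta>) = c\<close>. The case \<open>c = 1\<close> serves the process,
  general \<open>c\<close> the index of \<open>phi_inv\<close>.\<close>

lemma phi_inverse_asymptotics:
  assumes c: "c > 0" and g: "\<forall>\<^sub>F t in at_right 0. g t > 0"
    and lim: "((\<lambda>t. phi \<gamma> R (g t) / t) \<longlongrightarrow> c) (at_right 0)"
  shows "((\<lambda>t. g t / phi_inv \<gamma> R t) \<longlongrightarrow> c powr (- 1 / (\<theta> - 1))) (at_right 0)"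
proof -
  define L where "L = c powr (- 1 / (\<theta> - 1))"
  have "- 1 / (\<theta> - 1) * (1 - \<theta>) = 1" using \<theta> by (simp add: field_simps)
  then have L: "L > 0" "L powr (1 - \<theta>) = c"
    using c \<theta> unfolding L_def powr_powr by auto
  have tp: "\<forall>\<^sub>F t in at_right 0. (t::real) > 0" by (simp add: eventually_at_right_less)
  show ?thesis
    unfolding L_def[symmetric]
  proof (rule order_tendstoI)
    fix a0 assume a0: "a0 < L"
    \<comment> \<open>The given bound \<open>a0\<close> may be negative; a larger positive value
      below \<open>L\<close> can be used as a scaling factor.\<close>
    define a where "a = max a0 (L / 2)"
    have a: "a > 0" "a0 \<le> a" "a < L" using a0 L by (auto simp: a_def)
    have "c < a powr (1 - \<theta>)" unfolding L(2)[symmetric] using a \<theta> by (intro powr_less_mono2_neg) auto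
    then obtain M where M: "c < M" "M < a powr (1 - \<theta>)" using dense by auto
    obtain X where X: "X > 0" "\<And>x. x \<ge> X \<Longrightarrow> M * phi \<gamma> R x \<le> phi \<gamma> R (a * x)"
      using phi_scale_lower[OF a(1) M(2)] by auto
    show "\<forall>\<^sub>F t in at_right 0. a0 < g t / phi_inv \<gamma> R t"
      using order_tendstoD(2)[OF lim M(1)] phi_inv_eventually[OF X(1)] g tp
    proof eventually_elim
      case (elim t)
      then have p: "phi_inv \<gamma> R t > 0" using X(1) by linarith
      have "phi \<gamma> R (g t) < M * t" using elim by (simp add: field_simps)
      also have "\<dots> \<le> phi \<gamma> R (a * phi_inv \<gamma> R t)" using X(2)[of "phi_inv \<gamma> R t"] elim by simp
      finally have "a * phi_inv \<gamma> R t < g t" using elim a p by (subst (asm) phi_less_iff) auto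
      then have "a < g t / phi_inv \<gamma> R t" using p by (simp add: field_simps)
      then show ?case using a by simp
    qed
  next
    fix a assume a: "L < a"
    then have a0: "a > 0" using L by simp
    have "a powr (1 - \<theta>) < c" unfolding L(2)[symmetric] using a L \<theta> by (intro powr_less_mono2_neg) auto
    then obtain M where M: "M < c" "a powr (1 - \<theta>) < M" using dense by auto
    obtain X where X: "X > 0" "\<And>x. x \<ge> X \<Longrightarrow> phi \<gamma> R (a * x) \<le> M * phi \<gamma> R x"
      using phi_scale_upper[OF a0 M(2)] by auto
    show "\<forall>\<^sub>F t in at_right 0. g t / phi_inv \<gamma> R t < a"
      using order_tendstoD(1)[OF lim M(1)] phi_inv_eventually[OF X(1)] g tp
    proof eventually_elim
      case (elim t)
      then have p: "phi_inv \<gamma> R t > 0" using X(1) by linarith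
      have "phi \<gamma> R (a * phi_inv \<gamma> R t) \<le> M * t" using X(2)[of "phi_inv \<gamma> R t"] elim by simp
      also have "\<dots> < phi \<gamma> R (g t)" using elim by (simp add: field_simps)
      finally have "g t < a * phi_inv \<gamma> R t" using elim a0 p by (subst (asm) phi_less_iff) auto
      then show ?case using p by (simp add: field_simps)
    qed
  qed
qed

text \<open>The inversion is applied to \<open>g t = phi_inv (c * t)\<close>, for which
  \<open>phi (g t) / t\<close> eventually equals \<open>c\<close>.\<close>

lemma phi_inv_regvar: "regvar_at_0 (phi_inv \<gamma> R) (- 1 / (\<theta> - 1))"
  unfolding regvar_at_0_def
proof (intro conjI allI impI)
  show ev: "\<forall>\<^sub>F t in at_right 0. 0 < phi_inv \<gamma> R t"
    using phi_inv_eventually[of 1] by (auto elim: eventually_mono)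
  fix c :: real assume c: "c > 0"
  have fl: "filterlim (\<lambda>t. c * t) (at_right 0) (at_right 0)"
    unfolding filterlim_at
  proof
    show "((\<lambda>t. c * t) \<longlongrightarrow> 0) (at_right 0)" by (intro tendsto_eq_intros) auto
    show "\<forall>\<^sub>F t in at_right 0. c * t \<in> {0<..} \<and> c * t \<noteq> 0"
      using eventually_at_right_less[of "0::real"] by eventually_elim (use c in auto)
  qed
  show "((\<lambda>t. phi_inv \<gamma> R (c * t) / phi_inv \<gamma> R t) \<longlongrightarrow> c powr (- 1 / (\<theta> - 1))) (at_right 0)"
  proof (rule phi_inverse_asymptotics[OF c])
    show "\<forall>\<^sub>F t in at_right 0. 0 < phi_inv \<gamma> R (c * t)"
      using fl ev unfolding filterlim_iff by blast
    have "\<forall>\<^sub>F t in at_right 0. phi \<gamma> R (phi_inv \<gamma> R (c * t)) = c * t"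
      using fl phi_inv_eventually[of 1] unfolding filterlim_iff by (auto elim: eventually_mono)
    then have "\<forall>\<^sub>F t in at_right 0. phi \<gamma> R (phi_inv \<gamma> R (c * t)) / t = c"
      using eventually_at_right_less[of "0::real"] by eventually_elim auto
    then show "((\<lambda>t. phi \<gamma> R (phi_inv \<gamma> R (c * t)) / t) \<longlongrightarrow> c) (at_right 0)"
      by (rule tendsto_eventually)
  qed
qed

lemma phi_near:
  assumes "e > 0"
  obtains d X where "d > 0" "d < 1" "X > 0"
    "\<And>x y. x \<ge> X \<Longrightarrow> y \<ge> X \<Longrightarrow> \<bar>y - x\<bar> \<le> d * x \<Longrightarrow> \<bar>phi \<gamma> R x - phi \<gamma> R y\<bar> \<le> e * phi \<gamma> R y"
proof -
  \<comment> \<open>Scaling by this \<open>c < 1\<close> raises \<open>phi\<close> by less than the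
    factor \<open>1 + e\<close>, and the window \<open>(1 - c) * x\<close> gives both
    \<open>c * x <= y\<close> and \<open>c * y <= x\<close>.\<close>
  define c where "c = (1 + e / 2) powr (- 1 / (\<theta> - 1))"
  have "- 1 / (\<theta> - 1) * (1 - \<theta>) = 1" using \<theta> by (simp add: field_simps)
  then have "c powr (1 - \<theta>) = 1 + e / 2" unfolding c_def powr_powr using assms by simp
  then have c1: "c powr (1 - \<theta>) < 1 + e" using assms by simp
  have c: "c > 0" using assms by (simp add: c_def)
  have "c < (1 + e / 2) powr 0" unfolding c_def using assms \<theta> by (intro powr_less_mono) auto
  then have c2: "c < 1" using assms by simp
  obtain X where X: "X > 0" "\<And>x. x \<ge> X \<Longrightarrow> phi \<gamma> R (c * x) \<le> (1 + e) * phi \<gamma> R x"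
    using phi_scale_upper[OF c c1] by metis
  show ?thesis
  proof (rule that[of "1 - c" X])
    fix x y assume x: "X \<le> x" "X \<le> y" and y: "\<bar>y - x\<bar> \<le> (1 - c) * x"
    have pos: "x > 0" "y > 0" using x X by auto
    have cx: "c * x \<le> y" using y by (simp add: algebra_simps abs_le_iff)
    have "y \<le> (1 + (1 - c)) * x" using y by (simp add: algebra_simps abs_le_iff)
    then have "c * y \<le> c * ((1 + (1 - c)) * x)" using c by (intro mult_left_mono) auto
    also have "\<dots> = (1 - (1 - c)\<^sup>2) * x" by (simp add: power2_eq_square algebra_simps)
    also have "\<dots> \<le> 1 * x" using pos by (intro mult_right_mono) auto
    finally have cy: "c * y \<le> x" by simp
    show "\<bar>phi \<gamma> R x - phi \<gamma> R y\<bar> \<le> e * phi \<gamma> R y"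
    proof (cases "x \<le> y")
      case True
      have "phi \<gamma> R x \<le> phi \<gamma> R (c * y)" using cy c pos by (intro phi_antimono) auto
      also have "\<dots> \<le> (1 + e) * phi \<gamma> R y" using X x by auto
      finally show ?thesis using phi_antimono[OF pos(1) True] by (simp add: algebra_simps)
    next
      case False
      have "phi \<gamma> R y \<le> phi \<gamma> R (c * x)" using cx c pos by (intro phi_antimono) auto
      also have "\<dots> \<le> (1 + e) * phi \<gamma> R x" using X x by auto
      finally have "phi \<gamma> R y - phi \<gamma> R x \<le> e * phi \<gamma> R x" by (simp add: algebra_simps)
      moreover have *: "phi \<gamma> R x \<le> phi \<gamma> R y" using phi_antimono[of y x] False pos by auto
      moreover have "e * phi \<gamma> R x \<le> e * phi \<gamma> R y" using * assms by (intro mult_left_mono) auto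
      ultimately show ?thesis by simp
    qed
  qed (use c c2 X in auto)
qed

text \<open>Along a line of slope \<open>- \<gamma>\<close> the clock is exactly a difference of
  values of \<open>phi\<close>, by the fundamental theorem. A nearby path changes the integrand by a
  small relative error, and moving the endpoint from the line to the path changes \<open>phi\<close>
  by another.\<close>

lemma clock_estimate_near_line:
  assumes "e > 0"
  obtains d X where "d > 0" "d < 1" "X > 0"
    "\<And>z a b m. \<lbrakk>a \<le> b; m \<ge> X; (\<lambda>u. 1 / R (z u)) integrable_on {a..b};
       \<And>u. u \<in> {a..b} \<Longrightarrow> \<bar>z u - (z a - \<gamma> * (u - a))\<bar> \<le> d * m;
       \<And>u. u \<in> {a..b} \<Longrightarrow> z a - \<gamma> * (u - a) \<ge> m; z b \<ge> X\<rbrakk> \<Longrightarrow>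
       \<bar>integral {a..b} (\<lambda>u. 1 / R (z u)) - (phi \<gamma> R (z b) - phi \<gamma> R (z a))\<bar> \<le> e * phi \<gamma> R (z b)"
proof -
  \<comment> \<open>The endpoint costs one \<open>w\<close>. The integrand costs \<open>w\<close>
    times \<open>phi (l b) <= 2 * phi (z b)\<close>, where the cap \<open>w <= 1\<close> enters.
    Together this is \<open>3 * w\<close>.\<close>
  define w where "w = min (e / 3) 1"
  have w: "w > 0" "w \<le> 1" "3 * w \<le> e" using assms by (auto simp: w_def)
  obtain d1 X1 where 1: "d1 > 0" "d1 < 1" "X1 > 0"
    "\<And>x y. x \<ge> X1 \<Longrightarrow> \<bar>y - x\<bar> \<le> d1 * x \<Longrightarrow> \<bar>R x / R y - 1\<bar> \<le> w"
    using R_ratio_near_1[OF w(1)] by metis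
  obtain d2 X2 where 2: "d2 > 0" "d2 < 1" "X2 > 0"
    "\<And>x y. x \<ge> X2 \<Longrightarrow> y \<ge> X2 \<Longrightarrow> \<bar>y - x\<bar> \<le> d2 * x \<Longrightarrow> \<bar>phi \<gamma> R x - phi \<gamma> R y\<bar> \<le> w * phi \<gamma> R y"
    using phi_near[OF w(1)] by metis
  define d where "d = min d1 d2"
  define X where "X = max X1 X2"
  show ?thesis
  proof (rule that[of d X])
    fix z :: "real \<Rightarrow> real" and a b m :: real
    assume ab: "a \<le> b" and m: "X \<le> m" and int: "(\<lambda>u. 1 / R (z u)) integrable_on {a..b}"
      and near: "\<And>u. u \<in> {a..b} \<Longrightarrow> \<bar>z u - (z a - \<gamma> * (u - a))\<bar> \<le> d * m"
      and low: "\<And>u. u \<in> {a..b} \<Longrightarrow> z a - \<gamma> * (u - a) \<ge> m" and zb: "X \<le> z b"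
    define l where "l u = z a - \<gamma> * (u - a)" for u
    have Xp: "X > 0" using 1(3) by (simp add: X_def)
    have lm: "l u \<ge> m" if "u \<in> {a..b}" for u using low[OF that] by (simp add: l_def)
    have nr: "\<bar>z u - l u\<bar> \<le> d * l u" if "u \<in> {a..b}" for u
    proof -
      have "d * m \<le> d * l u" using lm[OF that] 1(1) 2(1) by (intro mult_left_mono) (auto simp: d_def)
      then show ?thesis using near[OF that] by (simp add: l_def)
    qed
    have li: "((\<lambda>u. 1 / R (l u)) has_integral (phi \<gamma> R (l b) - phi \<gamma> R (l a))) {a..b}"
    proof (rule fundamental_theorem_of_calculus[OF ab])
      fix u assume u: "u \<in> {a..b}"
      have lp: "l u > 0" using lm[OF u] m Xp by linarith
      have "(l has_real_derivative - \<gamma>) (at u)"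
        unfolding l_def by (auto intro!: derivative_eq_intros)
      from DERIV_chain2[OF phi_deriv[OF lp] this]
      have "((\<lambda>u. phi \<gamma> R (l u)) has_real_derivative 1 / R (l u)) (at u)" using \<gamma> by simp
      then show "((\<lambda>u. phi \<gamma> R (l u)) has_vector_derivative 1 / R (l u)) (at u within {a..b})"
        by (simp add: has_real_derivative_iff_has_vector_derivative has_vector_derivative_at_within)
    qed
    have "norm (integral {a..b} (\<lambda>u. 1 / R (z u) - 1 / R (l u))) \<le> integral {a..b} (\<lambda>u. w * (1 / R (l u)))"
    proof (rule integral_norm_bound_integral)
      show "(\<lambda>u. 1 / R (z u) - 1 / R (l u)) integrable_on {a..b}"
        using int li by (auto intro: integrable_diff)
      show "(\<lambda>u. w * (1 / R (l u))) integrable_on {a..b}"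
        using li by (intro integrable_on_mult_right) auto
      fix u assume u: "u \<in> {a..b}"
      have lp: "l u > 0" "X1 \<le> l u" using lm[OF u] m Xp by (auto simp: X_def)
      have "d * l u \<le> d1 * l u" using lp by (intro mult_right_mono) (auto simp: d_def)
      then have "\<bar>R (l u) / R (z u) - 1\<bar> \<le> w" using nr[OF u] by (intro 1(4) lp) auto
      moreover have "1 / R (z u) - 1 / R (l u) = (R (l u) / R (z u) - 1) * (1 / R (l u))"
        using R_pos[OF lp(1)] by (simp add: field_simps)
      ultimately show "norm (1 / R (z u) - 1 / R (l u)) \<le> w * (1 / R (l u))"
        using R_pos[OF lp(1)] by (simp only: real_norm_def abs_mult) (intro mult_mono, auto)
    qed
    moreover have "integral {a..b} (\<lambda>u. 1 / R (z u) - 1 / R (l u))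
        = integral {a..b} (\<lambda>u. 1 / R (z u)) - (phi \<gamma> R (l b) - phi \<gamma> R (l a))"
      using int li by (subst integral_diff) (auto simp: integral_unique)
    moreover have "integral {a..b} (\<lambda>u. w * (1 / R (l u))) = w * (phi \<gamma> R (l b) - phi \<gamma> R (l a))"
      using integral_unique[OF has_integral_mult_right[OF li, of w]] by simp
    ultimately have i: "\<bar>integral {a..b} (\<lambda>u. 1 / R (z u)) - (phi \<gamma> R (l b) - phi \<gamma> R (l a))\<bar>
        \<le> w * (phi \<gamma> R (l b) - phi \<gamma> R (l a))" by simp
    have la: "l a = z a" by (simp add: l_def)
    have lb: "l b > 0" "X2 \<le> l b" "l a > 0" using lm[of b] lm[of a] ab m Xp by (auto simp: X_def)
    have "d * l b \<le> d2 * l b" using lb by (intro mult_right_mono) (auto simp: d_def)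
    then have ii: "\<bar>phi \<gamma> R (l b) - phi \<gamma> R (z b)\<bar> \<le> w * phi \<gamma> R (z b)"
      using nr[of b] ab zb by (intro 2(4) lb) (auto simp: X_def)
    have pz: "phi \<gamma> R (z b) \<ge> 0" using zb Xp by (intro phi_nonneg) auto
    have "w * (phi \<gamma> R (l b) - phi \<gamma> R (l a)) \<le> w * (2 * phi \<gamma> R (z b))"
    proof (rule mult_left_mono)
      have "w * phi \<gamma> R (z b) \<le> 1 * phi \<gamma> R (z b)" using w pz by (intro mult_right_mono) auto
      then show "phi \<gamma> R (l b) - phi \<gamma> R (l a) \<le> 2 * phi \<gamma> R (z b)"
        using ii phi_nonneg[OF lb(3)] by linarith
    qed (use w in auto)
    then have "\<bar>integral {a..b} (\<lambda>u. 1 / R (z u)) - (phi \<gamma> R (z b) - phi \<gamma> R (z a))\<bar> \<le> 3 * w * phi \<gamma> R (z b)"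
      using i ii unfolding la by linarith
    also have "\<dots> \<le> e * phi \<gamma> R (z b)" using w pz by (intro mult_right_mono) auto
    finally show "\<bar>integral {a..b} (\<lambda>u. 1 / R (z u)) - (phi \<gamma> R (z b) - phi \<gamma> R (z a))\<bar> \<le> e * phi \<gamma> R (z b)" .
  qed (use 1 2 in \<open>auto simp: d_def X_def\<close>)
qed

text \<open>The error of a block is proportional to \<open>phi\<close> at its end, and \<open>phi\<close> grows geometrically along
  the blocks, so the accumulated error is a multiple of the last one.\<close>

lemma clock_estimate_chain:
  assumes "e > 0"
  obtains d X where "d > 0" "d \<le> 1 / 16" "X > 0"
    "\<And>z (N :: nat \<Rightarrow> real) c K. \<lbrakk>0 < K; N 0 = 0; (\<lambda>u. 1 / R (z u)) integrable_on {0..N K};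
       \<And>k. k < K \<Longrightarrow> N k \<le> N (Suc k) \<and> c k \<ge> X;
       \<And>k u. k < K \<Longrightarrow> u \<in> {N k..N (Suc k)} \<Longrightarrow>
         \<bar>z u - (z (N k) - \<gamma> * (u - N k))\<bar> \<le> d * c k \<and> z u \<ge> c k / 4;
       \<And>k. Suc k < K \<Longrightarrow> 3 / 2 * z (N (Suc k)) \<le> z (N k)\<rbrakk> \<Longrightarrow>
       \<forall>u\<in>{0..N K}. \<bar>integral {0..u} (\<lambda>u. 1 / R (z u)) - (phi \<gamma> R (z u) - phi \<gamma> R (z 0))\<bar> \<le> e * phi \<gamma> R (z u)"
proof -
  \<comment> \<open>Each block but the last divides the path by at least \<open>3 / 2\<close>, so
    \<open>phi\<close> at its start is at most \<open>q\<close> times \<open>phi\<close> at its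
    end.\<close>
  have "(3/2) powr (1 - \<theta>) < (3/2::real) powr 0" using \<theta> by (intro powr_less_mono) auto
  then obtain q where q: "(3/2) powr (1 - \<theta>) < q" "q < 1" using dense by auto
  have q0: "0 < q" using q(1) powr_gt_zero[of "3/2" "1-\<theta>"] by linarith
  obtain X1 where X1: "X1 > 0" "\<And>x. x \<ge> X1 \<Longrightarrow> phi \<gamma> R (3/2 * x) \<le> q * phi \<gamma> R x"
    using phi_scale_upper[OF _ q(1)] by auto
  \<comment> \<open>\<open>C\<close> compares \<open>phi\<close> at a block start with
    \<open>phi\<close> inside the block, where the path is at most twice its starting value.\<close>
  define C where "C = (1/2) powr (1 - \<theta>) + 1"
  have C: "C > 0" "(1/2) powr (1 - \<theta>) < C" by (auto simp: C_def add_pos_pos)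
  obtain X2 where X2: "X2 > 0" "\<And>x. x \<ge> X2 \<Longrightarrow> phi \<gamma> R (1/2 * x) \<le> C * phi \<gamma> R x"
    using phi_scale_upper[OF _ C(2)] by auto
  \<comment> \<open>The geometric sum of the powers of \<open>q\<close>; the relation
    \<open>A * q + 1 = A\<close> reproduces the bound from block to block.\<close>
  define A where "A = 1 / (1 - q)"
  have A: "A > 0" "A * q + 1 = A" using q by (auto simp: A_def field_simps)
  define e' where "e' = e / (A * C + 1)"
  have "A * C + 1 > 0" using A C by (simp add: add_pos_pos)
  then have e': "e' > 0" "(A * C + 1) * e' = e"
    using assms by (auto simp: e'_def)
  obtain d0 X3 where 3: "d0 > 0" "d0 < 1" "X3 > 0"
    "\<And>z a b m. \<lbrakk>a \<le> b; m \<ge> X3; (\<lambda>u. 1 / R (z u)) integrable_on {a..b};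
       \<And>u. u \<in> {a..b} \<Longrightarrow> \<bar>z u - (z a - \<gamma> * (u - a))\<bar> \<le> d0 * m;
       \<And>u. u \<in> {a..b} \<Longrightarrow> z a - \<gamma> * (u - a) \<ge> m; z b \<ge> X3\<rbrakk> \<Longrightarrow>
       \<bar>integral {a..b} (\<lambda>u. 1 / R (z u)) - (phi \<gamma> R (z b) - phi \<gamma> R (z a))\<bar> \<le> e' * phi \<gamma> R (z b)"
    using clock_estimate_near_line[OF e'(1)] by metis
  \<comment> \<open>The line estimate is used with \<open>m = c k / 8\<close>: the path is above
    \<open>c k / 4\<close> and within \<open>c k / 16\<close> of the line, so the line stays above
    \<open>c k / 8\<close>.\<close>
  define d where "d = min (d0 / 8) (1 / 16)"
  define X where "X = 8 * max X1 (max X2 X3)"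
  show ?thesis
  proof (rule that[of d X])
    fix z :: "real \<Rightarrow> real" and N :: "nat \<Rightarrow> real" and c :: "nat \<Rightarrow> real" and K :: nat
    assume K: "0 < K" and N0: "N 0 = 0" and int: "(\<lambda>u. 1 / R (z u)) integrable_on {0..N K}"
      and N: "\<And>k. k < K \<Longrightarrow> N k \<le> N (Suc k) \<and> c k \<ge> X"
      and near: "\<And>k u. k < K \<Longrightarrow> u \<in> {N k..N (Suc k)} \<Longrightarrow>
         \<bar>z u - (z (N k) - \<gamma> * (u - N k))\<bar> \<le> d * c k \<and> z u \<ge> c k / 4"
      and dec: "\<And>k. Suc k < K \<Longrightarrow> 3 / 2 * z (N (Suc k)) \<le> z (N k)"
    define I where "I u = integral {0..u} (\<lambda>u. 1 / R (z u))" for u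
    have Nmono: "N i \<le> N j" if "i \<le> j" "j \<le> K" for i j
      using that N by (induction j) (auto simp: le_Suc_eq intro: order_trans)
    \<comment> \<open>Two bounds are carried: a wide one at all times and a sharper one at block
      ends, which feeds the recursion. The final end is exempt, since no decrease is assumed over
      the last block.\<close>
    have "(\<forall>u\<in>{0..N k}. \<bar>I u - (phi \<gamma> R (z u) - phi \<gamma> R (z 0))\<bar> \<le> e * phi \<gamma> R (z u)) \<and>
        (k < K \<longrightarrow> \<bar>I (N k) - (phi \<gamma> R (z (N k)) - phi \<gamma> R (z 0))\<bar> \<le> A * e' * phi \<gamma> R (z (N k)))" if "k \<le> K" for k
      using that
    proof (induction k)
      case 0
      have "z 0 > 0" using near[OF K, of 0] N[OF K] N0 X1(1) by (auto simp: X_def)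
      then show ?case using N0 assms A(1) e'(1) phi_nonneg[of "z 0"] by (auto simp: I_def)
    next
      case (Suc k)
      then have k: "k < K" by simp
      have ck: "c k \<ge> X" "N k \<le> N (Suc k)" using N[OF k] by auto
      have Nk: "0 \<le> N k" "N (Suc k) \<le> N K" using Nmono[of 0 k] Nmono[of "Suc k" K] k N0 by auto
      have cp: "c k > 0" using ck X1 by (auto simp: X_def)
      have zl: "z u \<ge> c k / 4" "z u \<ge> X1" "z u \<ge> X2" "z u \<ge> X3" "z u > 0" if "u \<in> {N k..N (Suc k)}" for u
        using near[OF k that] ck X1 by (auto simp: X_def)
      have dc: "d * c k \<le> c k / 16" using cp mult_right_mono[of d "1/16" "c k"] by (simp add: d_def)
      have step: "\<bar>integral {N k..u} (\<lambda>u. 1 / R (z u)) - (phi \<gamma> R (z u) - phi \<gamma> R (z (N k)))\<bar> \<le> e' * phi \<gamma> R (z u)"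
        if u: "u \<in> {N k..N (Suc k)}" for u
      proof (rule 3(4))
        show "N k \<le> u" using u by simp
        show "X3 \<le> c k / 8" using ck by (auto simp: X_def)
        show "(\<lambda>u. 1 / R (z u)) integrable_on {N k..u}"
          using int by (rule integrable_on_subinterval) (use u Nk in auto)
        show "X3 \<le> z u" using zl u by auto
        fix v assume "v \<in> {N k..u}"
        then have v: "v \<in> {N k..N (Suc k)}" using u by auto
        have "d * c k \<le> d0 / 8 * c k" using cp by (intro mult_right_mono) (auto simp: d_def)
        then show "\<bar>z v - (z (N k) - \<gamma> * (v - N k))\<bar> \<le> d0 * (c k / 8)" using near[OF k v] by simp
        show "c k / 8 \<le> z (N k) - \<gamma> * (v - N k)" using near[OF k v] dc cp by linarith
      qed
      have split: "I u = I (N k) + integral {N k..u} (\<lambda>u. 1 / R (z u))" if u: "u \<in> {N k..N (Suc k)}" for u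
        unfolding I_def
        by (rule Henstock_Kurzweil_Integration.integral_combine[symmetric])
          (use u Nk in \<open>auto intro: integrable_on_subinterval[OF int]\<close>)
      have tight: "\<bar>I (N k) - (phi \<gamma> R (z (N k)) - phi \<gamma> R (z 0))\<bar> \<le> A * e' * phi \<gamma> R (z (N k))"
        using Suc k by auto
      have part: "\<bar>I u - (phi \<gamma> R (z u) - phi \<gamma> R (z 0))\<bar> \<le> e * phi \<gamma> R (z u)" if u: "u \<in> {N k..N (Suc k)}" for u
      proof -
        have zp: "z (N k) \<ge> c k / 4" "z (N k) > 0" using zl[of "N k"] ck by auto
        have "0 \<le> \<gamma> * (u - N k)" using u \<gamma> by auto
        then have "z u \<le> 2 * z (N k)" using near[OF k u] dc cp zp by linarith
        then have "phi \<gamma> R (z (N k)) \<le> phi \<gamma> R (1/2 * z u)" using zl[OF u] by (intro phi_antimono) auto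
        also have "\<dots> \<le> C * phi \<gamma> R (z u)" using X2(2) zl(3)[OF u] by auto
        finally have "A * e' * phi \<gamma> R (z (N k)) \<le> A * e' * (C * phi \<gamma> R (z u))"
          using A e' by (intro mult_left_mono) auto
        then have "\<bar>I u - (phi \<gamma> R (z u) - phi \<gamma> R (z 0))\<bar> \<le> A * e' * (C * phi \<gamma> R (z u)) + e' * phi \<gamma> R (z u)"
          using tight step[OF u] split[OF u] by linarith
        also have "\<dots> = ((A * C + 1) * e') * phi \<gamma> R (z u)" by (simp add: algebra_simps)
        finally show ?thesis using e' by simp
      qed
      have "\<bar>I (N (Suc k)) - (phi \<gamma> R (z (N (Suc k))) - phi \<gamma> R (z 0))\<bar> \<le> A * e' * phi \<gamma> R (z (N (Suc k)))"
        if "Suc k < K"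
      proof -
        let ?v = "N (Suc k)"
        have v: "?v \<in> {N k..N (Suc k)}" using ck by auto
        have "phi \<gamma> R (z (N k)) \<le> phi \<gamma> R (3/2 * z ?v)"
          using dec[OF that] zl[OF v] by (intro phi_antimono) auto
        also have "\<dots> \<le> q * phi \<gamma> R (z ?v)" using X1(2) zl(2)[OF v] by auto
        finally have "A * e' * phi \<gamma> R (z (N k)) \<le> A * e' * (q * phi \<gamma> R (z ?v))"
          using A e' by (intro mult_left_mono) auto
        then have "\<bar>I ?v - (phi \<gamma> R (z ?v) - phi \<gamma> R (z 0))\<bar> \<le> A * e' * (q * phi \<gamma> R (z ?v)) + e' * phi \<gamma> R (z ?v)"
          using tight step[OF v] split[OF v] by linarith
        also have "\<dots> = (A * q + 1) * e' * phi \<gamma> R (z ?v)" by (simp add: algebra_simps)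
        finally show ?thesis using A by simp
      qed
      moreover have "\<forall>u\<in>{0..N (Suc k)}. \<bar>I u - (phi \<gamma> R (z u) - phi \<gamma> R (z 0))\<bar> \<le> e * phi \<gamma> R (z u)"
      proof
        fix u assume "u \<in> {0..N (Suc k)}"
        then have "u \<in> {0..N k} \<or> u \<in> {N k..N (Suc k)}" by auto
        then show "\<bar>I u - (phi \<gamma> R (z u) - phi \<gamma> R (z 0))\<bar> \<le> e * phi \<gamma> R (z u)" using part Suc k by auto
      qed
      ultimately show ?case by auto
    qed
    from this[of K] show "\<forall>u\<in>{0..N K}. \<bar>integral {0..u} (\<lambda>u. 1 / R (z u)) - (phi \<gamma> R (z u) - phi \<gamma> R (z 0))\<bar> \<le> e * phi \<gamma> R (z u)"
      by (simp add: I_def)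
  qed (use 3 X1 in \<open>auto simp: d_def X_def\<close>)
qed

end

section \<open>The time change\<close>

text \<open>The function is a pointwise limit of step functions: each approximant evaluates it at a
  grid point and factors through an integer-valued floor.\<close>

lemma right_continuous_borel_measurable:
  fixes f :: "real \<Rightarrow> real"
  assumes "\<And>t. (f \<longlongrightarrow> f t) (at_right t)"
  shows "f \<in> borel_measurable borel"
proof (rule borel_measurable_LIMSEQ_real)
  \<comment> \<open>Adding 1 to the floor keeps the grid point strictly to the right of
    \<open>t\<close> even when \<open>t\<close> lies on the grid, so that the right limit
    applies.\<close>
  define s where "s n t = (of_int \<lfloor>real (Suc n) * t\<rfloor> + 1) / real (Suc n)" for n t
  show "(\<lambda>t. f (s n t)) \<in> borel_measurable borel" for n
  proof -
    have "(\<lambda>t. (\<lambda>i. f ((of_int i + 1) / real (Suc n))) \<lfloor>real (Suc n) * t\<rfloor>) \<in> borel_measurable borel"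
      by (rule measurable_compose[of _ _ "count_space UNIV"]) auto
    then show ?thesis by (simp add: s_def)
  qed
  fix t :: real
  have s1: "t < s n t" for n
    using floor_correct[of "real (Suc n) * t"] by (simp add: s_def field_simps)
  have s2: "s n t \<le> t + 1 / real (Suc n)" for n
  proof -
    have "s n t \<le> (real (Suc n) * t + 1) / real (Suc n)"
      unfolding s_def by (intro divide_right_mono) auto
    then show ?thesis by (simp add: add_divide_distrib)
  qed
  have "(\<lambda>n. t + 1 / real (Suc n)) \<longlonglongrightarrow> t + 0"
    by (intro tendsto_intros LIMSEQ_inverse_real_of_nat[unfolded inverse_eq_divide])
  then have lim: "(\<lambda>n. t + 1 / real (Suc n)) \<longlonglongrightarrow> t" by simp
  have "(\<lambda>n. s n t) \<longlonglongrightarrow> t"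
  proof (rule tendsto_sandwich[OF _ _ tendsto_const lim])
    show "\<forall>\<^sub>F n in sequentially. t \<le> s n t" using s1 by (intro always_eventually) (simp add: less_imp_le)
    show "\<forall>\<^sub>F n in sequentially. s n t \<le> t + 1 / real (Suc n)" using s2 by (intro always_eventually) blast
  qed
  moreover have "\<forall>\<^sub>F n in sequentially. s n t \<in> {t<..} \<and> s n t \<noteq> t"
    using s1 by (intro always_eventually) (simp add: less_imp_neq[symmetric])
  ultimately have "filterlim (\<lambda>n. s n t) (at_right t) sequentially"
    unfolding filterlim_at by blast
  with assms[of t] show "(\<lambda>n. f (s n t)) \<longlonglongrightarrow> f t" by (rule filterlim_compose)
qed

text \<open>The clock grows at least at rate \<open>m\<close>, so it is strictly increasing and its
  generalized inverse at the clock value of \<open>u\<close> returns \<open>u\<close>. The proxy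
  \<open>g\<close> has to agree with \<open>1 / R (Z r)\<close> before \<open>U\<close> only, and
  killing cannot occur earlier because the path is nonnegative there.\<close>

lemma time_change_eq:
  assumes g: "g \<in> borel_measurable borel" and m: "m > 0" "\<And>r. g r \<ge> m" and int: "g integrable_on {0..U}"
    and eq: "\<And>r. 0 \<le> r \<Longrightarrow> r < U \<Longrightarrow> Z r \<omega> \<ge> 0 \<and> g r = 1 / R (Z r \<omega>)" and u: "0 \<le> u" "u < U"
  shows "tc_proc R Z \<omega> (integral {0..u} g) = ereal (Z u \<omega>)"
proof -
  have tau: "ereal U \<le> tau0 Z \<omega>"
    unfolding tau0_def using eq by (auto intro!: cInf_greatest) (meson not_le)
  define F where "F s = integral {0..s} g" for s
  have Fdiff: "F t - F s \<ge> m * (t - s)" if "0 \<le> s" "s \<le> t" "t \<le> U" for s t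
  proof -
    have "F t = F s + integral {s..t} g" unfolding F_def
      by (rule Henstock_Kurzweil_Integration.integral_combine[symmetric])
        (use that in \<open>auto intro: integrable_on_subinterval[OF int]\<close>)
    moreover have "integral {s..t} (\<lambda>_. m) \<le> integral {s..t} g"
      by (rule integral_le) (use that m in \<open>auto intro: integrable_on_subinterval[OF int]\<close>)
    ultimately show ?thesis using that by (simp add: mult.commute)
  qed
  have F0: "F s \<ge> 0" if "0 \<le> s" "s \<le> U" for s
  proof -
    have "0 \<le> m * (s - 0)" using m that by simp
    then show ?thesis using Fdiff[of 0 s] that by (simp add: F_def)
  qed
  have Fless: "F s < F t" if "0 \<le> s" "s < t" "t \<le> U" for s t
  proof -
    have "0 < m * (t - s)" using m that by simp
    then show ?thesis using Fdiff[of s t] that by simp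
  qed
  have eta: "eta R Z \<omega> s = ennreal (F s)" if s: "0 \<le> s" "s < U" for s
  proof -
    have "eta R Z \<omega> s = (\<integral>\<^sup>+ r. indicator {0..s} r * g r \<partial>lborel)"
      unfolding eta_def
    proof (rule nn_integral_cong)
      fix r :: real
      have "ereal r < tau0 Z \<omega>" if "r \<le> s" using tau that s by (meson ereal_less_eq(3) le_less_trans less_ereal.simps(1) less_le_trans)
      then show "indicator {r. 0 \<le> r \<and> r \<le> s \<and> ereal r < tau0 Z \<omega>} r * ennreal (1 / R (Z r \<omega>))
        = ennreal (indicator {0..s} r * g r)"
        using eq[of r] s by (auto simp: indicator_def)
    qed
    also have "\<dots> = ennreal (F s)"
    proof (rule nn_integral_has_integral_lborel)
      show "(\<lambda>r. indicator {0..s} r * g r) \<in> borel_measurable borel" using g by measurable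
      show "0 \<le> indicator {0..s} x * g x" for x using m(2)[of x] m(1) by (simp add: indicator_def)
      have "(g has_integral F s) {0..s}" unfolding F_def
        using int s by (auto intro!: integrable_integral integrable_on_subinterval[OF int])
      then show "((\<lambda>r. indicator {0..s} r * g r) has_integral F s) UNIV"
        by (subst (asm) has_integral_restrict_UNIV[symmetric])
          (auto elim!: has_integral_eq[rotated] simp: indicator_def)
    qed
    finally show ?thesis .
  qed
  \<comment> \<open>Beyond \<open>U\<close> the clock is not computed, but the points of
    \<open>S\<close> just above \<open>u\<close> already determine the infimum.\<close>
  define S where "S = {s. 0 \<le> s \<and> eta R Z \<omega> s > ennreal (F u)}"
  have in_S: "s \<in> S" if "u < s" "s < U" for s
    using that u Fless[of u s] F0[of u] by (auto simp: S_def eta ennreal_less_iff)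
  have S_gt: "u < s" if "s \<in> S" for s
  proof (rule ccontr)
    assume "\<not> u < s"
    then have "s \<le> u" by simp
    moreover have "0 \<le> s" using that by (simp add: S_def)
    ultimately have "F s \<le> F u" using Fless[of s u] u by (cases "s = u") auto
    then have "eta R Z \<omega> s \<le> ennreal (F u)" using eta[of s] \<open>0 \<le> s\<close> \<open>s \<le> u\<close> u by (simp add: ennreal_leI)
    then show False using that by (auto simp: S_def dest: leD)
  qed
  have "(u + U) / 2 \<in> S" using u by (intro in_S) auto
  then have ne: "S \<noteq> {}" by auto
  have "Inf S = u"
  proof (rule cInf_eq_non_empty[OF ne])
    show "u \<le> s" if "s \<in> S" for s using S_gt[OF that] by simp
    fix y assume y: "\<And>s. s \<in> S \<Longrightarrow> y \<le> s"
    show "y \<le> u"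
    proof (rule dense_ge_bounded[OF u(2)])
      fix w assume "u < w" "w < U" then show "y \<le> w" using in_S y by auto
    qed
  qed
  then have ei: "eta_inv R Z \<omega> (F u) = ereal u"
    using ne unfolding eta_inv_def S_def by auto
  have "ereal u \<le> tau0 Z \<omega>" using tau u by (meson ereal_less_eq(3) less_imp_le order_trans)
  then show ?thesis unfolding F_def[symmetric] tc_proc_def ei by (simp add: Let_def min_def)
qed

section \<open>Clock estimates for time-changed paths\<close>

context regular_rate
begin

lemma time_changed_chain_estimate:
  assumes "e > 0"
  obtains d X where "d > 0" "d \<le> 1 / 32" "X > 0"
    "\<And>(Z :: real \<Rightarrow> 'x \<Rightarrow> real) \<omega> (N :: nat \<Rightarrow> real) c K B. \<lbrakk>cadlag0 (\<lambda>t. Z t \<omega>); N 0 = 0;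
       \<And>k. k \<le> K \<Longrightarrow> N k \<le> N (Suc k) \<and> c k \<ge> X;
       \<And>k u. k \<le> K \<Longrightarrow> u \<in> {N k..N (Suc k)} \<Longrightarrow>
         \<bar>Z u \<omega> - (Z (N k) \<omega> - \<gamma> * (u - N k))\<bar> \<le> d * c k \<and> Z u \<omega> \<ge> c k / 4;
       \<And>k. k < K \<Longrightarrow> 3 / 2 * Z (N (Suc k)) \<omega> \<le> Z (N k) \<omega>;
       N K < N (Suc K); \<And>u. u \<in> {N K..N (Suc K)} \<Longrightarrow> Z u \<omega> < B\<rbrakk> \<Longrightarrow>
       tc_proc R Z \<omega> 0 = ereal (Z 0 \<omega>) \<and> (\<forall>t\<ge>0. (\<forall>q\<in>\<rat>. 0 \<le> q \<longrightarrow> q \<le> t \<longrightarrow> B \<le> real_of_ereal (tc_proc R Z \<omega> q)) \<longrightarrow>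
         \<bar>phi \<gamma> R (real_of_ereal (tc_proc R Z \<omega> t)) - phi \<gamma> R (Z 0 \<omega>) - t\<bar>
           \<le> e * phi \<gamma> R (real_of_ereal (tc_proc R Z \<omega> t)))"
proof -
  obtain d0 X where d0: "d0 > 0" "d0 \<le> 1 / 16" "X > 0"
    "\<And>z (N :: nat \<Rightarrow> real) c K. \<lbrakk>0 < K; N 0 = 0; (\<lambda>u. 1 / R (z u)) integrable_on {0..N K};
       \<And>k. k < K \<Longrightarrow> N k \<le> N (Suc k) \<and> c k \<ge> X;
       \<And>k u. k < K \<Longrightarrow> u \<in> {N k..N (Suc k)} \<Longrightarrow>
         \<bar>z u - (z (N k) - \<gamma> * (u - N k))\<bar> \<le> d0 * c k \<and> z u \<ge> c k / 4;
       \<And>k. Suc k < K \<Longrightarrow> 3 / 2 * z (N (Suc k)) \<le> z (N k)\<rbrakk> \<Longrightarrow>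
       \<forall>u\<in>{0..N K}. \<bar>integral {0..u} (\<lambda>u. 1 / R (z u)) - (phi \<gamma> R (z u) - phi \<gamma> R (z 0))\<bar> \<le> e * phi \<gamma> R (z u)"
  proof (rule clock_estimate_chain[OF assms], goal_cases)
    case (1 d X)
    show ?case by (rule 1(1)) (fact 1)+
  qed
  \<comment> \<open>Halving gives the tolerance \<open>1 / 32\<close> on which the construction of
    the blocks relies.\<close>
  define d where "d = d0 / 2"
  show ?thesis
  proof (rule that[of d X])
    fix Z :: "real \<Rightarrow> 'x \<Rightarrow> real" and \<omega> and N :: "nat \<Rightarrow> real" and c :: "nat \<Rightarrow> real" and K :: nat and B :: real
    assume cad: "cadlag0 (\<lambda>t. Z t \<omega>)" and N0: "N 0 = 0"
      and N: "\<And>k. k \<le> K \<Longrightarrow> N k \<le> N (Suc k) \<and> c k \<ge> X"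
      and near: "\<And>k u. k \<le> K \<Longrightarrow> u \<in> {N k..N (Suc k)} \<Longrightarrow>
         \<bar>Z u \<omega> - (Z (N k) \<omega> - \<gamma> * (u - N k))\<bar> \<le> d * c k \<and> Z u \<omega> \<ge> c k / 4"
      and dec: "\<And>k. k < K \<Longrightarrow> 3 / 2 * Z (N (Suc k)) \<omega> \<le> Z (N k) \<omega>"
      and last: "N K < N (Suc K)" "\<And>u. u \<in> {N K..N (Suc K)} \<Longrightarrow> Z u \<omega> < B"
    define U where "U = N (Suc K)"
    have Nmono: "N i \<le> N j" if "i \<le> j" "j \<le> Suc K" for i j
      using that N by (induction j) (auto simp: le_Suc_eq intro: order_trans)
    have NK: "0 \<le> N K" using Nmono[of 0 K] N0 by simp
    have cover: "\<exists>j\<le>k. u \<in> {N j..N (Suc j)}" if "k \<le> K" "u \<in> {0..N (Suc k)}" for u k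
      using that
    proof (induction k)
      case (Suc k)
      show ?case
      proof (cases "u \<le> N (Suc k)")
        case True
        then show ?thesis using Suc by (auto intro: le_SucI)
      next
        case False
        then show ?thesis using Suc by (intro exI[of _ "Suc k"]) auto
      qed
    qed (use N0 in auto)
    have ck: "c k \<ge> X" "c k > 0" if "k \<le> K" for k using N[OF that] d0(3) by auto
    have zN: "Z (N k) \<omega> \<ge> c k / 4" if "k \<le> K" for k using near[OF that, of "N k"] N[OF that] by auto
    have z0: "Z (N k) \<omega> \<le> Z 0 \<omega>" if "k \<le> K" for k
      using that
    proof (induction k)
      case (Suc k)
      have "3 / 2 * Z (N (Suc k)) \<omega> \<le> Z (N k) \<omega>" "Z (N k) \<omega> \<le> Z 0 \<omega>" "Z (N (Suc k)) \<omega> > 0"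
        using Suc dec[of k] zN[of "Suc k"] ck[of "Suc k"] by auto
      then show ?case by linarith
    qed (use N0 in auto)
    define m0 where "m0 = X / 4"
    \<comment> \<open>Block starts decrease, and within a block the path exceeds its start by at
      most the size of that start.\<close>
    define M where "M = 2 * Z 0 \<omega>"
    have m0: "m0 > 0" using d0(3) by (simp add: m0_def)
    have bnd: "m0 \<le> Z u \<omega>" "Z u \<omega> \<le> M" if u: "u \<in> {0..U}" for u
    proof -
      obtain j where j: "j \<le> K" "u \<in> {N j..N (Suc j)}" using cover[of K u] u by (auto simp: U_def)
      show "m0 \<le> Z u \<omega>" using near[OF j] ck[OF j(1)] by (simp add: m0_def)
      have "d * c j \<le> 1 / 4 * c j" using d0 ck[OF j(1)] by (intro mult_right_mono) (auto simp: d_def)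
      moreover have "0 \<le> \<gamma> * (u - N j)" using \<gamma> j by auto
      ultimately show "Z u \<omega> \<le> M" using near[OF j] zN[OF j(1)] z0[OF j(1)] unfolding M_def by linarith
    qed
    have U: "0 < U" using NK last by (simp add: U_def)
    have mM: "m0 \<le> M" using bnd[of 0] U by auto
    \<comment> \<open>Clamping the path to \<open>m0..M\<close> and the time at 0 yields a Borel
      proxy for \<open>1 / R (Z r)\<close> on the whole line, bounded and bounded away from
      0.\<close>
    define g where "g r = 1 / R (max m0 (min M (Z (max 0 r) \<omega>)))" for r
    have meas: "g \<in> borel_measurable borel"
    proof -
      have [measurable]: "(\<lambda>r. Z (max 0 r) \<omega>) \<in> borel_measurable borel"
      proof (rule right_continuous_borel_measurable)
        fix t :: real
        show "((\<lambda>r. Z (max 0 r) \<omega>) \<longlongrightarrow> Z (max 0 t) \<omega>) (at_right t)"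
        proof (cases "t \<ge> 0")
          case True
          then have "((\<lambda>r. Z r \<omega>) \<longlongrightarrow> Z t \<omega>) (at_right t)" using cad by (simp add: cadlag0_def)
          moreover have "\<forall>\<^sub>F r in at_right t. Z r \<omega> = Z (max 0 r) \<omega>"
            using eventually_at_right_less[of t] by eventually_elim (use True in auto)
          ultimately show ?thesis using True by (simp add: tendsto_cong)
        next
          case False
          have "\<forall>\<^sub>F r in at_right t. r \<in> {t<..<0}" using False by (intro eventually_at_right_real) auto
          then have "\<forall>\<^sub>F r in at_right t. Z (max 0 r) \<omega> = Z (max 0 t) \<omega>"
            by eventually_elim (use False in auto)
          then show ?thesis by (rule tendsto_eventually)
        qed
      qed
      have "(\<lambda>x. 1 / R (max m0 x)) \<in> borel_measurable borel"
        by (rule borel_measurable_continuous_onI[OF R_scaled_cont[OF m0]])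
      then have [measurable]: "(\<lambda>x. 1 / R (max m0 x)) \<in> borel_measurable borel" .
      have "(\<lambda>r. (\<lambda>x. 1 / R (max m0 x)) (min M (Z (max 0 r) \<omega>))) \<in> borel_measurable borel" by measurable
      then show ?thesis unfolding g_def[abs_def] .
    qed
    have gZ: "g r = 1 / R (Z r \<omega>)" if "r \<in> {0..U}" for r using that bnd[OF that] by (simp add: g_def)
    obtain a where a: "a \<in> {m0..M}" "\<And>x. x \<in> {m0..M} \<Longrightarrow> 1 / R a \<le> 1 / R x"
      using continuous_attains_inf[OF compact_Icc _ inv_R_cont[OF m0, of M]] mM by auto
    obtain b where b: "b \<in> {m0..M}" "\<And>x. x \<in> {m0..M} \<Longrightarrow> 1 / R x \<le> 1 / R b"
      using continuous_attains_sup[OF compact_Icc _ inv_R_cont[OF m0, of M]] mM by auto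
    have gl: "1 / R a \<le> g r" and gu: "g r \<le> 1 / R b" for r unfolding g_def using mM by (auto intro!: a b)
    have ap: "1 / R a > 0" using R_pos[of a] a m0 by auto
    have gint: "g integrable_on {0..U}"
    proof -
      have "norm (g r) \<le> 1 / R b" for r using gl[of r] gu[of r] ap unfolding real_norm_def by linarith
      then have "set_integrable lborel {0..U} g" unfolding set_integrable_def
        by (intro integrableI_bounded_set_indicator[where B = "1 / R b"])
          (use meas in \<open>auto simp: emeasure_lborel_Icc_eq\<close>)
      then show ?thesis by (rule set_borel_integral_eq_integral(1))
    qed
    define F where "F u = integral {0..u} g" for u
    have tc: "tc_proc R Z \<omega> (F u) = ereal (Z u \<omega>)" if "0 \<le> u" "u < U" for u
      unfolding F_def
      by (rule time_change_eq[OF meas ap gl gint _ that]) (use gZ bnd m0 in force)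
    have Fcont: "continuous_on {0..U} F" unfolding F_def
      by (rule indefinite_integral_continuous_1[OF gint])
    have FU: "F (N K) < F U"
    proof -
      have "F U = F (N K) + integral {N K..U} g" unfolding F_def
        by (rule Henstock_Kurzweil_Integration.integral_combine[symmetric])
          (use last NK gint in \<open>auto simp: U_def\<close>)
      moreover have "integral {N K..U} (\<lambda>_. 1 / R a) \<le> integral {N K..U} g"
        by (rule integral_le) (use last NK gl in \<open>auto intro: integrable_on_subinterval[OF gint]\<close>)
      moreover have "0 < (U - N K) * (1 / R a)" using ap last by (simp add: U_def)
      ultimately show ?thesis using last by (simp add: U_def)
    qed
    have F0: "F 0 = 0" by (simp add: F_def)
    have est: "\<forall>u\<in>{0..U}. \<bar>F u - (phi \<gamma> R (Z u \<omega>) - phi \<gamma> R (Z 0 \<omega>))\<bar> \<le> e * phi \<gamma> R (Z u \<omega>)"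
    proof -
      have dd: "d * c k \<le> d0 * c k" if "k \<le> K" for k
        using ck[OF that] d0 by (intro mult_right_mono) (auto simp: d_def)
      have "\<forall>u\<in>{0..N (Suc K)}. \<bar>integral {0..u} (\<lambda>u. 1 / R (Z u \<omega>)) - (phi \<gamma> R (Z u \<omega>) - phi \<gamma> R (Z 0 \<omega>))\<bar> \<le> e * phi \<gamma> R (Z u \<omega>)"
      proof (rule d0(4)[where c = c])
        show "(\<lambda>u. 1 / R (Z u \<omega>)) integrable_on {0..N (Suc K)}"
          using integrable_eq[OF gint gZ] by (simp add: U_def)
        show "\<bar>Z u \<omega> - (Z (N k) \<omega> - \<gamma> * (u - N k))\<bar> \<le> d0 * c k \<and> c k / 4 \<le> Z u \<omega>"
          if "k < Suc K" "u \<in> {N k..N (Suc k)}" for k u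
          using near[of k u] that dd[of k] by auto
      qed (use N N0 dec in auto)
      moreover have "integral {0..u} (\<lambda>u. 1 / R (Z u \<omega>)) = F u" if "u \<in> {0..U}" for u
        unfolding F_def by (rule Henstock_Kurzweil_Integration.integral_cong) (use that gZ in auto)
      ultimately show ?thesis by (simp add: U_def)
    qed
    show "tc_proc R Z \<omega> 0 = ereal (Z 0 \<omega>) \<and> (\<forall>t\<ge>0. (\<forall>q\<in>\<rat>. 0 \<le> q \<longrightarrow> q \<le> t \<longrightarrow> B \<le> real_of_ereal (tc_proc R Z \<omega> q)) \<longrightarrow>
         \<bar>phi \<gamma> R (real_of_ereal (tc_proc R Z \<omega> t)) - phi \<gamma> R (Z 0 \<omega>) - t\<bar>
           \<le> e * phi \<gamma> R (real_of_ereal (tc_proc R Z \<omega> t)))"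
    proof (intro conjI allI impI)
      show "tc_proc R Z \<omega> 0 = ereal (Z 0 \<omega>)" using tc[of 0] U F0 by simp
      fix t :: real assume t: "0 \<le> t"
        and h: "\<forall>q\<in>\<rat>. 0 \<le> q \<longrightarrow> q \<le> t \<longrightarrow> B \<le> real_of_ereal (tc_proc R Z \<omega> q)"
      \<comment> \<open>Otherwise some rational clock time up to \<open>t\<close> falls into the
        last block, where the path is below \<open>B\<close>.\<close>
      have "t < F U"
      proof (rule ccontr)
        assume "\<not> t < F U"
        obtain q where q: "q \<in> \<rat>" "F (N K) < q" "q < F U" using Rats_dense_in_real[OF FU] by auto
        obtain u where u: "N K \<le> u" "u \<le> U" "F u = q"
          using IVT'[of F "N K" q U] q last NK continuous_on_subset[OF Fcont, of "{N K..U}"] by (auto simp: U_def)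
        then have "u < U" using q by (cases "u = U") auto
        have "0 \<le> F (N K)"
          unfolding F_def by (intro integral_nonneg integrable_on_subinterval[OF gint])
            (use NK last ap gl in \<open>auto simp: U_def intro: order_trans[OF less_imp_le[OF ap]]\<close>)
        then have "B \<le> real_of_ereal (tc_proc R Z \<omega> (F u))"
          using h q u \<open>\<not> t < F U\<close> by auto
        moreover have "real_of_ereal (tc_proc R Z \<omega> (F u)) = Z u \<omega>" using tc[of u] u NK \<open>u < U\<close> by simp
        ultimately show False using last(2)[of u] u by (auto simp: U_def)
      qed
      obtain u where u: "0 \<le> u" "u \<le> U" "F u = t"
        using IVT'[of F 0 t U] \<open>t < F U\<close> t F0 U Fcont by auto
      then have "u < U" using \<open>t < F U\<close> by (cases "u = U") auto
      then have "real_of_ereal (tc_proc R Z \<omega> t) = Z u \<omega>" using tc[of u] u by auto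
      moreover have "\<bar>F u - (phi \<gamma> R (Z u \<omega>) - phi \<gamma> R (Z 0 \<omega>))\<bar> \<le> e * phi \<gamma> R (Z u \<omega>)"
        using est u by auto
      ultimately show "\<bar>phi \<gamma> R (real_of_ereal (tc_proc R Z \<omega> t)) - phi \<gamma> R (Z 0 \<omega>) - t\<bar>
           \<le> e * phi \<gamma> R (real_of_ereal (tc_proc R Z \<omega> t))" using u by (simp add: abs_le_iff)
    qed
  qed (use d0 in \<open>auto simp: d_def\<close>)
qed

text \<open>The block starts are the first integer times at or below the levels
  \<open>y / 2 ^ k\<close>. As only integers are inspected, the path may undershoot a level, but
  within one unit of time only by a small fraction of it; so consecutive starts stay a factor
  \<open>3 / 2\<close> apart.\<close>

lemma time_changed_path_estimate:
  assumes "e > 0"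
  obtains d X where "d > 0" "X > 0"
    "\<And>(Z :: real \<Rightarrow> 'x \<Rightarrow> real) \<omega> y B K. \<lbrakk>cadlag0 (\<lambda>t. Z t \<omega>); Z 0 \<omega> = y; B \<ge> X; B / 4 \<le> y / 2 ^ K; y / 2 ^ K < B / 2;
       \<And>k n u. \<lbrakk>k \<le> K; Z (real n) \<omega> \<le> y / 2 ^ k; \<And>j. j < n \<Longrightarrow> y / 2 ^ k < Z (real j) \<omega>;
          0 \<le> u; u \<le> real (nat \<lceil>y / 2 ^ k / \<gamma>\<rceil>)\<rbrakk> \<Longrightarrow>
         \<bar>Z (real n + u) \<omega> - Z (real n) \<omega> + \<gamma> * u\<bar> \<le> d * (y / 2 ^ k)\<rbrakk> \<Longrightarrow>
       tc_proc R Z \<omega> 0 = ereal y \<and> (\<forall>t\<ge>0. (\<forall>q\<in>\<rat>. 0 \<le> q \<longrightarrow> q \<le> t \<longrightarrow> B \<le> real_of_ereal (tc_proc R Z \<omega> q)) \<longrightarrow>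
         \<bar>phi \<gamma> R (real_of_ereal (tc_proc R Z \<omega> t)) - phi \<gamma> R y - t\<bar>
           \<le> e * phi \<gamma> R (real_of_ereal (tc_proc R Z \<omega> t)))"
proof -
  obtain d X where d: "d > 0" "d \<le> 1 / 32" "X > 0"
    "\<And>(Z :: real \<Rightarrow> 'x \<Rightarrow> real) \<omega> (N :: nat \<Rightarrow> real) c K B. \<lbrakk>cadlag0 (\<lambda>t. Z t \<omega>); N 0 = 0;
       \<And>k. k \<le> K \<Longrightarrow> N k \<le> N (Suc k) \<and> c k \<ge> X;
       \<And>k u. k \<le> K \<Longrightarrow> u \<in> {N k..N (Suc k)} \<Longrightarrow>
         \<bar>Z u \<omega> - (Z (N k) \<omega> - \<gamma> * (u - N k))\<bar> \<le> d * c k \<and> Z u \<omega> \<ge> c k / 4;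
       \<And>k. k < K \<Longrightarrow> 3 / 2 * Z (N (Suc k)) \<omega> \<le> Z (N k) \<omega>;
       N K < N (Suc K); \<And>u. u \<in> {N K..N (Suc K)} \<Longrightarrow> Z u \<omega> < B\<rbrakk> \<Longrightarrow>
       tc_proc R Z \<omega> 0 = ereal (Z 0 \<omega>) \<and> (\<forall>t\<ge>0. (\<forall>q\<in>\<rat>. 0 \<le> q \<longrightarrow> q \<le> t \<longrightarrow> B \<le> real_of_ereal (tc_proc R Z \<omega> q)) \<longrightarrow>
         \<bar>phi \<gamma> R (real_of_ereal (tc_proc R Z \<omega> t)) - phi \<gamma> R (Z 0 \<omega>) - t\<bar>
           \<le> e * phi \<gamma> R (real_of_ereal (tc_proc R Z \<omega> t)))"
  proof (rule time_changed_chain_estimate[where 'x = 'x, OF assms], goal_cases)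
    case (1 d X)
    show ?case by (rule 1(1)) (fact 1)+
  qed
  show ?thesis
  \<comment> \<open>The factor 4 is due to the lowest level being at least \<open>B / 4\<close>; the
    term \<open>\<gamma> / d\<close> makes the drift over one unit of time at most the allowed
    deviation.\<close>
  proof (rule that[of d "4 * max X (\<gamma> / d)"])
    fix Z :: "real \<Rightarrow> 'x \<Rightarrow> real" and \<omega> and y B :: real and K :: nat
    assume cad: "cadlag0 (\<lambda>t. Z t \<omega>)" and y: "Z 0 \<omega> = y" and B: "4 * max X (\<gamma> / d) \<le> B"
      and K: "B / 4 \<le> y / 2 ^ K" "y / 2 ^ K < B / 2"
      and good: "\<And>k n u. \<lbrakk>k \<le> K; Z (real n) \<omega> \<le> y / 2 ^ k; \<And>j. j < n \<Longrightarrow> y / 2 ^ k < Z (real j) \<omega>;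
          0 \<le> u; u \<le> real (nat \<lceil>y / 2 ^ k / \<gamma>\<rceil>)\<rbrakk> \<Longrightarrow>
         \<bar>Z (real n + u) \<omega> - Z (real n) \<omega> + \<gamma> * u\<bar> \<le> d * (y / 2 ^ k)"
    define c where "c k = y / 2 ^ k" for k :: nat
    \<comment> \<open>In \<open>L k\<close> units of time the drift descends by at least
      \<open>c k\<close>, so a path within \<open>c k / 32\<close> of the line is then below
      \<open>c k / 2\<close>.\<close>
    define L where "L k = nat \<lceil>c k / \<gamma>\<rceil>" for k
    define hit where "hit k n \<longleftrightarrow> Z (real n) \<omega> \<le> c k \<and> (\<forall>j<n. c k < Z (real j) \<omega>)" for k n
    define D where "D k = d * c k" for k
    have cS: "c (Suc k) = c k / 2" for k by (simp add: c_def)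
    have cB: "c k \<ge> B / 4" if "k \<le> K" for k
      using that
    proof (induction rule: inc_induct)
      case (step n)
      have "B \<ge> 0" using B d(3) by linarith
      then show ?case using step cS[of n] by linarith
    qed (use K in \<open>simp add: c_def\<close>)
    have cX: "c k \<ge> X" "\<gamma> \<le> D k" "c k > 0" if "k \<le> K" for k
    proof -
      show "c k \<ge> X" using cB[OF that] B by linarith
      then show "c k > 0" using d by linarith
      have "\<gamma> / d \<le> c k" using cB[OF that] B by linarith
      then show "\<gamma> \<le> D k" using d(1) by (simp add: D_def field_simps)
    qed
    have dc: "D k \<le> c k / 32" if "k \<le> K" for k
      using mult_right_mono[OF d(2), of "c k"] cX(3)[OF that] by (simp add: D_def)
    have L: "c k \<le> \<gamma> * real (L k)" "L k \<ge> 1" if "k \<le> K" for k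
    proof -
      have "c k / \<gamma> > 0" using cX(3)[OF that] \<gamma> by simp
      then have "c k / \<gamma> \<le> real (L k)" unfolding L_def by (auto simp: of_nat_ceiling)
      then show "c k \<le> \<gamma> * real (L k)" using \<gamma> by (simp add: field_simps)
      then show "L k \<ge> 1" using cX(3)[OF that] by (cases "L k") auto
    qed
    have path: "\<bar>Z u \<omega> - (Z (real n) \<omega> - \<gamma> * (u - real n))\<bar> \<le> D k"
      if "k \<le> K" "hit k n" "real n \<le> u" "u \<le> real (n + L k)" for k n u
    proof -
      have "\<bar>Z (real n + (u - real n)) \<omega> - Z (real n) \<omega> + \<gamma> * (u - real n)\<bar> \<le> d * (y / 2 ^ k)"
        by (rule good) (use that in \<open>auto simp: hit_def c_def L_def\<close>)
      then show ?thesis by (simp add: D_def c_def algebra_simps)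
    qed
    have drop: "Z v \<omega> \<ge> Z u \<omega> - \<gamma> - 2 * (D k)"
      if "k \<le> K" "hit k n" "real n \<le> u" "u \<le> v" "v \<le> u + 1" "v \<le> real (n + L k)" for k n u v
    proof -
      have "\<gamma> * (v - u) \<le> \<gamma> * 1" using that \<gamma> by (intro mult_left_mono) auto
      then show ?thesis using path[of k n u] path[of k n v] that by (simp add: algebra_simps)
    qed
    \<comment> \<open>\<open>27 / 32 = 1 - 5 / 32\<close>: at the preceding integer the path is
      above \<open>c (Suc k)\<close>, and one unit of time costs at most
      \<open>\<gamma> + 2 * D k <= 5 / 32 * c (Suc k)\<close>.\<close>
    have next_hit: "\<exists>m. hit (Suc k) m \<and> n \<le> m \<and> m \<le> n + L k \<and> Z (real m) \<omega> \<ge> 27 / 32 * c (Suc k) \<and>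
        (\<forall>u\<in>{real n..real m}. Z u \<omega> \<ge> c k / 4)"
      if k: "k < K" and n: "hit k n" "Z (real n) \<omega> \<ge> 27 / 32 * c k" for k n
    proof -
      have kK: "k \<le> K" using k by simp
      have "\<bar>Z (real (n + L k)) \<omega> - (Z (real n) \<omega> - \<gamma> * (real (n + L k) - real n))\<bar> \<le> D k"
        by (rule path[OF kK n(1)]) auto
      moreover have "Z (real n) \<omega> \<le> c k" using n(1) by (simp add: hit_def)
      moreover have "\<gamma> * (real (n + L k) - real n) = \<gamma> * real (L k)" by simp
      ultimately have "Z (real (n + L k)) \<omega> \<le> c (Suc k)"
        using L(1)[OF kK] dc[OF kK] cX(3)[OF kK] unfolding cS by linarith
      define m where "m = (LEAST m. Z (real m) \<omega> \<le> c (Suc k))"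
      have m1: "Z (real m) \<omega> \<le> c (Suc k)" unfolding m_def by (rule LeastI) fact
      have m2: "m \<le> n + L k" unfolding m_def by (rule Least_le) fact
      have m3: "c (Suc k) < Z (real j) \<omega>" if "j < m" for j
        using not_less_Least[of j "\<lambda>m. Z (real m) \<omega> \<le> c (Suc k)"] that by (auto simp: m_def)
      have hm: "hit (Suc k) m" using m1 m3 by (simp add: hit_def)
      have nm: "n < m"
      proof (rule ccontr)
        assume "\<not> n < m"
        then have "m = n \<or> m < n" by auto
        then have "m = n \<or> c k < Z (real m) \<omega>" using n(1) by (auto simp: hit_def)
        then have "Z (real m) \<omega> > c (Suc k)"
          using n(2) cX(3)[OF kK] unfolding cS by auto
        then show False using m1 by simp
      qed
      have *: "Z u \<omega> \<ge> 27 / 32 * c (Suc k)" if "u \<in> {real n..real m}" for u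
      proof (cases "u = real n")
        case True
        then show ?thesis using n cX(3)[OF kK] by (simp add: cS)
      next
        case False
        \<comment> \<open>The last integer strictly before \<open>u\<close>; with the ceiling,
          \<open>j < m\<close> holds also for \<open>u = m\<close>.\<close>
        define j where "j = nat (\<lceil>u\<rceil> - 1)"
        have nu: "real n < u" using False that by auto
        then have cu: "int n < \<lceil>u\<rceil>" by (simp add: less_ceiling_iff)
        have rj: "real j = of_int \<lceil>u\<rceil> - 1" using cu by (simp add: j_def)
        have j: "real j < u" "u \<le> real j + 1" "n \<le> j"
          using ceiling_correct[of u] cu unfolding rj by (auto simp: j_def)
        then have "j < m" using that by simp
        have "Z u \<omega> \<ge> Z (real j) \<omega> - \<gamma> - 2 * (D k)"
          by (rule drop[OF kK n(1)]) (use j that m2 in auto)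
        moreover have "\<gamma> \<le> c k / 64" using cX(2)[of "Suc k"] dc[of "Suc k"] k by (simp add: cS)
        ultimately show ?thesis using m3[OF \<open>j < m\<close>] dc[OF kK] cX(3)[OF kK] unfolding cS by linarith
      qed
      have "Z u \<omega> \<ge> c k / 4" if "u \<in> {real n..real m}" for u
        using *[OF that] cX(3)[OF kK] unfolding cS by linarith
      then show ?thesis using hm nm m2 *[of "real m"] by (intro exI[of _ m]) auto
    qed
    define step where "step k n = (SOME m. hit (Suc k) m \<and> n \<le> m \<and> m \<le> n + L k \<and>
      Z (real m) \<omega> \<ge> 27 / 32 * c (Suc k) \<and> (\<forall>u\<in>{real n..real m}. Z u \<omega> \<ge> c k / 4))" for k n
    define N where "N = rec_nat 0 step"
    have N: "N 0 = 0" "N (Suc k) = step k (N k)" for k by (auto simp: N_def)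
    have step: "hit (Suc k) (step k n) \<and> n \<le> step k n \<and> step k n \<le> n + L k \<and>
      Z (real (step k n)) \<omega> \<ge> 27 / 32 * c (Suc k) \<and> (\<forall>u\<in>{real n..real (step k n)}. Z u \<omega> \<ge> c k / 4)"
      if "k < K" "hit k n" "Z (real n) \<omega> \<ge> 27 / 32 * c k" for k n
      unfolding step_def using next_hit[OF that] by (rule someI_ex)
    have inv: "hit k (N k) \<and> Z (real (N k)) \<omega> \<ge> 27 / 32 * c k" if "k \<le> K" for k
      using that
    proof (induction k)
      case 0
      show ?case using y cX(3)[of 0] by (simp add: N hit_def) (simp add: c_def)
    next
      case (Suc k)
      then show ?case using step[of k "N k"] by (auto simp: N)
    qed
    \<comment> \<open>A block of length 1 is appended after the last start. The path is still below
      \<open>B\<close> there, since \<open>c K < B / 2\<close> and the deviation is small.\<close>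
    define T where "T k = (if k \<le> K then real (N k) else real (N K) + 1)" for k
    have TS: "T (Suc k) = (if k < K then real (N (Suc k)) else real (N K) + 1)" for k
      by (auto simp: T_def)
    have last: "Z u \<omega> \<ge> c K / 4" "Z u \<omega> < B" if u: "u \<in> {real (N K)..real (N K) + 1}" for u
    proof -
      have h: "hit K (N K)" "Z (real (N K)) \<omega> \<ge> 27 / 32 * c K" using inv[of K] by auto
      have uL: "u \<le> real (N K + L K)" using u L(2)[of K] by auto
      have "Z u \<omega> \<ge> Z (real (N K)) \<omega> - \<gamma> - 2 * (D K)"
        by (rule drop[OF _ h(1)]) (use u uL in auto)
      then show "Z u \<omega> \<ge> c K / 4" using h cX[of K] dc[of K] by simp
      have "\<bar>Z u \<omega> - (Z (real (N K)) \<omega> - \<gamma> * (u - real (N K)))\<bar> \<le> D K"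
        by (rule path[OF _ h(1)]) (use u uL in auto)
      moreover have "0 \<le> \<gamma> * (u - real (N K))" using u \<gamma> by simp
      moreover have "Z (real (N K)) \<omega> \<le> c K" using h(1) by (simp add: hit_def)
      ultimately have "Z u \<omega> \<le> c K + D K" by linarith
      then show "Z u \<omega> < B" using dc[of K] K(2) cX(3)[of K] by (simp add: c_def)
    qed
    have "tc_proc R Z \<omega> 0 = ereal (Z 0 \<omega>) \<and> (\<forall>t\<ge>0. (\<forall>q\<in>\<rat>. 0 \<le> q \<longrightarrow> q \<le> t \<longrightarrow> B \<le> real_of_ereal (tc_proc R Z \<omega> q)) \<longrightarrow>
         \<bar>phi \<gamma> R (real_of_ereal (tc_proc R Z \<omega> t)) - phi \<gamma> R (Z 0 \<omega>) - t\<bar>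
           \<le> e * phi \<gamma> R (real_of_ereal (tc_proc R Z \<omega> t)))"
    proof (rule d(4)[where Z = Z and \<omega> = \<omega> and N = T and c = c and K = K, OF cad])
      show "T 0 = 0" by (simp add: T_def N)
      show "T k \<le> T (Suc k) \<and> X \<le> c k" if "k \<le> K" for k
      proof (cases "k = K")
        case False
        then show ?thesis using that cX(1)[OF that] inv[of k] step[of k "N k"] by (auto simp: TS T_def N)
      qed (use cX(1) in \<open>auto simp: T_def\<close>)
      show "\<bar>Z u \<omega> - (Z (T k) \<omega> - \<gamma> * (u - T k))\<bar> \<le> d * c k \<and> c k / 4 \<le> Z u \<omega>"
        if k: "k \<le> K" and u: "u \<in> {T k..T (Suc k)}" for k u
      proof (cases "k = K")
        case True
        then show ?thesis using u last[of u] path[of K "N K" u] inv[of K] L(2)[of K] by (auto simp: TS T_def D_def)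
      next
        case False
        then have "k < K" using k by simp
        then show ?thesis using u path[of k "N k" u] inv[of k] step[of k "N k"] by (auto simp: TS T_def N D_def)
      qed
      \<comment> \<open>At least \<open>27 / 32 * c k\<close> against at most
        \<open>c k / 2\<close>: the ratio is \<open>27 / 16\<close>.\<close>
      show "3 / 2 * Z (T (Suc k)) \<omega> \<le> Z (T k) \<omega>" if "k < K" for k
        using that inv[of k] inv[of "Suc k"] cX(3)[of k] by (simp add: T_def hit_def cS)
      show "T K < T (Suc K)" by (simp add: T_def)
      show "Z u \<omega> < B" if "u \<in> {T K..T (Suc K)}" for u using that last by (auto simp: T_def)
    qed
    then show "tc_proc R Z \<omega> 0 = ereal y \<and> (\<forall>t\<ge>0. (\<forall>q\<in>\<rat>. 0 \<le> q \<longrightarrow> q \<le> t \<longrightarrow> B \<le> real_of_ereal (tc_proc R Z \<omega> q)) \<longrightarrow>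
         \<bar>phi \<gamma> R (real_of_ereal (tc_proc R Z \<omega> t)) - phi \<gamma> R y - t\<bar>
           \<le> e * phi \<gamma> R (real_of_ereal (tc_proc R Z \<omega> t)))" unfolding y .
  qed (use d in auto)
qed

end

section \<open>Deviations of the Levy process from its drift\<close>

text \<open>Ottaviani's inequality inside an event \<open>A\<close>. After the first exceedance of
  \<open>2 * x\<close> the remaining increment is larger than \<open>x\<close> with conditional
  probability at most \<open>p\<close>; otherwise the endpoint itself exceeds \<open>x\<close>.
  Independence enters through the product bound \<open>inc\<close>.\<close>

lemma (in prob_space) ottaviani:
  fixes S :: "nat \<Rightarrow> 'a \<Rightarrow> real"
  assumes [measurable]: "\<And>i. S i \<in> borel_measurable M" "A \<in> events"
    and E: "\<And>i. E i = {\<omega>\<in>A. (\<forall>j<i. \<bar>S j \<omega>\<bar> \<le> 2 * x) \<and> \<bar>S i \<omega>\<bar> > 2 * x}"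
    and inc: "\<And>i. i \<le> n \<Longrightarrow> prob (E i \<inter> {\<omega>\<in>space M. \<bar>S n \<omega> - S i \<omega>\<bar> > x}) \<le> p * prob (E i)"
    and fin: "prob (A \<inter> {\<omega>\<in>space M. \<bar>S n \<omega>\<bar> > x}) \<le> p * prob A"
    and p: "0 \<le> p" "p \<le> 1 / 2"
  shows "prob {\<omega>\<in>A. \<exists>i\<le>n. \<bar>S i \<omega>\<bar> > 2 * x} \<le> 2 * p * prob A"
proof -
  have As: "A \<subseteq> space M" by (rule sets.sets_into_space) fact
  have Eeq: "E i = A \<inter> {\<omega>\<in>space M. (\<forall>j<i. \<bar>S j \<omega>\<bar> \<le> 2 * x) \<and> \<bar>S i \<omega>\<bar> > 2 * x}" for i
    using As by (auto simp: E)
  have [measurable]: "E i \<in> events" for i unfolding Eeq by measurable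
  have disj: "disjoint_family_on E {..n}"
    by (auto simp: disjoint_family_on_def E) (metis linorder_neqE_nat not_less)
  have U: "{\<omega>\<in>A. \<exists>i\<le>n. \<bar>S i \<omega>\<bar> > 2 * x} = (\<Union>i\<in>{..n}. E i)"
  proof (intro equalityI subsetI)
    fix \<omega> assume w: "\<omega> \<in> {\<omega>\<in>A. \<exists>i\<le>n. \<bar>S i \<omega>\<bar> > 2 * x}"
    then obtain i where i: "i \<le> n" "\<bar>S i \<omega>\<bar> > 2 * x" by auto
    define l where "l = (LEAST i. \<bar>S i \<omega>\<bar> > 2 * x)"
    have "\<bar>S l \<omega>\<bar> > 2 * x" unfolding l_def by (rule LeastI) (fact i)
    moreover have "l \<le> i" unfolding l_def by (rule Least_le) (fact i)
    moreover have "\<bar>S j \<omega>\<bar> \<le> 2 * x" if "j < l" for j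
      using not_less_Least[of j "\<lambda>i. \<bar>S i \<omega>\<bar> > 2 * x"] that by (auto simp: l_def)
    ultimately show "\<omega> \<in> (\<Union>i\<in>{..n}. E i)" using w i by (auto simp: E intro!: bexI[of _ l])
  qed (auto simp: E)
  let ?F = "A \<inter> {\<omega>\<in>space M. \<bar>S n \<omega>\<bar> > x}"
  have step: "(1 - p) * prob (E i) \<le> prob (E i \<inter> ?F)" if "i \<le> n" for i
  proof -
    have "E i \<subseteq> (E i \<inter> {\<omega>\<in>space M. \<bar>S n \<omega> - S i \<omega>\<bar> > x}) \<union> (E i \<inter> ?F)"
      using As by (auto simp: E)
    then have "prob (E i) \<le> prob ((E i \<inter> {\<omega>\<in>space M. \<bar>S n \<omega> - S i \<omega>\<bar> > x}) \<union> (E i \<inter> ?F))"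
      by (rule finite_measure_mono) measurable
    also have "\<dots> \<le> prob (E i \<inter> {\<omega>\<in>space M. \<bar>S n \<omega> - S i \<omega>\<bar> > x}) + prob (E i \<inter> ?F)"
      by (rule measure_Un_le) measurable
    also have "\<dots> \<le> p * prob (E i) + prob (E i \<inter> ?F)" using inc[OF that] by simp
    finally show ?thesis by (simp add: algebra_simps)
  qed
  have "(1 - p) * prob (\<Union>i\<in>{..n}. E i) = (\<Sum>i\<le>n. (1 - p) * prob (E i))"
    by (subst finite_measure_finite_Union[OF _ _ disj]) (auto simp: sum_distrib_left)
  also have "\<dots> \<le> (\<Sum>i\<le>n. prob (E i \<inter> ?F))" by (intro sum_mono step) auto
  also have "\<dots> = prob (\<Union>i\<in>{..n}. E i \<inter> ?F)"
    by (rule finite_measure_finite_Union[symmetric])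
      (use disj in \<open>auto simp: disjoint_family_on_def\<close>)
  also have "\<dots> \<le> prob ?F" by (rule finite_measure_mono) auto
  also have "\<dots> \<le> p * prob A" by (rule fin)
  finally have a: "(1 - p) * prob (\<Union>i\<in>{..n}. E i) \<le> p * prob A" .
  have "1 / 2 * prob (\<Union>i\<in>{..n}. E i) \<le> (1 - p) * prob (\<Union>i\<in>{..n}. E i)"
    using p by (intro mult_right_mono) auto
  then show ?thesis using a unfolding U by linarith
qed

section \<open>Laplace transforms and tails of the increments\<close>

locale sp_levy_process = prob_space N for N :: "'b measure" +
  fixes Z :: "real \<Rightarrow> 'b \<Rightarrow> real" and y :: real and \<Psi> :: "real \<Rightarrow> real"
  assumes levy: "sp_levy N Z y \<Psi>"
begin

lemma Z_measurable: "t \<ge> 0 \<Longrightarrow> Z t \<in> borel_measurable N"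
  and Z_start: "\<omega> \<in> space N \<Longrightarrow> Z 0 \<omega> = y"
  and Z_cadlag: "\<omega> \<in> space N \<Longrightarrow> cadlag0 (\<lambda>t. Z t \<omega>)"
  and Z_indep: "0 \<le> ts 0 \<Longrightarrow> (\<And>i. i < n \<Longrightarrow> ts i \<le> ts (Suc i)) \<Longrightarrow>
    indep_vars (\<lambda>_. borel) (\<lambda>i \<omega>. Z (ts (Suc i)) \<omega> - Z (ts i) \<omega>) {..<n}"
  and Z_stationary: "0 \<le> s \<Longrightarrow> s \<le> t \<Longrightarrow>
    distr N borel (\<lambda>\<omega>. Z t \<omega> - Z s \<omega>) = distr N borel (\<lambda>\<omega>. Z (t - s) \<omega> - Z 0 \<omega>)"
  and Z_laplace: "l \<ge> 0 \<Longrightarrow> expectation (\<lambda>\<omega>. exp (- l * Z 1 \<omega>)) = exp (- l * y + \<Psi> l)"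
  using levy unfolding sp_levy_def by blast+

lemma Z_nat_measurable [measurable]: "Z (real i / real n) \<in> borel_measurable N" "Z (real i) \<in> borel_measurable N"
  by (auto intro: Z_measurable)

lemma laplace_one:
  assumes "l \<ge> 0" shows "(\<integral>\<^sup>+\<omega>. ennreal (exp (- l * (Z 1 \<omega> - Z 0 \<omega>))) \<partial>N) = ennreal (exp (\<Psi> l))"
proof -
  have [measurable]: "Z 1 \<in> borel_measurable N" "Z 0 \<in> borel_measurable N" by (auto intro: Z_measurable)
  \<comment> \<open>A non-integrable function has Bochner integral 0, whereas the prescribed value
    is positive; so integrability follows from the value.\<close>
  have "integrable N (\<lambda>\<omega>. exp (- l * Z 1 \<omega>))"
    using not_integrable_integral_eq[of N "\<lambda>\<omega>. exp (- l * Z 1 \<omega>)"] Z_laplace[OF assms] by force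
  then have "(\<integral>\<^sup>+\<omega>. ennreal (exp (- l * Z 1 \<omega>)) \<partial>N) = ennreal (exp (- l * y + \<Psi> l))"
    using Z_laplace[OF assms] by (subst nn_integral_eq_integral) auto
  have "(\<integral>\<^sup>+\<omega>. ennreal (exp (- l * (Z 1 \<omega> - Z 0 \<omega>))) \<partial>N)
      = (\<integral>\<^sup>+\<omega>. ennreal (exp (l * y)) * ennreal (exp (- l * Z 1 \<omega>)) \<partial>N)"
    by (intro nn_integral_cong)
      (simp add: Z_start ennreal_mult[symmetric] exp_add[symmetric] algebra_simps)
  also have "\<dots> = ennreal (exp (l * y)) * (\<integral>\<^sup>+\<omega>. ennreal (exp (- l * Z 1 \<omega>)) \<partial>N)"
    by (rule nn_integral_cmult) measurable
  also have "\<dots> = ennreal (exp (\<Psi> l))"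
    unfolding \<open>(\<integral>\<^sup>+\<omega>. ennreal (exp (- l * Z 1 \<omega>)) \<partial>N) = ennreal (exp (- l * y + \<Psi> l))\<close>
    by (simp add: ennreal_mult[symmetric] exp_add[symmetric])
  finally show ?thesis .
qed

lemma laplace_power:
  assumes n: "n > 0"
  shows "(\<integral>\<^sup>+\<omega>. ennreal (exp (- l * (Z (real j / real n) \<omega> - Z 0 \<omega>))) \<partial>N)
    = (\<integral>\<^sup>+\<omega>. ennreal (exp (- l * (Z (1 / real n) \<omega> - Z 0 \<omega>))) \<partial>N) ^ j"
proof -
  define ts where "ts i = real i / real n" for i
  have [measurable]: "Z (ts i) \<in> borel_measurable N" for i by (auto intro: Z_measurable simp: ts_def)
  define D where "D i \<omega> = Z (ts (Suc i)) \<omega> - Z (ts i) \<omega>" for i \<omega>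
  have [measurable]: "D i \<in> borel_measurable N" for i unfolding D_def by measurable
  have "indep_vars (\<lambda>_. borel) D {..<j}"
    unfolding D_def by (rule Z_indep[of ts]) (auto simp: ts_def divide_right_mono)
  then have ind: "indep_vars (\<lambda>_. borel) (\<lambda>i \<omega>. ennreal (exp (- l * D i \<omega>))) {..<j}"
    by (rule indep_vars_compose2) measurable
  have step: "(\<integral>\<^sup>+\<omega>. ennreal (exp (- l * D i \<omega>)) \<partial>N)
      = (\<integral>\<^sup>+\<omega>. ennreal (exp (- l * (Z (1 / real n) \<omega> - Z 0 \<omega>))) \<partial>N)" for i
  proof -
    have [measurable]: "Z (1 / real n) \<in> borel_measurable N" "Z 0 \<in> borel_measurable N" by (auto intro: Z_measurable)
    have d: "distr N borel (D i) = distr N borel (\<lambda>\<omega>. Z (1 / real n) \<omega> - Z 0 \<omega>)"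
    proof -
      have e: "ts (Suc i) - ts i = 1 / real n" by (simp add: ts_def diff_divide_distrib[symmetric])
      show ?thesis unfolding D_def[abs_def] using Z_stationary[of "ts i" "ts (Suc i)"] unfolding e
        by (auto simp: ts_def divide_right_mono)
    qed
    have "(\<integral>\<^sup>+\<omega>. ennreal (exp (- l * D i \<omega>)) \<partial>N) = (\<integral>\<^sup>+v. ennreal (exp (- l * v)) \<partial>distr N borel (D i))"
      by (subst nn_integral_distr) auto
    also have "\<dots> = (\<integral>\<^sup>+\<omega>. ennreal (exp (- l * (Z (1 / real n) \<omega> - Z 0 \<omega>))) \<partial>N)"
      unfolding d by (subst nn_integral_distr) auto
    finally show ?thesis .
  qed
  have "(\<integral>\<^sup>+\<omega>. ennreal (exp (- l * (Z (real j / real n) \<omega> - Z 0 \<omega>))) \<partial>N)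
      = (\<integral>\<^sup>+\<omega>. (\<Prod>i<j. ennreal (exp (- l * D i \<omega>))) \<partial>N)"
  proof (rule nn_integral_cong)
    fix \<omega>
    have "(\<Sum>i<j. D i \<omega>) = Z (ts j) \<omega> - Z (ts 0) \<omega>"
      unfolding D_def by (rule sum_lessThan_telescope)
    then have "exp (- l * (Z (real j / real n) \<omega> - Z 0 \<omega>)) = exp (\<Sum>i<j. - l * D i \<omega>)"
      unfolding sum_distrib_left[symmetric] by (simp add: ts_def)
    then show "ennreal (exp (- l * (Z (real j / real n) \<omega> - Z 0 \<omega>))) = (\<Prod>i<j. ennreal (exp (- l * D i \<omega>)))"
      by (simp add: exp_sum prod_ennreal)
  qed
  also have "\<dots> = (\<Prod>i<j. (\<integral>\<^sup>+\<omega>. ennreal (exp (- l * D i \<omega>)) \<partial>N))"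
    by (rule indep_vars_nn_integral[OF _ ind]) auto
  also have "\<dots> = (\<integral>\<^sup>+\<omega>. ennreal (exp (- l * (Z (1 / real n) \<omega> - Z 0 \<omega>))) \<partial>N) ^ j"
    unfolding step by simp
  finally show ?thesis .
qed

text \<open>\<open>sp_levy\<close> prescribes the transform at time 1. Splitting the unit interval
  into \<open>n\<close> independent equal increments makes the transform at \<open>1 / n\<close> the
  nonnegative \<open>n\<close>-th root of \<open>exp (\<Psi> l)\<close>, which is unique, and its
  powers reach all rational times.\<close>

lemma laplace_rational:
  assumes n: "n > 0" and l: "l \<ge> 0"
  shows "(\<integral>\<^sup>+\<omega>. ennreal (exp (- l * (Z (real j / real n) \<omega> - Z 0 \<omega>))) \<partial>N)
    = ennreal (exp (real j / real n * \<Psi> l))"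
proof -
  define a where "a = (\<integral>\<^sup>+\<omega>. ennreal (exp (- l * (Z (1 / real n) \<omega> - Z 0 \<omega>))) \<partial>N)"
  have an: "a ^ n = ennreal (exp (\<Psi> l))"
    using laplace_power[OF n, of l n] laplace_one[OF l] n unfolding a_def by simp
  \<comment> \<open>An infinite transform at time \<open>1 / n\<close> would have an infinite
    \<open>n\<close>-th power.\<close>
  have "a < \<top>"
  proof (rule ccontr)
    assume "\<not> a < \<top>"
    then have "a = \<top>" using top.not_eq_extremum by blast
    then have "a ^ n = \<top>" using n by (simp add: power_eq_top_ennreal)
    then show False using an by simp
  qed
  then obtain r where r: "r \<ge> 0" "a = ennreal r" by (metis ennreal_cases less_irrefl top.not_eq_extremum)
  have "r ^ n = exp (\<Psi> l)" using an r by (simp add: ennreal_power)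
  also have "\<dots> = exp (\<Psi> l / real n) ^ n" using n by (simp add: exp_of_nat_mult[symmetric])
  finally have "r = exp (\<Psi> l / real n)" using r n by (intro power_eq_imp_eq_base[of r n]) auto
  then have "a ^ j = ennreal (exp (real j / real n * \<Psi> l))"
    using r by (simp add: ennreal_power exp_of_nat_mult[symmetric])
  then show ?thesis using laplace_power[OF n, of l j] by (simp add: a_def)
qed

end

locale sp_levy_drift = sp_levy_process +
  fixes \<gamma> :: real and \<psi> :: "real \<Rightarrow> real"
  assumes \<psi>: "\<And>l. \<psi> l = \<Psi> l - \<gamma> * l" and \<psi>_nonneg: "\<And>l. l > 0 \<Longrightarrow> \<psi> l \<ge> 0"
begin

text \<open>Chebyshev's inequality for \<open>(1 - exp (- v))\<^sup>2\<close> with \<open>v\<close> the compensated increment divided by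
  \<open>x\<close>: its mean is an explicit combination of Laplace transforms, and it is bounded away from \<open>0\<close>
  on both tails.\<close>

lemma increment_tail:
  assumes n: "n > 0" and x: "x > 0" and ij: "i \<le> j"
  shows "prob {\<omega>\<in>space N. \<bar>Z (real j / real n) \<omega> - Z (real i / real n) \<omega> + \<gamma> * (real (j - i) / real n)\<bar> > x}
    \<le> 4 * (exp (real (j - i) / real n * \<psi> (2 / x)) - 1)"
proof -
  define u where "u = real (j - i) / real n"
  have u: "u \<ge> 0" by (simp add: u_def)
  define W where "W \<omega> = Z u \<omega> - Z 0 \<omega> + \<gamma> * u" for \<omega>
  have [measurable]: "Z u \<in> borel_measurable N" "Z 0 \<in> borel_measurable N" using u by (auto intro: Z_measurable)
  have [measurable]: "W \<in> borel_measurable N" unfolding W_def by measurable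
  have lap: "has_bochner_integral N (\<lambda>\<omega>. exp (- l * W \<omega>)) (exp (u * \<psi> l))" if "l \<ge> 0" for l
  proof (rule has_bochner_integral_nn_integral)
    have "(\<integral>\<^sup>+\<omega>. ennreal (exp (- l * W \<omega>)) \<partial>N)
        = (\<integral>\<^sup>+\<omega>. ennreal (exp (- l * \<gamma> * u)) * ennreal (exp (- l * (Z u \<omega> - Z 0 \<omega>))) \<partial>N)"
      by (intro nn_integral_cong) (simp add: W_def ennreal_mult[symmetric] exp_add[symmetric] algebra_simps)
    also have "\<dots> = ennreal (exp (- l * \<gamma> * u)) * ennreal (exp (u * \<Psi> l))"
      using laplace_rational[OF n that, of "j - i"] by (subst nn_integral_cmult) (auto simp: u_def)
    also have "\<dots> = ennreal (exp (u * \<psi> l))"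
      by (simp add: \<psi> ennreal_mult[symmetric] exp_add[symmetric] algebra_simps)
    finally show "(\<integral>\<^sup>+\<omega>. ennreal (exp (- l * W \<omega>)) \<partial>N) = ennreal (exp (u * \<psi> l))" .
  qed auto
  define l where "l = 1 / x"
  have l: "l > 0" using x by (simp add: l_def)
  have i: "integrable N (\<lambda>\<omega>. exp (- l * W \<omega>))" "expectation (\<lambda>\<omega>. exp (- l * W \<omega>)) = exp (u * \<psi> l)"
    "integrable N (\<lambda>\<omega>. exp (- (2 * l) * W \<omega>))" "expectation (\<lambda>\<omega>. exp (- (2 * l) * W \<omega>)) = exp (u * \<psi> (2 * l))"
    using lap[of l] lap[of "2 * l"] l unfolding has_bochner_integral_iff by simp_all
  have expand: "(1 - exp (- l * W \<omega>))\<^sup>2 = 1 - 2 * exp (- l * W \<omega>) + exp (- (2 * l) * W \<omega>)" for \<omega>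
    by (simp add: power2_eq_square algebra_simps exp_add[symmetric])
  have i2: "integrable N (\<lambda>\<omega>. 1 - 2 * exp (- l * W \<omega>))"
    by (intro Bochner_Integration.integrable_diff integrable_mult_right i integrable_const)
  have E1: "integrable N (\<lambda>\<omega>. (1 - exp (- l * W \<omega>))\<^sup>2)"
    unfolding expand by (intro Bochner_Integration.integrable_add i i2)
  have "expectation (\<lambda>\<omega>. (1 - exp (- l * W \<omega>))\<^sup>2)
      = expectation (\<lambda>\<omega>. 1 - 2 * exp (- l * W \<omega>)) + exp (u * \<psi> (2 * l))"
    unfolding expand by (subst Bochner_Integration.integral_add[OF i2 i(3)]) (simp only: i)
  also have "expectation (\<lambda>\<omega>. 1 - 2 * exp (- l * W \<omega>)) = 1 - 2 * exp (u * \<psi> l)"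
    by (subst Bochner_Integration.integral_diff)
      (simp_all only: integrable_const integrable_mult_right i integral_mult_right_zero, simp_all add: prob_space)
  finally have E: "expectation (\<lambda>\<omega>. (1 - exp (- l * W \<omega>))\<^sup>2) = 1 - 2 * exp (u * \<psi> l) + exp (u * \<psi> (2 * l))" .
  \<comment> \<open>Nonnegativity of \<psi> makes the cross term at most \<open>-2\<close>, so the
    mean is at most \<open>exp (u * \<psi> (2 / x)) - 1\<close>, which is small.\<close>
  have "exp (u * \<psi> l) \<ge> 1" using u \<psi>_nonneg[OF l] by simp
  moreover have "2 * l = 2 / x" by (simp add: l_def)
  ultimately have E2: "expectation (\<lambda>\<omega>. (1 - exp (- l * W \<omega>))\<^sup>2) \<le> exp (u * \<psi> (2 / x)) - 1"
    using E by simp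
  \<comment> \<open>The lower bound follows on both sides from \<open>exp 1 >= 2\<close>; its
    reciprocal is the constant 4 of the claim.\<close>
  have sq: "(1 - exp (- v))\<^sup>2 \<ge> 1 / 4" if "\<bar>v\<bar> \<ge> 1" for v :: real
  proof -
    have "exp (1::real) \<ge> 2" using exp_ge_add_one_self[of 1] by simp
    have "\<bar>1 - exp (- v)\<bar> \<ge> 1 / 2"
    proof (cases "v \<ge> 1")
      case True
      have "exp (- v) \<le> exp (- 1)" using True by simp
      also have "\<dots> = 1 / exp 1" by (simp add: exp_minus field_simps)
      also have "\<dots> \<le> 1 / 2" using \<open>exp (1::real) \<ge> 2\<close> by (intro divide_left_mono) auto
      finally show ?thesis by linarith
    next
      case False
      then have "exp 1 \<le> exp (- v)" using that by simp
      then show ?thesis using \<open>exp (1::real) \<ge> 2\<close> by linarith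
    qed
    then have "(1 / 2)\<^sup>2 \<le> \<bar>1 - exp (- v)\<bar>\<^sup>2" by (intro power_mono) auto
    then show ?thesis by (simp add: power2_eq_square)
  qed
  have "prob {\<omega>\<in>space N. \<bar>W \<omega>\<bar> > x} \<le> prob {\<omega>\<in>space N. (1 - exp (- l * W \<omega>))\<^sup>2 \<ge> 1 / 4}"
  proof (rule finite_measure_mono)
    show "{\<omega>\<in>space N. \<bar>W \<omega>\<bar> > x} \<subseteq> {\<omega>\<in>space N. (1 - exp (- l * W \<omega>))\<^sup>2 \<ge> 1 / 4}"
    proof safe
      fix \<omega> assume "x < \<bar>W \<omega>\<bar>"
      then have "\<bar>l * W \<omega>\<bar> \<ge> 1" using x by (simp add: l_def abs_mult field_simps)
      from sq[OF this] show "(1 - exp (- l * W \<omega>))\<^sup>2 \<ge> 1 / 4" by simp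
    qed
  qed measurable
  also have "\<dots> \<le> expectation (\<lambda>\<omega>. (1 - exp (- l * W \<omega>))\<^sup>2) / (1 / 4)"
    using E1 by (rule integral_Markov_inequality_measure[where A = "space N"]) auto
  also have "\<dots> \<le> 4 * (exp (u * \<psi> (2 / x)) - 1)" using E2 by simp
  finally have *: "prob {\<omega>\<in>space N. \<bar>W \<omega>\<bar> > x} \<le> 4 * (exp (u * \<psi> (2 / x)) - 1)" .
  have e: "real j / real n - real i / real n = u"
    using ij by (simp add: u_def of_nat_diff diff_divide_distrib)
  have d: "distr N borel (\<lambda>\<omega>. Z (real j / real n) \<omega> - Z (real i / real n) \<omega>) = distr N borel (\<lambda>\<omega>. Z u \<omega> - Z 0 \<omega>)"
    using Z_stationary[of "real i / real n" "real j / real n"] ij unfolding e by (auto simp: divide_right_mono)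
  have "prob {\<omega>\<in>space N. \<bar>Z (real j / real n) \<omega> - Z (real i / real n) \<omega> + \<gamma> * u\<bar> > x}
      = measure (distr N borel (\<lambda>\<omega>. Z (real j / real n) \<omega> - Z (real i / real n) \<omega>)) {v. \<bar>v + \<gamma> * u\<bar> > x}"
    by (subst measure_distr) (auto intro!: arg_cong[where f = prob])
  also have "\<dots> = prob {\<omega>\<in>space N. \<bar>W \<omega>\<bar> > x}"
    unfolding d by (subst measure_distr) (auto intro!: arg_cong[where f = prob] simp: W_def)
  finally show ?thesis using * by (simp add: u_def)
qed

end

section \<open>Independence of later increments from the grid path\<close>

context sp_levy_process
begin

text \<open>The grid path up to \<open>i\<close> is a measurable function of \<open>y\<close> and
  the first \<open>i\<close> increments, so it suffices to separate these from one further
  increment.\<close>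

lemma grid_indep:
  assumes n: "n > 0" and ij: "i \<le> j" and B: "B \<in> sets (PiM {..i} (\<lambda>_. borel))" and C: "C \<in> sets borel"
  defines "P \<equiv> (\<lambda>\<omega>. \<lambda>k\<in>{..i}. Z (real k / real n) \<omega>)"
    and "D \<equiv> (\<lambda>\<omega>. Z (real j / real n) \<omega> - Z (real i / real n) \<omega>)"
  shows "prob {\<omega>\<in>space N. P \<omega> \<in> B \<and> D \<omega> \<in> C} = prob {\<omega>\<in>space N. P \<omega> \<in> B} * prob {\<omega>\<in>space N. D \<omega> \<in> C}"
proof -
  \<comment> \<open>From \<open>i + 1\<close> on the times are constant, so the increment with index
    \<open>i\<close> covers the whole span from \<open>i\<close> to \<open>j\<close>.\<close>
  define ts where "ts k = (if k \<le> i then real k / real n else real j / real n)" for k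
  define I where "I k \<omega> = Z (ts (Suc k)) \<omega> - Z (ts k) \<omega>" for k \<omega>
  have "indep_vars (\<lambda>_. borel) I {..<Suc i}"
    unfolding I_def
  proof (rule Z_indep[of ts])
    show "0 \<le> ts 0" by (simp add: ts_def)
    fix k assume "k < Suc i"
    show "ts k \<le> ts (Suc k)" using ij n \<open>k < Suc i\<close> by (auto simp: ts_def intro!: divide_right_mono)
  qed
  then have ind: "indep_var (PiM {..<i} (\<lambda>_. borel)) (\<lambda>\<omega>. restrict (\<lambda>k. I k \<omega>) {..<i})
      (PiM {i} (\<lambda>_. borel)) (\<lambda>\<omega>. restrict (\<lambda>k. I k \<omega>) {i})"
    by (rule indep_var_restrict) auto
  define G where "G w = (\<lambda>k\<in>{..i}. y + (\<Sum>m<k. w m))" for w :: "nat \<Rightarrow> real"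
  have G: "G \<in> measurable (PiM {..<i} (\<lambda>_. borel)) (PiM {..i} (\<lambda>_. borel))"
    unfolding G_def
  proof (rule measurable_restrict)
    fix k assume k: "k \<in> {..i}"
    have "(\<lambda>w. w m) \<in> borel_measurable (PiM {..<i} (\<lambda>_. borel))" if "m < k" for m
      using k that by (intro measurable_component_singleton) auto
    then show "(\<lambda>w. y + (\<Sum>m<k. w m)) \<in> borel_measurable (PiM {..<i} (\<lambda>_. borel))"
      by (intro borel_measurable_add borel_measurable_sum borel_measurable_const) auto
  qed
  let ?D = "\<lambda>\<omega>. restrict (\<lambda>k. I k \<omega>) {i}"
  have ind2: "indep_var (PiM {..i} (\<lambda>_. borel)) (G \<circ> (\<lambda>\<omega>. restrict (\<lambda>k. I k \<omega>) {..<i}))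
      (PiM {i} (\<lambda>_. borel)) ((\<lambda>w. w) \<circ> ?D)"
    by (rule indep_var_compose[OF ind G]) simp
  define C' where "C' = {w \<in> space (PiM {i} (\<lambda>_. borel :: real measure)). w i \<in> C}"
  have C': "C' \<in> sets (PiM {i} (\<lambda>_. borel))"
    unfolding C'_def using C by measurable
  have GP: "(G \<circ> (\<lambda>\<omega>. restrict (\<lambda>k. I k \<omega>) {..<i})) \<omega> = P \<omega>" if "\<omega> \<in> space N" for \<omega>
  proof (rule ext)
    fix k
    have "(\<Sum>m<k. restrict (\<lambda>k. I k \<omega>) {..<i} m) = (\<Sum>m<k. I m \<omega>)" if "k \<le> i"
      by (rule sum.cong) (use that in auto)
    also have "\<dots> = Z (ts k) \<omega> - Z (ts 0) \<omega>" unfolding I_def by (rule sum_lessThan_telescope)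
    finally show "(G \<circ> (\<lambda>\<omega>. restrict (\<lambda>k. I k \<omega>) {..<i})) \<omega> k = P \<omega> k"
      using Z_start[OF that] by (auto simp: G_def P_def ts_def)
  qed
  have HD: "((\<lambda>w. w) \<circ> ?D) \<omega> \<in> C' \<longleftrightarrow> D \<omega> \<in> C" for \<omega>
    by (simp add: C'_def D_def I_def ts_def space_PiM)
  have 1: "(\<lambda>x. ((G \<circ> (\<lambda>\<omega>. restrict (\<lambda>k. I k \<omega>) {..<i})) x, ((\<lambda>w. w) \<circ> ?D) x)) -` (B \<times> C') \<inter> space N
      = {\<omega>\<in>space N. P \<omega> \<in> B \<and> D \<omega> \<in> C}"
    using GP HD by (auto simp del: o_apply)
  have 2: "(G \<circ> (\<lambda>\<omega>. restrict (\<lambda>k. I k \<omega>) {..<i})) -` B \<inter> space N = {\<omega>\<in>space N. P \<omega> \<in> B}"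
    using GP by (auto simp del: o_apply)
  have 3: "((\<lambda>w. w) \<circ> ?D) -` C' \<inter> space N = {\<omega>\<in>space N. D \<omega> \<in> C}"
    using HD by (auto simp del: o_apply)
  show ?thesis using indep_varD[OF ind2 B C'] unfolding 1 2 3 .
qed

lemma grid_indep_pred:
  assumes n: "n > 0" and ij: "i \<le> j" and Q: "Measurable.pred (PiM {..i} (\<lambda>_. borel)) Q"
    and C: "C \<in> sets borel"
    and QE: "\<And>\<omega>. \<omega> \<in> space N \<Longrightarrow> \<omega> \<in> E \<longleftrightarrow> Q (\<lambda>k\<in>{..i}. Z (real k / real n) \<omega>)" and E: "E \<subseteq> space N"
  shows "prob (E \<inter> {\<omega>\<in>space N. Z (real j / real n) \<omega> - Z (real i / real n) \<omega> \<in> C})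
    = prob E * prob {\<omega>\<in>space N. Z (real j / real n) \<omega> - Z (real i / real n) \<omega> \<in> C}"
proof -
  define B where "B = {w \<in> space (PiM {..i} (\<lambda>_. borel :: real measure)). Q w}"
  have B: "B \<in> sets (PiM {..i} (\<lambda>_. borel))" unfolding B_def using Q by measurable
  have b: "(\<lambda>k\<in>{..i}. Z (real k / real n) \<omega>) \<in> B \<longleftrightarrow> \<omega> \<in> E" if "\<omega> \<in> space N" for \<omega>
    using QE[OF that] by (auto simp: B_def space_PiM)
  have 1: "{\<omega>\<in>space N. (\<lambda>k\<in>{..i}. Z (real k / real n) \<omega>) \<in> B \<and> Z (real j / real n) \<omega> - Z (real i / real n) \<omega> \<in> C}
    = E \<inter> {\<omega>\<in>space N. Z (real j / real n) \<omega> - Z (real i / real n) \<omega> \<in> C}"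
    and 2: "{\<omega>\<in>space N. (\<lambda>k\<in>{..i}. Z (real k / real n) \<omega>) \<in> B} = E"
    using b E by auto
  show ?thesis using grid_indep[OF n ij B C] unfolding 1 2 .
qed

end

section \<open>Maximal deviations after the first passage below a level\<close>

context sp_levy_drift
begin

text \<open>Ottaviani's inequality for the walk on the grid of mesh \<open>1 / n\<close>, inside the
  event that \<open>a\<close> is the first integer time at or below \<open>c\<close>. Integer times
  are the grid indices \<open>j * n\<close>, so this event is decided by the grid path up to time
  \<open>a\<close>. The factor \<open>prob A\<close> on the right is kept for a summation over
  \<open>a\<close>.\<close>

lemma hitting_block_grid:
  fixes a L n :: nat and c :: real
  assumes n: "n > 0" and x: "x > 0" and p: "4 * (exp (real L * \<psi> (2 / x)) - 1) \<le> p" "p \<le> 1 / 2"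
  defines "A \<equiv> {\<omega>\<in>space N. Z (real a) \<omega> \<le> c \<and> (\<forall>j<a. c < Z (real j) \<omega>)}"
  shows "prob {\<omega>\<in>A. \<exists>i\<le>n * L. \<bar>Z (real (a * n + i) / real n) \<omega> - Z (real a) \<omega> + \<gamma> * (real i / real n)\<bar> > 2 * x}
    \<le> 2 * p * prob A"
proof -
  define W where "W k \<omega> = Z (real k / real n) \<omega>" for k \<omega>
  have [measurable]: "W k \<in> borel_measurable N" for k unfolding W_def by (auto intro: Z_measurable)
  have Wa: "W (j * n) = Z (real j)" for j using n by (simp add: W_def[abs_def])
  define S where "S i \<omega> = W (a * n + i) \<omega> - W (a * n) \<omega> + \<gamma> * (real i / real n)" for i \<omega>
  have [measurable]: "S k \<in> borel_measurable N" for k unfolding S_def by measurable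
  define E where "E i = {\<omega>\<in>A. (\<forall>j<i. \<bar>S j \<omega>\<bar> \<le> 2 * x) \<and> \<bar>S i \<omega>\<bar> > 2 * x}" for i
  have [measurable]: "A \<in> events" unfolding A_def by measurable
  have psi: "\<psi> (2 / x) \<ge> 0" using \<psi>_nonneg x by simp
  have tail: "prob {\<omega>\<in>space N. W j \<omega> - W i \<omega> \<in> {v. \<bar>v + \<gamma> * (real (j - i) / real n)\<bar> > x}} \<le> p"
    if "i \<le> j" "j - i \<le> n * L" for i j
  proof -
    have "real (j - i) / real n \<le> real L" using n of_nat_mono[OF that(2), where 'a = real] by (simp add: field_simps)
    then have "real (j - i) / real n * \<psi> (2 / x) \<le> real L * \<psi> (2 / x)" using psi by (intro mult_right_mono) auto
    then have "4 * (exp (real (j - i) / real n * \<psi> (2 / x)) - 1) \<le> p" using p(1) by (smt (verit) exp_le_cancel_iff)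
    then show ?thesis using increment_tail[OF n x that(1)] by (simp add: W_def)
  qed
  have "1 \<le> exp (real L * \<psi> (2 / x))" using psi by simp
  then have "0 \<le> 4 * (exp (real L * \<psi> (2 / x)) - 1)" by simp
  then have p0: "0 \<le> p" using p(1) by (rule order_trans)
  have Qind: "prob (F \<inter> {\<omega>\<in>space N. W j \<omega> - W i \<omega> \<in> {v. \<bar>v + \<gamma> * (real (j - i) / real n)\<bar> > x}}) \<le> p * prob F"
    if "i \<le> j" "j - i \<le> n * L" "Measurable.pred (PiM {..i} (\<lambda>_. borel)) Q"
      "\<And>\<omega>. \<omega> \<in> space N \<Longrightarrow> \<omega> \<in> F \<longleftrightarrow> Q (\<lambda>k\<in>{..i}. W k \<omega>)" "F \<subseteq> space N" for i j Q F
  proof -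
    have "prob (F \<inter> {\<omega>\<in>space N. W j \<omega> - W i \<omega> \<in> {v. \<bar>v + \<gamma> * (real (j - i) / real n)\<bar> > x}})
      = prob F * prob {\<omega>\<in>space N. W j \<omega> - W i \<omega> \<in> {v. \<bar>v + \<gamma> * (real (j - i) / real n)\<bar> > x}}"
      unfolding W_def by (rule grid_indep_pred[OF n that(1,3)]) (use that(4,5) in \<open>auto simp: W_def\<close>)
    also have "\<dots> \<le> prob F * p" using tail[OF that(1,2)] by (intro mult_left_mono) auto
    finally show ?thesis by (simp add: mult.commute)
  qed
  have comp: "(\<lambda>w. w k) \<in> borel_measurable (PiM {..i} (\<lambda>_. borel))" if "k \<le> i" for k i :: nat
    using that by (intro measurable_component_singleton) auto
  have an: "j * n \<le> a * n + i" if "j < a" for i j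
    by (rule trans_le_add1, rule mult_le_mono1) (use that in simp)
  have pl: "Measurable.pred K (\<lambda>w. f w \<le> g w)"
    if "f \<in> borel_measurable K" "g \<in> borel_measurable K" for K :: "(nat \<Rightarrow> real) measure" and f g :: "(nat \<Rightarrow> real) \<Rightarrow> real"
    unfolding pred_def by (rule borel_measurable_le[OF that])
  have "prob {\<omega>\<in>A. \<exists>i\<le>n * L. \<bar>S i \<omega>\<bar> > 2 * x} \<le> 2 * p * prob A"
  proof (rule ottaviani[of S A E x "n * L" p])
    fix i assume i: "i \<le> n * L"
    \<comment> \<open>\<open>E i\<close> expressed through the grid coordinates up to
      \<open>a * n + i\<close>, which exhibits it as an event of the past of the next
      increment.\<close>
    define Q where "Q w \<longleftrightarrow> w (a * n) \<le> c \<and> (\<forall>j\<in>{..<a}. c < w (j * n)) \<and>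
      (\<forall>j\<in>{..<i}. \<bar>w (a * n + j) - w (a * n) + \<gamma> * (real j / real n)\<bar> \<le> 2 * x) \<and>
      \<bar>w (a * n + i) - w (a * n) + \<gamma> * (real i / real n)\<bar> > 2 * x" for w :: "nat \<Rightarrow> real"
    have m0: "(\<lambda>w. w (a * n)) \<in> borel_measurable (PiM {..a * n + i} (\<lambda>_. borel))" by (auto intro: comp)
    have m1: "(\<lambda>w. w (j * n)) \<in> borel_measurable (PiM {..a * n + i} (\<lambda>_. borel))" if "j \<in> {..<a}" for j
      using that by (intro comp an) auto
    have m2: "(\<lambda>w. w (a * n + j)) \<in> borel_measurable (PiM {..a * n + i} (\<lambda>_. borel))" if "j \<in> {..<i} \<or> j = i" for j
      using that by (intro comp) auto
    have m3: "(\<lambda>w. \<bar>w (a * n + j) - w (a * n) + \<gamma> * (real j / real n)\<bar>) \<in> borel_measurable (PiM {..a * n + i} (\<lambda>_. borel))"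
      if "j \<in> {..<i} \<or> j = i" for j
      by (intro borel_measurable_add borel_measurable_diff borel_measurable_abs borel_measurable_const m0 m2 that)
    have Qm: "Measurable.pred (PiM {..a * n + i} (\<lambda>_. borel)) Q"
      unfolding Q_def[abs_def]
      by (intro pred_intros_logic(3) pred_intros_finite(3) borel_measurable_pred_less pl
          finite_lessThan borel_measurable_const m0 m1 m3) auto
    have "prob (E i \<inter> {\<omega>\<in>space N. W (a * n + n * L) \<omega> - W (a * n + i) \<omega> \<in>
        {v. \<bar>v + \<gamma> * (real (a * n + n * L - (a * n + i)) / real n)\<bar> > x}}) \<le> p * prob (E i)"
    proof (rule Qind[OF _ _ Qm])
      fix \<omega> assume w: "\<omega> \<in> space N"
      show "\<omega> \<in> E i \<longleftrightarrow> Q (\<lambda>k\<in>{..a * n + i}. W k \<omega>)"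
        using w an[of _ i] by (auto simp: E_def A_def Q_def S_def Wa)
    qed (use i in \<open>auto simp: E_def A_def\<close>)
    moreover have "W (a * n + n * L) \<omega> - W (a * n + i) \<omega> + \<gamma> * (real (a * n + n * L - (a * n + i)) / real n)
        = S (n * L) \<omega> - S i \<omega>" for \<omega>
      using i by (simp add: S_def of_nat_diff algebra_simps diff_divide_distrib)
    ultimately show "prob (E i \<inter> {\<omega>\<in>space N. \<bar>S (n * L) \<omega> - S i \<omega>\<bar> > x}) \<le> p * prob (E i)" by simp
  next
    define Q where "Q w \<longleftrightarrow> w (a * n) \<le> c \<and> (\<forall>j\<in>{..<a}. c < w (j * n))" for w :: "nat \<Rightarrow> real"
    have m0: "(\<lambda>w. w (a * n)) \<in> borel_measurable (PiM {..a * n} (\<lambda>_. borel))" by (auto intro: comp)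
    have m1: "(\<lambda>w. w (j * n)) \<in> borel_measurable (PiM {..a * n} (\<lambda>_. borel))" if "j \<in> {..<a}" for j
      using an[of j 0] that by (intro comp) (simp only: add_0_right lessThan_iff)
    have Qm: "Measurable.pred (PiM {..a * n} (\<lambda>_. borel)) Q"
      unfolding Q_def[abs_def]
      by (intro pred_intros_logic(3) pred_intros_finite(3) borel_measurable_pred_less pl
          finite_lessThan borel_measurable_const m0 m1)
    have "prob (A \<inter> {\<omega>\<in>space N. W (a * n + n * L) \<omega> - W (a * n) \<omega> \<in>
        {v. \<bar>v + \<gamma> * (real (a * n + n * L - a * n) / real n)\<bar> > x}}) \<le> p * prob A"
    proof (rule Qind[OF _ _ Qm])
      fix \<omega> assume w: "\<omega> \<in> space N"
      have "j * n \<le> a * n" if "j < a" for j using an[OF that, of 0] by (simp only: add_0_right)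
      then show "\<omega> \<in> A \<longleftrightarrow> Q (\<lambda>k\<in>{..a * n}. W k \<omega>)"
        using w by (auto simp: A_def Q_def Wa)
    qed (auto simp: A_def)
    then show "prob (A \<inter> {\<omega>\<in>space N. \<bar>S (n * L) \<omega>\<bar> > x}) \<le> p * prob A" by (simp add: S_def)
  qed (use p p0 in \<open>auto simp: E_def\<close>)
  then show ?thesis by (simp add: S_def W_def[of "a * n + _"] Wa)
qed

text \<open>The first integer time \<open>a\<close> with \<open>Z a \<le> c\<close> takes countably many values, so restarting there
  only needs the independence of increments at each fixed \<open>a\<close>, not the strong Markov property.\<close>

definition block_bad :: "real \<Rightarrow> nat \<Rightarrow> real \<Rightarrow> nat \<Rightarrow> 'a set" where
  "block_bad c L e a = {\<omega>\<in>space N. (Z (real a) \<omega> \<le> c \<and> (\<forall>j<a. c < Z (real j) \<omega>)) \<and>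
     (\<exists>m. \<exists>i\<le>2 ^ m * L. \<bar>Z (real (a * 2 ^ m + i) / real (2 ^ m)) \<omega> - Z (real a) \<omega> + \<gamma> * (real i / real (2 ^ m))\<bar> > e)}"

lemma block_bad_measurable [measurable]: "block_bad c L e a \<in> events"
proof -
  have [measurable]: "Z (real (a * 2 ^ m + i) / real (2 ^ m)) \<in> borel_measurable N" for m i
    by (auto intro: Z_measurable)
  show ?thesis unfolding block_bad_def by measurable
qed

text \<open>For fixed \<open>a\<close> the dyadic grids are nested, so the grid bound passes to the
  limit. It is proportional to the probability that \<open>a\<close> is the first passage time;
  these events are disjoint, so the sum over \<open>a\<close> costs nothing.\<close>

lemma prob_block_bad:
  assumes x: "x > 0" and p: "4 * (exp (real L * \<psi> (2 / x)) - 1) \<le> p" "p \<le> 1 / 2"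
  shows "prob (\<Union>a. block_bad c L (2 * x) a) \<le> 2 * p"
proof -
  define A where "A a = {\<omega>\<in>space N. Z (real a) \<omega> \<le> c \<and> (\<forall>j<a. c < Z (real j) \<omega>)}" for a
  define G where "G a m = {\<omega>\<in>A a. \<exists>i\<le>2 ^ m * L. \<bar>Z (real (a * 2 ^ m + i) / real (2 ^ m)) \<omega> - Z (real a) \<omega>
     + \<gamma> * (real i / real (2 ^ m))\<bar> > 2 * x}" for a m
  have [measurable]: "Z (real (a * 2 ^ m + i) / real (2 ^ m)) \<in> borel_measurable N" for a m i
    by (auto intro: Z_measurable)
  have [measurable]: "A a \<in> events" for a unfolding A_def by measurable
  have Geq: "G a m = A a \<inter> {\<omega>\<in>space N. \<exists>i\<le>2 ^ m * L. \<bar>Z (real (a * 2 ^ m + i) / real (2 ^ m)) \<omega> - Z (real a) \<omega>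
     + \<gamma> * (real i / real (2 ^ m))\<bar> > 2 * x}" for a m by (auto simp: G_def A_def)
  have Gm: "G a m \<in> events" for a m unfolding Geq by measurable
  have inc: "incseq (G a)" for a
  proof (intro incseq_SucI subsetI)
    fix m \<omega> assume "\<omega> \<in> G a m"
    then obtain i where w: "\<omega> \<in> A a" and i: "i \<le> 2 ^ m * L"
      and big: "\<bar>Z (real (a * 2 ^ m + i) / real (2 ^ m)) \<omega> - Z (real a) \<omega> + \<gamma> * (real i / real (2 ^ m))\<bar> > 2 * x"
      by (auto simp: G_def)
    have "real (a * 2 ^ Suc m + 2 * i) / real (2 ^ Suc m) = real (a * 2 ^ m + i) / real (2 ^ m)"
      "real (2 * i) / real (2 ^ Suc m) = real i / real (2 ^ m)"
      by (auto simp: divide_simps)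
    moreover have "2 * i \<le> 2 ^ Suc m * L" using i by simp
    ultimately show "\<omega> \<in> G a (Suc m)"
      unfolding G_def using w big by (intro CollectI conjI exI[of _ "2 * i"]) (simp_all only:)
  qed
  have bb: "block_bad c L (2 * x) a = (\<Union>m. G a m)" for a
    by (auto simp: block_bad_def G_def A_def)
  have le: "prob (block_bad c L (2 * x) a) \<le> 2 * p * prob (A a)" for a
  proof -
    have "(\<lambda>m. prob (G a m)) \<longlonglongrightarrow> prob (\<Union>m. G a m)"
      using inc Gm by (intro finite_Lim_measure_incseq) auto
    moreover have "prob (G a m) \<le> 2 * p * prob (A a)" for m
      using hitting_block_grid[of "2 ^ m" x L p a c] x p by (simp add: G_def A_def)
    ultimately show ?thesis unfolding bb by (intro LIMSEQ_le_const2) auto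
  qed
  have dA: "disjoint_family A"
  proof (unfold disjoint_family_on_def, intro ballI impI)
    fix a b :: nat assume "a \<noteq> b"
    then show "A a \<inter> A b = {}" by (cases a b rule: linorder_cases) (auto simp: A_def not_less[symmetric])
  qed
  have sub: "block_bad c L (2 * x) a \<subseteq> A a" for a by (auto simp: bb G_def)
  have dB: "disjoint_family (block_bad c L (2 * x))"
    using dA sub unfolding disjoint_family_on_def by blast
  have sB: "(\<lambda>a. prob (block_bad c L (2 * x) a)) sums prob (\<Union>a. block_bad c L (2 * x) a)"
    by (rule finite_measure_UNION) (use dB in auto)
  have "(\<lambda>a. prob (A a)) sums prob (\<Union>a. A a)"
    by (rule finite_measure_UNION) (use dA in auto)
  then have sA: "(\<lambda>a. 2 * p * prob (A a)) sums (2 * p * prob (\<Union>a. A a))" by (rule sums_mult)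
  have "0 \<le> real L * \<psi> (2 / x)" using \<psi>_nonneg x by simp
  then have "0 \<le> 4 * (exp (real L * \<psi> (2 / x)) - 1)" by simp
  then have p0: "0 \<le> p" using p(1) by (rule order_trans)
  have "prob (\<Union>a. block_bad c L (2 * x) a) \<le> 2 * p * prob (\<Union>a. A a)"
    using le sB sA by (intro sums_le[OF _ sB sA])
  also have "\<dots> \<le> 2 * p * 1" using p0 by (intro mult_left_mono) auto
  finally show ?thesis by simp
qed

text \<open>Right-continuity carries the bound from dyadic times to all times of the window. The
  endpoint \<open>u = L\<close> is treated apart: it lies on the grid, while its approximants from
  the right would leave the window.\<close>

lemma not_block_bad:
  assumes w: "\<omega> \<in> space N" "\<And>a. \<omega> \<notin> block_bad c L e a"
    and hit: "Z (real a) \<omega> \<le> c" "\<And>j. j < a \<Longrightarrow> c < Z (real j) \<omega>" and u: "0 \<le> u" "u \<le> real L"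
  shows "\<bar>Z (real a + u) \<omega> - Z (real a) \<omega> + \<gamma> * u\<bar> \<le> e"
proof -
  have grid: "\<bar>Z (real a + real i / 2 ^ m) \<omega> - Z (real a) \<omega> + \<gamma> * (real i / 2 ^ m)\<bar> \<le> e" if "i \<le> 2 ^ m * L" for i m
  proof -
    have eq: "real (a * 2 ^ m + i) / real (2 ^ m) = real a + real i / 2 ^ m"
      "real i / real (2 ^ m) = real i / 2 ^ m" by (simp_all add: divide_simps)
    have "\<not> (\<exists>m. \<exists>i\<le>2 ^ m * L. \<bar>Z (real (a * 2 ^ m + i) / real (2 ^ m)) \<omega> - Z (real a) \<omega> + \<gamma> * (real i / real (2 ^ m))\<bar> > e)"
      using w(2)[of a] w(1) hit unfolding block_bad_def by blast
    then have "\<not> \<bar>Z (real (a * 2 ^ m + i) / real (2 ^ m)) \<omega> - Z (real a) \<omega> + \<gamma> * (real i / real (2 ^ m))\<bar> > e"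
      using that by blast
    then show ?thesis by (simp only: eq not_less)
  qed
  show ?thesis
  proof (cases "u = real L")
    case True
    then show ?thesis using grid[of L 0] by simp
  next
    case False
    define i where "i m = nat (\<lfloor>2 ^ m * u\<rfloor> + 1)" for m :: nat
    define s where "s m = real (i m) / 2 ^ m" for m
    have ri: "real (i m) = of_int \<lfloor>2 ^ m * u\<rfloor> + 1" for m using u by (simp add: i_def)
    have s1: "u < s m" for m
      using floor_correct[of "2 ^ m * u"] unfolding s_def ri by (simp add: field_simps)
    have s2: "s m \<le> u + (1 / 2) ^ m" for m
    proof -
      have "s m \<le> (2 ^ m * u + 1) / 2 ^ m" unfolding s_def ri by (intro divide_right_mono) auto
      then show ?thesis by (simp add: add_divide_distrib power_one_over)
    qed
    have iL: "i m \<le> 2 ^ m * L" for m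
    proof -
      have "2 ^ m * u < 2 ^ m * real L" using False u by simp
      then have "2 ^ m * u < of_int (2 ^ m * int L)" by simp
      then have "\<lfloor>2 ^ m * u\<rfloor> < 2 ^ m * int L" by (simp only: floor_less_iff)
      then have "\<lfloor>2 ^ m * u\<rfloor> + 1 \<le> int (2 ^ m * L)" by simp
      then show ?thesis unfolding i_def by (subst nat_le_iff) 
    qed
    have "(\<lambda>m. u + (1 / 2) ^ m) \<longlonglongrightarrow> u + 0"
      by (intro tendsto_intros LIMSEQ_realpow_zero) auto
    then have lim: "(\<lambda>m. u + (1 / 2) ^ m) \<longlonglongrightarrow> u" by simp
    have slim: "s \<longlonglongrightarrow> u"
    proof (rule tendsto_sandwich[OF _ _ tendsto_const lim])
      show "\<forall>\<^sub>F n in sequentially. u \<le> s n" using s1 by (intro always_eventually) (simp add: less_imp_le)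
      show "\<forall>\<^sub>F n in sequentially. s n \<le> u + (1 / 2) ^ n" using s2 by (intro always_eventually) blast
    qed
    then have "filterlim (\<lambda>m. real a + s m) (at_right (real a + u)) sequentially"
      unfolding filterlim_at
      by (intro conjI tendsto_add tendsto_const always_eventually allI) (use s1 in \<open>auto simp: less_imp_neq[symmetric]\<close>)
    moreover have "((\<lambda>t. Z t \<omega>) \<longlongrightarrow> Z (real a + u) \<omega>) (at_right (real a + u))"
      using Z_cadlag[OF w(1)] u by (simp add: cadlag0_def)
    ultimately have "(\<lambda>m. Z (real a + s m) \<omega>) \<longlonglongrightarrow> Z (real a + u) \<omega>" by (rule filterlim_compose[rotated])
    then have "(\<lambda>m. \<bar>Z (real a + s m) \<omega> - Z (real a) \<omega> + \<gamma> * s m\<bar>) \<longlonglongrightarrow> \<bar>Z (real a + u) \<omega> - Z (real a) \<omega> + \<gamma> * u\<bar>"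
      by (intro tendsto_intros slim)
    then show ?thesis
      by (rule LIMSEQ_le_const2) (use grid[OF iL] in \<open>auto simp: s_def\<close>)
  qed
qed

end

text \<open>A block of length about \<open>c / \<gamma>\<close> contributes an exponent of order
  \<open>c * (1 / c) powr (1 + \<delta>) = c powr - \<delta>\<close>. The threshold is
  \<open>d * c / 2\<close> because the maximal inequality doubles it.\<close>

lemma block_probability_bound:
  fixes \<psi> :: "real \<Rightarrow> real"
  assumes "\<gamma> > 0" "d > 0" "\<delta> > 0" "l0 > 0" "C > 0"
    and \<psi>: "\<And>l. 0 < l \<Longrightarrow> l < l0 \<Longrightarrow> \<psi> l \<le> C * l powr (1 + \<delta>)"
  obtains C' c0 where "C' > 0" "c0 > 0"
    "\<And>c. c \<ge> c0 \<Longrightarrow> 4 * (exp (real (nat \<lceil>c / \<gamma>\<rceil>) * \<psi> (2 / (d * c / 2))) - 1) \<le> C' * c powr (- \<delta>)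
       \<and> C' * c powr (- \<delta>) \<le> 1 / 2"
proof -
  define C1 where "C1 = 2 / \<gamma> * C * (4 / d) powr (1 + \<delta>)"
  have C1: "C1 > 0" using assms by (simp add: C1_def)
  have lim: "((\<lambda>c. 8 * C1 * c powr (- \<delta>)) \<longlongrightarrow> 8 * C1 * 0) at_top"
    using assms by (intro tendsto_mult tendsto_const tendsto_neg_powr filterlim_ident) auto
  then have "\<forall>\<^sub>F c in at_top. 8 * C1 * c powr (- \<delta>) < 1 / 2" by (intro order_tendstoD) auto
  then obtain X where X: "\<And>c. c \<ge> X \<Longrightarrow> 8 * C1 * c powr (- \<delta>) < 1 / 2" by (auto simp: eventually_at_top_linorder)
  \<comment> \<open>\<open>c >= \<gamma>\<close> makes the rounded length at most
    \<open>2 * c / \<gamma>\<close>; the last term brings \<open>4 / (d * c)\<close> into the range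
    where \<psi> is bounded.\<close>
  define c0 where "c0 = max X (max \<gamma> (8 / (d * l0)))"
  show ?thesis
  proof (rule that[of "8 * C1" c0])
    fix c assume "c0 \<le> c"
    then have c: "X \<le> c" "\<gamma> \<le> c" "8 / (d * l0) \<le> c" by (auto simp: c0_def)
    have cp: "c > 0" using c(2) assms(1) by linarith
    have l: "2 / (d * c / 2) = 4 / d / c" by simp
    have ll: "0 < 4 / d / c" "4 / d / c < l0"
    proof -
      show "0 < 4 / d / c" using assms cp by simp
      have "8 \<le> c * (d * l0)" using c(3) assms by (simp add: field_simps)
      then show "4 / d / c < l0" using assms cp by (simp add: field_simps)
    qed
    have L: "real (nat \<lceil>c / \<gamma>\<rceil>) \<le> 2 / \<gamma> * c"
    proof -
      have "1 \<le> c / \<gamma>" using c(2) assms(1) by simp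
      moreover have "real (nat \<lceil>c / \<gamma>\<rceil>) \<le> c / \<gamma> + 1" using of_int_ceiling_le_add_one[of "c / \<gamma>"] \<open>1 \<le> c / \<gamma>\<close> by simp
      moreover have "2 / \<gamma> * c = 2 * (c / \<gamma>)" by simp
      ultimately show ?thesis by linarith
    qed
    have "real (nat \<lceil>c / \<gamma>\<rceil>) * \<psi> (2 / (d * c / 2)) \<le> real (nat \<lceil>c / \<gamma>\<rceil>) * (C * (4 / d / c) powr (1 + \<delta>))"
      unfolding l using \<psi>[OF ll] by (intro mult_left_mono) auto
    also have "\<dots> \<le> (2 / \<gamma> * c) * (C * (4 / d / c) powr (1 + \<delta>))"
      using L assms by (intro mult_right_mono) auto
    also have "(4 / d / c) powr (1 + \<delta>) = (4 / d) powr (1 + \<delta>) * (c powr (- \<delta>) / c)"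
    proof -
      have "(4 / d / c) powr (1 + \<delta>) = (4 / d) powr (1 + \<delta>) / c powr (1 + \<delta>)"
        by (rule powr_divide)
      also have "c powr (1 + \<delta>) = c * c powr \<delta>" using cp by (simp add: powr_add)
      finally show ?thesis by (simp add: powr_minus_divide)
    qed
    also have "(2 / \<gamma> * c) * (C * ((4 / d) powr (1 + \<delta>) * (c powr (- \<delta>) / c))) = C1 * c powr (- \<delta>)"
      using cp by (simp add: C1_def field_simps)
    finally have a: "real (nat \<lceil>c / \<gamma>\<rceil>) * \<psi> (2 / (d * c / 2)) \<le> C1 * c powr (- \<delta>)" .
    define v where "v = C1 * c powr (- \<delta>)"
    have v: "0 \<le> v" "v \<le> 1" "8 * v \<le> 1 / 2" using X[OF c(1)] C1 by (auto simp: v_def)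
    have "exp v \<le> 1 + v + v\<^sup>2" using v by (intro exp_bound) auto
    also have "v\<^sup>2 \<le> v" using v by (simp add: power2_eq_square mult_left_le)
    finally have "4 * (exp v - 1) \<le> 8 * v" by simp
    moreover have "exp (real (nat \<lceil>c / \<gamma>\<rceil>) * \<psi> (2 / (d * c / 2))) \<le> exp v" using a by (simp add: v_def)
    ultimately have "4 * (exp (real (nat \<lceil>c / \<gamma>\<rceil>) * \<psi> (2 / (d * c / 2))) - 1) \<le> 8 * v"
      by (meson diff_right_mono mult_left_mono order_trans zero_le_numeral)
    then show "4 * (exp (real (nat \<lceil>c / \<gamma>\<rceil>) * \<psi> (2 / (d * c / 2))) - 1) \<le> 8 * C1 * c powr (- \<delta>)
       \<and> 8 * C1 * c powr (- \<delta>) \<le> 1 / 2" using v by (simp add: v_def mult.assoc)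
  qed (use C1 assms in \<open>auto simp: c0_def\<close>)
qed

text \<open>The terms grow geometrically with \<open>k\<close>, so the smallest scale controls the
  sum whatever the number of scales.\<close>

lemma geometric_powr_sum:
  fixes y \<delta> :: real
  assumes "y > 0" "\<delta> > 0"
  shows "(\<Sum>k\<le>K. (y / 2 ^ k) powr (- \<delta>)) \<le> (y / 2 ^ K) powr (- \<delta>) / (1 - 2 powr (- \<delta>))"
proof -
  define q where "q = (2::real) powr (- \<delta>)"
  have "q < 2 powr 0" unfolding q_def using assms by (intro powr_less_mono) auto
  then have q: "0 < q" "q < 1" by (auto simp: q_def)
  show ?thesis unfolding q_def[symmetric]
  proof (induction K)
    case 0
    show ?case using q by (simp add: field_simps)
  next
    case (Suc K)
    have h: "(y / 2 ^ K) powr (- \<delta>) = q * (y / 2 ^ Suc K) powr (- \<delta>)"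
      unfolding q_def using assms by (simp add: powr_mult[symmetric])
    have "(\<Sum>k\<le>Suc K. (y / 2 ^ k) powr (- \<delta>)) \<le> (q * (y / 2 ^ Suc K) powr (- \<delta>)) / (1 - q) + (y / 2 ^ Suc K) powr (- \<delta>)"
      using Suc unfolding h by simp
    also have "\<dots> = (y / 2 ^ Suc K) powr (- \<delta>) / (1 - q)" using q by (simp add: field_simps)
    finally show ?case .
  qed
qed

text \<open>A union bound over the scales. The smallest scale governs the total and is at least
  \<open>B / 4\<close>, which is why \<open>B0\<close> depends neither on \<open>y\<close> and
  \<open>K\<close> nor on the process.\<close>

lemma sp_levy_good_event:
  fixes \<psi> \<Psi> :: "real \<Rightarrow> real"
  assumes "\<gamma> > 0" "d > 0" "\<delta> > 0" "l0 > 0" "C > 0" "\<epsilon> > 0"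
    and \<psi>: "\<And>l. 0 < l \<Longrightarrow> l < l0 \<Longrightarrow> \<psi> l \<le> C * l powr (1 + \<delta>)"
    and \<psi>0: "\<And>l. l > 0 \<Longrightarrow> \<psi> l \<ge> 0" and \<Psi>: "\<And>l. \<psi> l = \<Psi> l - \<gamma> * l"
  obtains B0 where "B0 > 0"
    "\<And>(N :: 'b measure) Z y B K. \<lbrakk>sp_levy N Z y \<Psi>; B \<ge> B0; B / 4 \<le> y / 2 ^ K\<rbrakk> \<Longrightarrow>
      \<exists>G\<in>sets N. measure N G \<ge> 1 - \<epsilon> \<and> (\<forall>\<omega>\<in>G. \<forall>k n u. k \<le> K \<longrightarrow> Z (real n) \<omega> \<le> y / 2 ^ k \<longrightarrow>
        (\<forall>j<n. y / 2 ^ k < Z (real j) \<omega>) \<longrightarrow> 0 \<le> u \<longrightarrow> u \<le> real (nat \<lceil>y / 2 ^ k / \<gamma>\<rceil>) \<longrightarrow>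
          \<bar>Z (real n + u) \<omega> - Z (real n) \<omega> + \<gamma> * u\<bar> \<le> d * (y / 2 ^ k))"
proof -
  obtain C' c0 where C': "C' > 0" "c0 > 0"
    "\<And>c. c \<ge> c0 \<Longrightarrow> 4 * (exp (real (nat \<lceil>c / \<gamma>\<rceil>) * \<psi> (2 / (d * c / 2))) - 1) \<le> C' * c powr (- \<delta>)
       \<and> C' * c powr (- \<delta>) \<le> 1 / 2"
    using block_probability_bound[OF assms(1-5) \<psi>] by metis
  define D where "D = 2 * C' / (1 - 2 powr (- \<delta>))"
  have "2 powr (- \<delta>) < (2::real) powr 0" using assms by (intro powr_less_mono) auto
  then have D: "D > 0" using C' by (simp add: D_def)
  have "((\<lambda>c. D * c powr (- \<delta>)) \<longlongrightarrow> D * 0) at_top"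
    using assms by (intro tendsto_mult tendsto_const tendsto_neg_powr filterlim_ident) auto
  then have "\<forall>\<^sub>F c in at_top. D * c powr (- \<delta>) < \<epsilon>" using assms by (intro order_tendstoD) auto
  then obtain X where X: "\<And>c. c \<ge> X \<Longrightarrow> D * c powr (- \<delta>) < \<epsilon>" by (auto simp: eventually_at_top_linorder)
  show ?thesis
  proof (rule that[of "4 * max X c0"])
    fix N :: "'b measure" and Z :: "real \<Rightarrow> 'b \<Rightarrow> real" and y B :: real and K :: nat
    assume lev: "sp_levy N Z y \<Psi>" and B: "4 * max X c0 \<le> B" and K: "B / 4 \<le> y / 2 ^ K"
    interpret sp_levy_drift N Z y \<Psi> \<gamma> \<psi>
      by (intro sp_levy_drift.intro sp_levy_process.intro sp_levy_process_axioms.intro sp_levy_drift_axioms.intro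
          lev \<Psi> \<psi>0) (use lev in \<open>simp add: sp_levy_def\<close>)
    define c where "c k = y / 2 ^ k" for k :: nat
    define L where "L k = nat \<lceil>c k / \<gamma>\<rceil>" for k
    have cK: "max X c0 \<le> c K" using B K unfolding c_def by linarith
    have yp: "y > 0"
    proof -
      have "0 < y / 2 ^ K" using cK C'(2) by (simp add: c_def)
      then show ?thesis by (simp add: zero_less_divide_iff)
    qed
    have ck: "c k \<ge> c0" if "k \<le> K" for k
    proof -
      have "(2::real) ^ k \<le> 2 ^ K" using that by (simp add: power_increasing)
      then have "c K \<le> c k" unfolding c_def using yp by (intro divide_left_mono) auto
      then show ?thesis using cK by simp
    qed
    define Bad where "Bad k = (\<Union>a. block_bad (c k) (L k) (d * c k) a)" for k
    have [measurable]: "Bad k \<in> events" for k unfolding Bad_def by measurable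
    have Bad: "prob (Bad k) \<le> 2 * (C' * c k powr (- \<delta>))" if "k \<le> K" for k
    proof -
      have cp: "c k > 0" using ck[OF that] C'(2) by linarith
      have "prob (\<Union>a. block_bad (c k) (L k) (2 * (d * c k / 2)) a) \<le> 2 * (C' * c k powr (- \<delta>))"
        by (rule prob_block_bad) (use C'(3)[OF ck[OF that]] cp assms in \<open>auto simp: L_def\<close>)
      then show ?thesis by (simp add: Bad_def)
    qed
    define G where "G = space N - (\<Union>k\<le>K. Bad k)"
    have [measurable]: "G \<in> events" unfolding G_def by measurable
    have "prob (\<Union>k\<le>K. Bad k) \<le> (\<Sum>k\<le>K. prob (Bad k))"
      by (rule finite_measure_subadditive_finite) auto
    also have "\<dots> \<le> (\<Sum>k\<le>K. 2 * (C' * c k powr (- \<delta>)))" by (intro sum_mono Bad) auto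
    also have "\<dots> = 2 * C' * (\<Sum>k\<le>K. c k powr (- \<delta>))" by (simp add: sum_distrib_left mult_ac)
    also have "\<dots> \<le> 2 * C' * (c K powr (- \<delta>) / (1 - 2 powr (- \<delta>)))"
      using geometric_powr_sum[OF yp assms(3), of K] C' unfolding c_def by (intro mult_left_mono) auto
    also have "\<dots> = D * c K powr (- \<delta>)" by (simp add: D_def)
    also have "\<dots> < \<epsilon>" using cK by (intro X) auto
    finally have "prob (\<Union>k\<le>K. Bad k) < \<epsilon>" .
    then have "prob G \<ge> 1 - \<epsilon>" unfolding G_def by (subst prob_compl) auto
    moreover have "\<forall>\<omega>\<in>G. \<forall>k n u. k \<le> K \<longrightarrow> Z (real n) \<omega> \<le> y / 2 ^ k \<longrightarrow>
        (\<forall>j<n. y / 2 ^ k < Z (real j) \<omega>) \<longrightarrow> 0 \<le> u \<longrightarrow> u \<le> real (nat \<lceil>y / 2 ^ k / \<gamma>\<rceil>) \<longrightarrow>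
          \<bar>Z (real n + u) \<omega> - Z (real n) \<omega> + \<gamma> * u\<bar> \<le> d * (y / 2 ^ k)"
    proof (intro ballI allI impI)
      fix \<omega> k n u assume w: "\<omega> \<in> G" "k \<le> K" "Z (real n) \<omega> \<le> y / 2 ^ k" "\<forall>j<n. y / 2 ^ k < Z (real j) \<omega>"
        "0 \<le> u" "u \<le> real (nat \<lceil>y / 2 ^ k / \<gamma>\<rceil>)"
      show "\<bar>Z (real n + u) \<omega> - Z (real n) \<omega> + \<gamma> * u\<bar> \<le> d * (y / 2 ^ k)"
        by (rule not_block_bad[where c = "c k" and L = "L k"])
          (use w in \<open>auto simp: G_def Bad_def c_def L_def\<close>)
    qed
    ultimately show "\<exists>G\<in>sets N. measure N G \<ge> 1 - \<epsilon> \<and> (\<forall>\<omega>\<in>G. \<forall>k n u. k \<le> K \<longrightarrow> Z (real n) \<omega> \<le> y / 2 ^ k \<longrightarrow>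
        (\<forall>j<n. y / 2 ^ k < Z (real j) \<omega>) \<longrightarrow> 0 \<le> u \<longrightarrow> u \<le> real (nat \<lceil>y / 2 ^ k / \<gamma>\<rceil>) \<longrightarrow>
          \<bar>Z (real n + u) \<omega> - Z (real n) \<omega> + \<gamma> * u\<bar> \<le> d * (y / 2 ^ k))" by auto
  qed (use C' in auto)
qed

section \<open>The process started at infinity\<close>

lemma exp_quadratic_bounds:
  fixes x :: real
  assumes "x \<ge> 0"
  shows "exp (- x) - 1 + x \<le> x\<^sup>2 / 2" "x\<^sup>2 / 2 \<le> exp x - 1 - x"
proof -
  have e: "1 + x + x\<^sup>2 / 2 \<le> exp x" using assms by (rule exp_lower_Taylor_quadratic)
  then show "x\<^sup>2 / 2 \<le> exp x - 1 - x" by simp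
  \<comment> \<open>This identity turns the lower Taylor bound for \<open>exp x\<close> into an
    upper bound for \<open>exp (- x)\<close>.\<close>
  have "(1 + x + x\<^sup>2 / 2) * (1 - x + x\<^sup>2 / 2) = 1 + (x\<^sup>2 / 2)\<^sup>2"
    by (simp add: algebra_simps power2_eq_square)
  then have "1 \<le> (1 + x + x\<^sup>2 / 2) * (1 - x + x\<^sup>2 / 2)" by simp
  also have "\<dots> \<le> exp x * (1 - x + x\<^sup>2 / 2)"
  proof (rule mult_right_mono[OF e])
    have eq: "1 - x + x\<^sup>2 / 2 = ((1 - x)\<^sup>2 + 1) / 2" by (simp add: power2_eq_square field_simps)
    show "0 \<le> 1 - x + x\<^sup>2 / 2" unfolding eq by (intro divide_nonneg_pos add_nonneg_nonneg) auto
  qed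
  finally have "exp (- x) * 1 \<le> exp (- x) * (exp x * (1 - x + x\<^sup>2 / 2))" by (intro mult_left_mono) auto
  also have "\<dots> = 1 - x + x\<^sup>2 / 2" by (simp add: mult.assoc[symmetric] exp_add[symmetric])
  finally show "exp (- x) - 1 + x \<le> x\<^sup>2 / 2" by simp
qed

lemma Psi_minus_drift: "Psi \<gamma> \<sigma> \<pi> l - \<gamma> * l = \<sigma>\<^sup>2 / 2 * l\<^sup>2 + (\<integral>z. exp (- l * z) - 1 + l * z \<partial>\<pi>)"
  by (simp add: Psi_def)

lemma Psi_minus_drift_nonneg: "Psi \<gamma> \<sigma> \<pi> l - \<gamma> * l \<ge> 0"
proof -
  have "0 \<le> exp (- l * z) - 1 + l * z" for z using exp_ge_add_one_self[of "- l * z"] by simp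
  then have "0 \<le> (\<integral>z. exp (- l * z) - 1 + l * z \<partial>\<pi>)" by (rule Bochner_Integration.integral_nonneg)
  then show ?thesis unfolding Psi_minus_drift by simp
qed

text \<open>The square of \<open>z\<close> mediates: up to constants it dominates the integrand at
  \<open>l\<close> and is dominated by the one at \<open>- \<nu>\<close>. The exponent is
  \<open>1 + 1\<close> to match the general form with \<open>\<delta> = 1\<close>.\<close>

lemma Psi_bound_exponential_moment:
  assumes lm: "levy_measure \<pi>" and \<nu>: "\<nu> > 0" and int: "integrable \<pi> (\<lambda>z. exp (\<nu> * z) - 1 - \<nu> * z)"
  obtains C where "C > 0" "\<And>l. l > 0 \<Longrightarrow> Psi \<gamma> \<sigma> \<pi> l - \<gamma> * l \<le> C * l powr (1 + 1)"
proof -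
  define I where "I = (\<integral>z. exp (\<nu> * z) - 1 - \<nu> * z \<partial>\<pi>)"
  have nn: "0 \<le> exp (\<nu> * z) - 1 - \<nu> * z" for z using exp_ge_add_one_self[of "\<nu> * z"] by linarith
  then have I: "I \<ge> 0" unfolding I_def by (intro Bochner_Integration.integral_nonneg) auto
  have pos: "AE z in \<pi>. z > 0"
  proof (rule AE_I')
    show "{..0} \<in> null_sets \<pi>" using lm by (auto simp: levy_measure_def null_sets_def)
  qed auto
  show ?thesis
  \<comment> \<open>The summand 1 keeps the constant positive when \<sigma> and \<open>I\<close>
    vanish.\<close>
  proof (rule that[of "\<sigma>\<^sup>2 / 2 + I / \<nu>\<^sup>2 + 1"])
    fix l :: real assume l: "l > 0"
    have "(\<integral>z. exp (- l * z) - 1 + l * z \<partial>\<pi>) \<le> (\<integral>z. (l / \<nu>)\<^sup>2 * (exp (\<nu> * z) - 1 - \<nu> * z) \<partial>\<pi>)"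
    proof (rule integral_mono_AE')
      show "integrable \<pi> (\<lambda>z. (l / \<nu>)\<^sup>2 * (exp (\<nu> * z) - 1 - \<nu> * z))" using int by simp
      show "AE z in \<pi>. exp (- l * z) - 1 + l * z \<le> (l / \<nu>)\<^sup>2 * (exp (\<nu> * z) - 1 - \<nu> * z)"
        using pos
      proof eventually_elim
        case (elim z)
        have "exp (- l * z) - 1 + l * z \<le> (l * z)\<^sup>2 / 2"
          using exp_quadratic_bounds(1)[of "l * z"] l elim by simp
        also have "\<dots> = (l / \<nu>)\<^sup>2 * ((\<nu> * z)\<^sup>2 / 2)" using \<nu> by (simp add: field_simps)
        also have "\<dots> \<le> (l / \<nu>)\<^sup>2 * (exp (\<nu> * z) - 1 - \<nu> * z)"
          using exp_quadratic_bounds(2)[of "\<nu> * z"] \<nu> elim by (intro mult_left_mono) auto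
        finally show ?case .
      qed
      show "AE z in \<pi>. 0 \<le> (l / \<nu>)\<^sup>2 * (exp (\<nu> * z) - 1 - \<nu> * z)"
        using nn by (intro AE_I2 mult_nonneg_nonneg) auto
    qed
    also have "\<dots> = (l / \<nu>)\<^sup>2 * I" by (simp add: I_def)
    finally have "Psi \<gamma> \<sigma> \<pi> l - \<gamma> * l \<le> \<sigma>\<^sup>2 / 2 * l\<^sup>2 + (l / \<nu>)\<^sup>2 * I" unfolding Psi_minus_drift by simp
    also have "\<dots> \<le> (\<sigma>\<^sup>2 / 2 + I / \<nu>\<^sup>2 + 1) * l\<^sup>2" by (simp add: algebra_simps power_divide)
    also have "l\<^sup>2 = l powr (1 + 1)" using l by (simp add: powr_numeral)
    finally show "Psi \<gamma> \<sigma> \<pi> l - \<gamma> * l \<le> (\<sigma>\<^sup>2 / 2 + I / \<nu>\<^sup>2 + 1) * l powr (1 + 1)" .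
  qed (use I in \<open>auto intro!: add_nonneg_pos\<close>)
qed

lemma asymp_equiv_powr_bound:
  fixes f :: "real \<Rightarrow> real"
  assumes "f \<sim>[at_right 0] (\<lambda>l. c * l powr a)" "c > 0"
  obtains C l0 where "C > 0" "l0 > 0" "\<And>l. 0 < l \<Longrightarrow> l < l0 \<Longrightarrow> f l \<le> C * l powr a"
proof -
  have "f \<in> O[at_right 0](\<lambda>l. c * l powr a)" using assms(1) by (rule asymp_equiv_imp_bigo)
  then have "f \<in> O[at_right 0](\<lambda>l. l powr a)" using assms(2) by simp
  then obtain C where C: "C > 0" "\<forall>\<^sub>F l in at_right 0. norm (f l) \<le> C * norm (l powr a)"
    by (elim landau_o.bigE)
  then obtain l0 where "l0 > 0" "\<And>l. 0 < l \<Longrightarrow> l < l0 \<Longrightarrow> norm (f l) \<le> C * norm (l powr a)"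
    by (auto simp: eventually_at_right_field)
  then show ?thesis using C by (intro that[of C l0]) (auto intro: order_trans[OF abs_ge_self])
qed

text \<open>Countably many inner events with probabilities tending to 1 have a union of full
  measure; \<open>Q\<close> itself may be non-measurable.\<close>

lemma (in prob_space) AE_from_large_events:
  assumes "\<And>\<epsilon>. \<epsilon> > 0 \<Longrightarrow> \<exists>A\<in>events. prob A \<ge> 1 - \<epsilon> \<and> (\<forall>\<omega>\<in>A. Q \<omega>)"
  shows "AE \<omega> in M. Q \<omega>"
proof -
  have "\<exists>A. A \<in> events \<and> prob A \<ge> 1 - 1 / real (Suc n) \<and> (\<forall>\<omega>\<in>A. Q \<omega>)" for n
    using assms[of "1 / real (Suc n)"] by auto
  then obtain A where A: "\<And>n. A n \<in> events" "\<And>n. prob (A n) \<ge> 1 - 1 / real (Suc n)" "\<And>n \<omega>. \<omega> \<in> A n \<Longrightarrow> Q \<omega>"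
    by metis
  have U: "(\<Union>n. A n) \<in> events" using A(1) by auto
  have "prob (\<Union>n. A n) \<ge> 1"
  proof (rule field_le_epsilon)
    fix e :: real assume "e > 0"
    then obtain n where n: "1 / real (Suc n) < e" using nat_approx_posE by (metis of_nat_Suc)
    have "prob (A n) \<le> prob (\<Union>n. A n)" using U by (intro finite_measure_mono) auto
    then show "1 \<le> prob (\<Union>n. A n) + e" using A(2)[of n] n by linarith
  qed
  then have "prob (\<Union>n. A n) = 1" using prob_le_1 by (intro antisym) auto
  then have "AE \<omega> in M. \<omega> \<in> (\<Union>n. A n)" using U by (subst AE_in_set_eq_1) auto
  then show ?thesis by eventually_elim (use A(3) in auto)
qed

text \<open>For the least \<open>K\<close> the scale before it is at least \<open>B / 2\<close>;
  \<open>B <= y\<close> guarantees that there is one before it. Ending below \<open>B / 2\<close>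
  leaves the last block room under \<open>B\<close>.\<close>

lemma halving_scale:
  fixes y B :: real
  assumes "0 < B" "B \<le> y"
  obtains K where "B / 4 \<le> y / 2 ^ K" "y / 2 ^ K < B / 2"
proof -
  obtain n where n: "2 * y / B < 2 ^ n" using real_arch_pow[of 2 "2 * y / B"] by auto
  then have ex: "y / 2 ^ n < B / 2" using assms by (simp add: field_simps)
  define K where "K = (LEAST n. y / 2 ^ n < B / 2)"
  have K: "y / 2 ^ K < B / 2" unfolding K_def by (rule LeastI) (rule ex)
  then obtain k where k: "K = Suc k" using assms by (cases K) auto
  have "\<not> y / 2 ^ k < B / 2" using not_less_Least[of k "\<lambda>n. y / 2 ^ n < B / 2"] k by (auto simp: K_def)
  then have "B / 4 \<le> y / 2 ^ K" by (simp add: k field_simps)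
  then show ?thesis using K by (rule that)
qed

section \<open>Nearly deterministic evolution of \<open>phi\<close> along the process\<close>

context regular_rate
begin

text \<open>Rational times make this an event of the product sigma-algebra; the truncation at \<open>B > 0\<close> makes
  \<open>phi\<close> continuous and has no effect as long as the path stays above \<open>B\<close>.\<close>

definition near_flow :: "real \<Rightarrow> real \<Rightarrow> (real \<Rightarrow> real) \<Rightarrow> bool" where
  "near_flow e B x \<longleftrightarrow> (\<forall>t\<in>\<rat>. 0 \<le> t \<longrightarrow> (\<forall>q\<in>\<rat>. 0 \<le> q \<longrightarrow> q \<le> t \<longrightarrow> B \<le> x q) \<longrightarrow>
     \<bar>phi \<gamma> R (max B (x t)) - phi \<gamma> R (max B (x 0)) - t\<bar> \<le> e * phi \<gamma> R (max B (x t)))"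

text \<open>The order of choices gives uniformity: \<open>d\<close> comes from \<open>e\<close> and
  the rate, then \<open>B\<close> from \<open>d\<close> and \<epsilon>, and only then do the
  starting point \<open>y\<close> and its number \<open>K\<close> of halvings enter.\<close>

lemma time_changed_near_flow:
  fixes \<psi> \<Psi> :: "real \<Rightarrow> real"
  assumes "e > 0" "\<epsilon> > 0" "\<delta> > 0" "l0 > 0" "C > 0"
    and \<psi>: "\<And>l. 0 < l \<Longrightarrow> l < l0 \<Longrightarrow> \<psi> l \<le> C * l powr (1 + \<delta>)"
    and \<psi>0: "\<And>l. l > 0 \<Longrightarrow> \<psi> l \<ge> 0" and \<Psi>: "\<And>l. \<psi> l = \<Psi> l - \<gamma> * l"
  obtains B where "B > 0"
    "\<And>(N :: 'b measure) Z y. \<lbrakk>sp_levy N Z y \<Psi>; B \<le> y\<rbrakk> \<Longrightarrow>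
      \<exists>G\<in>sets N. measure N G \<ge> 1 - \<epsilon> \<and> (\<forall>\<omega>\<in>G. near_flow e B (\<lambda>t. real_of_ereal (tc_proc R Z \<omega> t)))"
proof -
  obtain d X where d: "d > 0" "X > 0"
    "\<And>(Z :: real \<Rightarrow> 'b \<Rightarrow> real) \<omega> y B K. \<lbrakk>cadlag0 (\<lambda>t. Z t \<omega>); Z 0 \<omega> = y; B \<ge> X; B / 4 \<le> y / 2 ^ K; y / 2 ^ K < B / 2;
       \<And>k n u. \<lbrakk>k \<le> K; Z (real n) \<omega> \<le> y / 2 ^ k; \<And>j. j < n \<Longrightarrow> y / 2 ^ k < Z (real j) \<omega>;
          0 \<le> u; u \<le> real (nat \<lceil>y / 2 ^ k / \<gamma>\<rceil>)\<rbrakk> \<Longrightarrow>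
         \<bar>Z (real n + u) \<omega> - Z (real n) \<omega> + \<gamma> * u\<bar> \<le> d * (y / 2 ^ k)\<rbrakk> \<Longrightarrow>
       tc_proc R Z \<omega> 0 = ereal y \<and> (\<forall>t\<ge>0. (\<forall>q\<in>\<rat>. 0 \<le> q \<longrightarrow> q \<le> t \<longrightarrow> B \<le> real_of_ereal (tc_proc R Z \<omega> q)) \<longrightarrow>
         \<bar>phi \<gamma> R (real_of_ereal (tc_proc R Z \<omega> t)) - phi \<gamma> R y - t\<bar>
           \<le> e * phi \<gamma> R (real_of_ereal (tc_proc R Z \<omega> t)))"
  proof (rule time_changed_path_estimate[where 'x = 'b, OF assms(1)], goal_cases)
    case (1 d X)
    show ?case by (rule 1(1)) (fact 1)+
  qed
  obtain B0 where B0: "B0 > 0"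
    "\<And>(N :: 'b measure) Z y B K. \<lbrakk>sp_levy N Z y \<Psi>; B \<ge> B0; B / 4 \<le> y / 2 ^ K\<rbrakk> \<Longrightarrow>
      \<exists>G\<in>sets N. measure N G \<ge> 1 - \<epsilon> \<and> (\<forall>\<omega>\<in>G. \<forall>k n u. k \<le> K \<longrightarrow> Z (real n) \<omega> \<le> y / 2 ^ k \<longrightarrow>
        (\<forall>j<n. y / 2 ^ k < Z (real j) \<omega>) \<longrightarrow> 0 \<le> u \<longrightarrow> u \<le> real (nat \<lceil>y / 2 ^ k / \<gamma>\<rceil>) \<longrightarrow>
          \<bar>Z (real n + u) \<omega> - Z (real n) \<omega> + \<gamma> * u\<bar> \<le> d * (y / 2 ^ k))"
  proof (rule sp_levy_good_event[where 'b = 'b, OF \<gamma> d(1) assms(3-5,2) \<psi> \<psi>0 \<Psi>], goal_cases)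
    case (4 B0)
    show ?case by (rule 4(1)) (fact 4)+
  qed
  define B where "B = max X B0"
  have B: "B > 0" "X \<le> B" "B0 \<le> B" using B0(1) by (auto simp: B_def)
  show ?thesis
  proof (rule that[OF B(1)])
    fix N :: "'b measure" and Z y assume lev: "sp_levy N Z y \<Psi>" and y: "B \<le> y"
    obtain K where K: "B / 4 \<le> y / 2 ^ K" "y / 2 ^ K < B / 2" using halving_scale[OF B(1) y] by metis
    obtain G where G: "G \<in> sets N" "measure N G \<ge> 1 - \<epsilon>"
      "\<And>\<omega> k n u. \<lbrakk>\<omega> \<in> G; k \<le> K; Z (real n) \<omega> \<le> y / 2 ^ k; \<forall>j<n. y / 2 ^ k < Z (real j) \<omega>; 0 \<le> u;
         u \<le> real (nat \<lceil>y / 2 ^ k / \<gamma>\<rceil>)\<rbrakk> \<Longrightarrow> \<bar>Z (real n + u) \<omega> - Z (real n) \<omega> + \<gamma> * u\<bar> \<le> d * (y / 2 ^ k)"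
      using B0(2)[OF lev B(3) K(1)] by blast
    have "near_flow e B (\<lambda>t. real_of_ereal (tc_proc R Z \<omega> t))" if w: "\<omega> \<in> G" for \<omega>
    proof -
      have wN: "\<omega> \<in> space N" using w G(1) sets.sets_into_space by auto
      then have cad: "cadlag0 (\<lambda>t. Z t \<omega>)" "Z 0 \<omega> = y" using lev by (auto simp: sp_levy_def)
      have *: "tc_proc R Z \<omega> 0 = ereal y \<and> (\<forall>t\<ge>0. (\<forall>q\<in>\<rat>. 0 \<le> q \<longrightarrow> q \<le> t \<longrightarrow> B \<le> real_of_ereal (tc_proc R Z \<omega> q)) \<longrightarrow>
         \<bar>phi \<gamma> R (real_of_ereal (tc_proc R Z \<omega> t)) - phi \<gamma> R y - t\<bar>
           \<le> e * phi \<gamma> R (real_of_ereal (tc_proc R Z \<omega> t)))"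
        by (rule d(3)[where Z = Z and \<omega> = \<omega>, OF cad B(2) K]) (use G(3)[OF w] in auto)
      show ?thesis unfolding near_flow_def
      proof (intro ballI impI)
        fix t assume t: "t \<in> \<rat>" "0 \<le> t" and h: "\<forall>q\<in>\<rat>. 0 \<le> q \<longrightarrow> q \<le> t \<longrightarrow> B \<le> real_of_ereal (tc_proc R Z \<omega> q)"
        have "max B (real_of_ereal (tc_proc R Z \<omega> t)) = real_of_ereal (tc_proc R Z \<omega> t)" using h t by auto
        moreover have "max B (real_of_ereal (tc_proc R Z \<omega> 0)) = y" using * y by auto
        ultimately show "\<bar>phi \<gamma> R (max B (real_of_ereal (tc_proc R Z \<omega> t))) - phi \<gamma> R (max B (real_of_ereal (tc_proc R Z \<omega> 0))) - t\<bar>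
          \<le> e * phi \<gamma> R (max B (real_of_ereal (tc_proc R Z \<omega> t)))" using * h t by simp
      qed
    qed
    then show "\<exists>G\<in>sets N. measure N G \<ge> 1 - \<epsilon> \<and> (\<forall>\<omega>\<in>G. near_flow e B (\<lambda>t. real_of_ereal (tc_proc R Z \<omega> t)))"
      using G by auto
  qed
qed

lemma phi_max_continuous: "B > 0 \<Longrightarrow> continuous_on UNIV (\<lambda>x. phi \<gamma> R (max B x))"
  by (rule continuous_on_compose2[OF phi_cont[of B]]) (auto intro!: continuous_intros)

lemma near_flow_measurable:
  assumes "B > 0"
  shows "{x \<in> space (PiM {0..} (\<lambda>_. borel :: ereal measure)). near_flow e B (\<lambda>t. real_of_ereal (x t))}
    \<in> sets (PiM {0..} (\<lambda>_. borel))"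
proof -
  let ?M = "PiM {0::real..} (\<lambda>_. borel :: ereal measure)"
  have m1: "(\<lambda>x. real_of_ereal (x t)) \<in> borel_measurable ?M" if "0 \<le> t" for t
    using that by (intro borel_measurable_real_of_ereal measurable_component_singleton) auto
  have m2: "(\<lambda>x. phi \<gamma> R (max B x)) \<in> borel_measurable borel"
    by (rule borel_measurable_continuous_onI[OF phi_max_continuous[OF assms]])
  have m3: "(\<lambda>x. phi \<gamma> R (max B (real_of_ereal (x t)))) \<in> borel_measurable ?M" if "0 \<le> t" for t
    using measurable_compose[OF m1[OF that] m2] .
  have a: "Measurable.pred ?M (\<lambda>x. B \<le> real_of_ereal (x q))" if "0 \<le> q" for q
    unfolding pred_def by (intro borel_measurable_le borel_measurable_const m1 that)
  have b: "Measurable.pred ?M (\<lambda>x. \<bar>phi \<gamma> R (max B (real_of_ereal (x t))) - phi \<gamma> R (max B (real_of_ereal (x 0))) - t\<bar>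
     \<le> e * phi \<gamma> R (max B (real_of_ereal (x t))))" if "0 \<le> t" for t
    unfolding pred_def
    by (intro borel_measurable_le borel_measurable_abs borel_measurable_diff borel_measurable_times borel_measurable_const m3 that order_refl)
  have ball: "Measurable.pred ?M (\<lambda>x. \<forall>i\<in>I. P i x)"
    if "countable I" "\<And>i. i \<in> I \<Longrightarrow> Measurable.pred ?M (P i)" for I :: "real set" and P
    using that unfolding pred_def by (intro sets.sets_Collect_countable_All') auto
  have "Measurable.pred ?M (\<lambda>x. near_flow e B (\<lambda>t. real_of_ereal (x t)))"
  proof -
    have "Measurable.pred ?M (\<lambda>x. \<forall>t\<in>\<rat> \<inter> {0..}. (\<forall>q\<in>\<rat> \<inter> {0..t}. B \<le> real_of_ereal (x q)) \<longrightarrow>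
      \<bar>phi \<gamma> R (max B (real_of_ereal (x t))) - phi \<gamma> R (max B (real_of_ereal (x 0))) - t\<bar>
       \<le> e * phi \<gamma> R (max B (real_of_ereal (x t))))"
      by (intro ball pred_intros_logic(4) countable_subset[OF Int_lower1 countable_rat] a b) auto
    then show ?thesis by (rule measurable_cong[THEN iffD1, rotated]) (auto simp: near_flow_def)
  qed
  then show ?thesis by (simp add: pred_def)
qed

text \<open>The law of the time-changed path is only bounded from below through an event \<open>G\<close> of the Levy
  process: \<open>nn_integral_mono\<close> needs no measurability, so \<open>Xpath\<close> is never shown to be measurable.\<close>

lemma P_infty_near_flow_event:
  fixes Lev :: "real \<Rightarrow> 'b measure" and Zs :: "real \<Rightarrow> real \<Rightarrow> 'b \<Rightarrow> real"
    and M :: "'a measure" and Y :: "real \<Rightarrow> 'a \<Rightarrow> ereal"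
  assumes proc: "P_infty_process R Lev Zs M Y" and B: "B > 0" and s: "s > 0" and \<epsilon>: "0 < \<epsilon>" "\<epsilon> < 1"
    and lev: "\<And>y. y \<ge> 0 \<Longrightarrow> sp_levy (Lev y) (Zs y) y \<Psi>"
    and G: "\<And>(N :: 'b measure) Z y. \<lbrakk>sp_levy N Z y \<Psi>; B \<le> y\<rbrakk> \<Longrightarrow>
      \<exists>G\<in>sets N. measure N G \<ge> 1 - \<epsilon> \<and> (\<forall>\<omega>\<in>G. near_flow e B (\<lambda>t. real_of_ereal (tc_proc R Z \<omega> t)))"
  shows "{\<omega>\<in>space M. near_flow e B (\<lambda>t. real_of_ereal (Y (s + t) \<omega>))} \<in> sets M" (is "?A \<in> _")
    and "measure M {\<omega>\<in>space M. near_flow e B (\<lambda>t. real_of_ereal (Y (s + t) \<omega>))}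
      \<ge> (1 - \<epsilon>) * measure M {\<omega>\<in>space M. B \<le> real_of_ereal (Y s \<omega>)}"
proof -
  interpret prob_space M using proc by (simp add: P_infty_process_def)
  let ?P = "PiM {0::real..} (\<lambda>_. borel :: ereal measure)"
  define H where "H = {x \<in> space ?P. near_flow e B (\<lambda>t. real_of_ereal (x t))}"
  have H: "H \<in> sets ?P" unfolding H_def by (rule near_flow_measurable[OF B])
  have Ym: "Y t \<in> borel_measurable M" if "t \<ge> 0" for t using proc that by (simp add: P_infty_process_def)
  have restr: "near_flow e B (\<lambda>t. real_of_ereal (restrict x {0..} t)) = near_flow e B (\<lambda>t. real_of_ereal (x t))"
    for x :: "real \<Rightarrow> ereal" unfolding near_flow_def by auto
  have inH: "restrict x {0..} \<in> H \<longleftrightarrow> near_flow e B (\<lambda>t. real_of_ereal (x t))" for x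
    unfolding H_def using restr[of x] by (auto simp: space_PiM)
  have shift: "(\<lambda>\<omega>. restrict (\<lambda>t. Y (s + t) \<omega>) {0..}) \<in> measurable M ?P"
    using s by (intro measurable_restrict Ym) auto
  have A: "?A = (\<lambda>\<omega>. restrict (\<lambda>t. Y (s + t) \<omega>) {0..}) -` H \<inter> space M" using inH by auto
  show Am: "?A \<in> sets M" unfolding A by (rule measurable_sets[OF shift H])
  \<comment> \<open>The Markov property at time \<open>s\<close> with the trivial past event and the
    indicator of \<open>H\<close>.\<close>
  have markov: "(\<integral>\<^sup>+ \<omega>. indicator (space M) \<omega> * indicator H (restrict (\<lambda>t. Y (s + t) \<omega>) {0..}) \<partial>M) =
      (\<integral>\<^sup>+ \<omega>. indicator (space M) \<omega> * (\<integral>\<^sup>+ \<omega>'. indicator H (Xpath R (Zs (real_of_ereal (Y s \<omega>))) \<omega>')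
         \<partial>(Lev (real_of_ereal (Y s \<omega>)))) \<partial>M)"
  proof -
    have "\<forall>s>0. \<forall>A \<in> sigma_sets (space M)
                {Y r -` B \<inter> space M | r B. 0 \<le> r \<and> r \<le> s \<and> B \<in> sets (borel :: ereal measure)}.
        \<forall>f \<in> borel_measurable ?P.
          (\<integral>\<^sup>+ \<omega>. indicator A \<omega> * f (restrict (\<lambda>t. Y (s + t) \<omega>) {0..}) \<partial>M) =
          (\<integral>\<^sup>+ \<omega>. indicator A \<omega> * (\<integral>\<^sup>+ \<omega>'. f (Xpath R (Zs (real_of_ereal (Y s \<omega>))) \<omega>')
             \<partial>(Lev (real_of_ereal (Y s \<omega>)))) \<partial>M)"
      using proc unfolding P_infty_process_def by blast
    from this[THEN spec, THEN mp, OF s, THEN bspec, OF sigma_sets_top, THEN bspec,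
        OF borel_measurable_indicator[OF H]] show ?thesis .
  qed
  have "emeasure M ?A = (\<integral>\<^sup>+ \<omega>. indicator ?A \<omega> \<partial>M)" using Am by simp
  also have "\<dots> = (\<integral>\<^sup>+ \<omega>. indicator (space M) \<omega> * indicator H (restrict (\<lambda>t. Y (s + t) \<omega>) {0..}) \<partial>M)"
    using inH by (intro nn_integral_cong) (auto simp: indicator_def)
  \<comment> \<open>Where \<open>Y s\<close> is at least \<open>B\<close> the inner integral is at
    least the probability of the good event; elsewhere it is bounded below by 0.\<close>
  also have "\<dots> \<ge> (\<integral>\<^sup>+ \<omega>. ennreal (1 - \<epsilon>) * indicator {\<omega>\<in>space M. B \<le> real_of_ereal (Y s \<omega>)} \<omega> \<partial>M)"
    unfolding markov
  proof (intro nn_integral_mono)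
    fix \<omega> assume w: "\<omega> \<in> space M"
    define y where "y = real_of_ereal (Y s \<omega>)"
    show "ennreal (1 - \<epsilon>) * indicator {\<omega>\<in>space M. B \<le> real_of_ereal (Y s \<omega>)} \<omega>
      \<le> indicator (space M) \<omega> * (\<integral>\<^sup>+ \<omega>'. indicator H (Xpath R (Zs (real_of_ereal (Y s \<omega>))) \<omega>')
         \<partial>(Lev (real_of_ereal (Y s \<omega>))))"
    proof (cases "B \<le> y")
      case True
      have l: "sp_levy (Lev y) (Zs y) y \<Psi>" using True B by (intro lev) auto
      then interpret L: prob_space "Lev y" by (simp add: sp_levy_def)
      obtain G where G: "G \<in> sets (Lev y)" "measure (Lev y) G \<ge> 1 - \<epsilon>"
        "\<And>\<omega>. \<omega> \<in> G \<Longrightarrow> near_flow e B (\<lambda>t. real_of_ereal (tc_proc R (Zs y) \<omega> t))"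
        using G[OF l True] by blast
      have "ennreal (1 - \<epsilon>) \<le> emeasure (Lev y) G"
        using G(2) by (simp add: L.emeasure_eq_measure ennreal_leI)
      also have "\<dots> = (\<integral>\<^sup>+ \<omega>'. indicator G \<omega>' \<partial>Lev y)" using G(1) by simp
      also have "\<dots> \<le> (\<integral>\<^sup>+ \<omega>'. indicator H (Xpath R (Zs y) \<omega>') \<partial>Lev y)"
        using G(3) inH by (intro nn_integral_mono) (auto simp: indicator_def Xpath_def)
      finally show ?thesis using w unfolding y_def by (simp add: indicator_def)
    qed (simp add: y_def)
  qed
  finally have "(\<integral>\<^sup>+ \<omega>. ennreal (1 - \<epsilon>) * indicator {\<omega>\<in>space M. B \<le> real_of_ereal (Y s \<omega>)} \<omega> \<partial>M) \<le> emeasure M ?A" .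
  moreover have "{\<omega>\<in>space M. B \<le> real_of_ereal (Y s \<omega>)} \<in> sets M"
    using Ym[of s] s by (intro borel_measurable_le borel_measurable_const borel_measurable_real_of_ereal) auto
  ultimately have "ennreal (1 - \<epsilon>) * emeasure M {\<omega>\<in>space M. B \<le> real_of_ereal (Y s \<omega>)} \<le> emeasure M ?A"
    by (subst (asm) nn_integral_cmult_indicator) auto
  then show "measure M ?A \<ge> (1 - \<epsilon>) * measure M {\<omega>\<in>space M. B \<le> real_of_ereal (Y s \<omega>)}"
    using \<epsilon> by (simp add: emeasure_eq_measure ennreal_mult'[symmetric])
qed

text \<open>For rational \<open>v\<close> the comparison between \<open>s k\<close> and
  \<open>v\<close> holds for infinitely many \<open>k\<close>, and both \<open>s k\<close> and
  \<open>phi (g (s k))\<close> tend to 0, so the inequality survives without the starting point. The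
  \<open>s k\<close> are rational so that \<open>v - s k\<close> is among the times that
  \<open>near_flow\<close> inspects.\<close>

lemma near_flow_from_0:
  fixes g :: "real \<Rightarrow> real" and s :: "nat \<Rightarrow> real"
  assumes B: "B > 0" and e: "e > 0" and lim: "filterlim g at_top (at_right 0)"
    and rc: "\<And>v. v > 0 \<Longrightarrow> B < g v \<Longrightarrow> (g \<longlongrightarrow> g v) (at_right v)"
    and s: "s \<longlonglongrightarrow> 0" "\<And>k. s k > 0" "\<And>k. s k \<in> \<rat>"
    and inf: "\<exists>\<^sub>F k in sequentially. near_flow e B (\<lambda>t. g (s k + t))"
  shows "\<forall>\<^sub>F v in at_right 0. \<bar>phi \<gamma> R (g v) - v\<bar> \<le> e * phi \<gamma> R (g v)"
proof -
  define f where "f x = phi \<gamma> R (max B x)" for x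
  have fc: "continuous_on UNIV f" unfolding f_def by (rule phi_max_continuous[OF B])
  have "\<forall>\<^sub>F v in at_right 0. B < g v" using lim by (simp add: filterlim_at_top_dense)
  \<comment> \<open>Up to \<open>t0\<close> the path stays above \<open>B\<close>, which discharges
    the premise of \<open>near_flow\<close> between \<open>s k\<close> and \<open>v\<close>.\<close>
  then obtain t0 where t0: "t0 > 0" "\<And>v. 0 < v \<Longrightarrow> v < t0 \<Longrightarrow> B < g v"
    by (auto simp: eventually_at_right_field)
  have sr: "filterlim s (at_right 0) sequentially"
    unfolding filterlim_at using s by (auto simp: less_imp_neq[symmetric])
  have gs: "filterlim (\<lambda>k. g (s k)) at_top sequentially" by (rule filterlim_compose[OF lim sr])
  have fs: "(\<lambda>k. f (g (s k))) \<longlonglongrightarrow> 0"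
  proof (rule Lim_transform_eventually)
    show "(\<lambda>k. phi \<gamma> R (g (s k))) \<longlonglongrightarrow> 0" by (rule filterlim_compose[OF phi_tendsto_0 gs])
    have "\<forall>\<^sub>F k in sequentially. B < g (s k)" using gs by (simp add: filterlim_at_top_dense)
    then show "\<forall>\<^sub>F k in sequentially. phi \<gamma> R (g (s k)) = f (g (s k))"
      by eventually_elim (simp add: f_def max_def)
  qed
  have rat: "\<bar>f (g v) - v\<bar> \<le> e * f (g v)" if v: "v \<in> \<rat>" "0 < v" "v < t0" for v
  proof (rule ccontr)
    assume n: "\<not> \<bar>f (g v) - v\<bar> \<le> e * f (g v)"
    have "(\<lambda>k. \<bar>f (g v) - f (g (s k)) - (v - s k)\<bar>) \<longlonglongrightarrow> \<bar>f (g v) - 0 - (v - 0)\<bar>"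
      by (intro tendsto_intros fs s(1))
    moreover have "\<bar>f (g v) - 0 - (v - 0)\<bar> > e * f (g v)" using n by simp
    ultimately have "\<forall>\<^sub>F k in sequentially. \<bar>f (g v) - f (g (s k)) - (v - s k)\<bar> > e * f (g v)"
      by (rule order_tendstoD(1))
    moreover have "\<forall>\<^sub>F k in sequentially. s k < v" using order_tendstoD(2)[OF s(1) v(2)] .
    ultimately have "\<forall>\<^sub>F k in sequentially. \<not> near_flow e B (\<lambda>t. g (s k + t))"
    proof eventually_elim
      case (elim k)
      have r: "v - s k \<in> \<rat>" using v(1) s(3) by simp
      have P: "\<forall>q\<in>\<rat>. 0 \<le> q \<longrightarrow> q \<le> v - s k \<longrightarrow> B \<le> g (s k + q)"
      proof (intro ballI impI)
        fix q assume "0 \<le> q" "q \<le> v - s k"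
        then show "B \<le> g (s k + q)" using t0(2)[of "s k + q"] v s(2)[of k] by simp
      qed
      have "\<bar>f (g v) - f (g (s k)) - (v - s k)\<bar> \<le> e * f (g v)" if "near_flow e B (\<lambda>t. g (s k + t))"
      proof -
        have "0 \<le> v - s k" using elim by simp
        from that[unfolded near_flow_def, THEN bspec, OF r, THEN mp, OF this, THEN mp, OF P]
        show ?thesis by (simp add: f_def)
      qed
      then show ?case using elim by auto
    qed
    then show False using inf by (auto simp: frequently_def)
  qed
  \<comment> \<open>By right-continuity a strict violation at \<open>v\<close> would persist just to
    the right of \<open>v\<close>, hence at a rational time.\<close>
  have all: "\<bar>f (g v) - v\<bar> \<le> e * f (g v)" if v: "0 < v" "v < t0" for v
  proof (rule ccontr)
    assume n: "\<not> \<bar>f (g v) - v\<bar> \<le> e * f (g v)"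
    have fg: "((\<lambda>w. f (g w)) \<longlongrightarrow> f (g v)) (at_right v)"
      by (rule continuous_on_tendsto_compose[OF fc rc[OF v(1) t0(2)[OF v]]]) auto
    have "((\<lambda>w. \<bar>f (g w) - w\<bar> - e * f (g w)) \<longlongrightarrow> \<bar>f (g v) - v\<bar> - e * f (g v)) (at_right v)"
      by (intro tendsto_intros fg)
    then have "\<forall>\<^sub>F w in at_right v. \<bar>f (g w) - w\<bar> - e * f (g w) > 0"
      using n by (intro order_tendstoD(1)) auto
    then obtain b where b: "b > v" "\<And>w. v < w \<Longrightarrow> w < b \<Longrightarrow> \<bar>f (g w) - w\<bar> - e * f (g w) > 0"
      by (auto simp: eventually_at_right_field)
    obtain w where "w \<in> \<rat>" "v < w" "w < min b t0" using Rats_dense_in_real[of v "min b t0"] b v by auto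
    then show False using rat[of w] b(2)[of w] v by auto
  qed
  have "\<forall>\<^sub>F v in at_right 0. v \<in> {0<..<t0}" using t0(1) by (rule eventually_at_right_real)
  then show ?thesis
  proof eventually_elim
    case (elim v)
    then show ?case using all[of v] t0(2)[of v] by (simp add: f_def max_def)
  qed
qed

text \<open>The good events \<open>A k\<close> for the starting times \<open>s k\<close> need not be
  nested, so they are combined through their limsup \<open>L\<close>, which inherits the uniform
  lower bound on their probabilities. Infinitely many good starting times suffice for the passage to
  time 0.\<close>

lemma P_infty_phi_near_time:
  fixes Lev :: "real \<Rightarrow> 'b measure" and Zs :: "real \<Rightarrow> real \<Rightarrow> 'b \<Rightarrow> real"
    and M :: "'a measure" and Y :: "real \<Rightarrow> 'a \<Rightarrow> ereal"
  assumes proc: "P_infty_process R Lev Zs M Y"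
    and lev: "\<And>y. y \<ge> 0 \<Longrightarrow> sp_levy (Lev y) (Zs y) y \<Psi>"
    and \<psi>: "\<delta> > 0" "l0 > 0" "C > 0" "\<And>l. 0 < l \<Longrightarrow> l < l0 \<Longrightarrow> \<Psi> l - \<gamma> * l \<le> C * l powr (1 + \<delta>)"
      "\<And>l. l > 0 \<Longrightarrow> \<Psi> l - \<gamma> * l \<ge> 0" and e: "e > 0"
  shows "AE \<omega> in M. \<forall>\<^sub>F v in at_right 0. \<bar>phi \<gamma> R (real_of_ereal (Y v \<omega>)) - v\<bar> \<le> e * phi \<gamma> R (real_of_ereal (Y v \<omega>))"
proof -
  interpret prob_space M using proc by (simp add: P_infty_process_def)
  have Ym: "Y t \<in> borel_measurable M" if "t \<ge> 0" for t using proc that by (simp add: P_infty_process_def)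
  have Yfin: "Y t \<omega> < \<infinity>" if "t > 0" "\<omega> \<in> space M" for t \<omega> using proc that by (simp add: P_infty_process_def)
  have Ylim: "((\<lambda>t. Y t \<omega>) \<longlongrightarrow> \<infinity>) (at_right 0)" if "\<omega> \<in> space M" for \<omega>
    using proc that by (simp add: P_infty_process_def)
  have Yrc: "((\<lambda>t. Y t \<omega>) \<longlongrightarrow> Y v \<omega>) (at_right v)" if "\<omega> \<in> space M" "v > 0" for \<omega> v
    using proc that by (simp add: P_infty_process_def)
  have glim: "filterlim (\<lambda>t. real_of_ereal (Y t \<omega>)) at_top (at_right 0)" if w: "\<omega> \<in> space M" for \<omega>
    unfolding filterlim_at_top_dense
  proof
    fix c :: real
    have "\<forall>\<^sub>F t in at_right 0. ereal c < Y t \<omega>" using order_tendstoD(1)[OF Ylim[OF w]] by simp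
    then show "\<forall>\<^sub>F t in at_right 0. c < real_of_ereal (Y t \<omega>)"
      using eventually_at_right_less[of "0::real"]
    proof eventually_elim
      case (elim t)
      then show ?case using Yfin[of t \<omega>] w by (cases "Y t \<omega>") auto
    qed
  qed
  have grc: "((\<lambda>t. real_of_ereal (Y t \<omega>)) \<longlongrightarrow> real_of_ereal (Y v \<omega>)) (at_right v)"
    if w: "\<omega> \<in> space M" and v: "v > 0" "0 < real_of_ereal (Y v \<omega>)" for \<omega> v
  proof -
    have "Y v \<omega> = ereal (real_of_ereal (Y v \<omega>))" using v Yfin[OF v(1) w] by (cases "Y v \<omega>") auto
    then show ?thesis using Yrc[OF w v(1)] by (metis lim_real_of_ereal)
  qed
  define s where "s k = 1 / real (Suc k)" for k
  have s: "s \<longlonglongrightarrow> 0" "\<And>k. s k > 0" "\<And>k. s k \<in> \<rat>"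
    unfolding s_def using LIMSEQ_inverse_real_of_nat by (auto simp: inverse_eq_divide)
  show ?thesis
  proof (rule AE_from_large_events)
    fix \<epsilon> :: real assume \<epsilon>0: "\<epsilon> > 0"
    \<comment> \<open>Two losses are covered: being below \<open>B\<close> at time
      \<open>s k\<close>, and a bad path afterwards; their joint cost is at most
      \<open>2 * \<epsilon>'\<close>.\<close>
    define \<epsilon>' where "\<epsilon>' = min \<epsilon> 1 / 3"
    have \<epsilon>': "0 < \<epsilon>'" "\<epsilon>' < 1" "3 * \<epsilon>' \<le> \<epsilon>" using \<epsilon>0 by (auto simp: \<epsilon>'_def)
    obtain B where B: "B > 0"
      "\<And>(N :: 'b measure) Z y. \<lbrakk>sp_levy N Z y \<Psi>; B \<le> y\<rbrakk> \<Longrightarrow>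
      \<exists>G\<in>sets N. measure N G \<ge> 1 - \<epsilon>' \<and> (\<forall>\<omega>\<in>G. near_flow e B (\<lambda>t. real_of_ereal (tc_proc R Z \<omega> t)))"
    proof (rule time_changed_near_flow[where 'b = 'b and \<psi> = "\<lambda>l. \<Psi> l - \<gamma> * l", OF e \<epsilon>'(1) \<psi>(1-5) refl], goal_cases)
      case (4 B)
      show ?case by (rule 4(1)) (fact 4)+
    qed
    define A where "A k = {\<omega>\<in>space M. near_flow e B (\<lambda>t. real_of_ereal (Y (s k + t) \<omega>))}" for k
    define D where "D k = {\<omega>\<in>space M. B \<le> real_of_ereal (Y (s k) \<omega>)}" for k
    have A: "A k \<in> events" "prob (A k) \<ge> (1 - \<epsilon>') * prob (D k)" for k
      unfolding A_def D_def by (rule P_infty_near_flow_event[OF proc B(1) s(2) \<epsilon>'(1,2) lev B(2)]; assumption)+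
    have Dm: "D k \<in> events" for k
      unfolding D_def using Ym[of "s k"] s(2)[of k]
      by (intro borel_measurable_le borel_measurable_const borel_measurable_real_of_ereal) auto
    \<comment> \<open>As \<open>Y\<close> tends to infinity at 0, every path has
      \<open>Y (s k)\<close> above \<open>B\<close> for all large \<open>k\<close>, so the tail
      intersections increase to the whole space.\<close>
    have Dlim: "(\<lambda>n. prob (\<Inter>k\<in>{n..}. D k)) \<longlonglongrightarrow> 1"
    proof -
      have "(\<lambda>n. prob (\<Inter>k\<in>{n..}. D k)) \<longlonglongrightarrow> prob (\<Union>n. \<Inter>k\<in>{n..}. D k)"
        using Dm by (intro finite_Lim_measure_incseq incseq_SucI INF_superset_mono) (auto intro!: sets.countable_INT')
      moreover have "(\<Union>n. \<Inter>k\<in>{n..}. D k) = space M"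
      proof (intro equalityI subsetI)
        fix \<omega> assume w: "\<omega> \<in> space M"
        have "filterlim s (at_right 0) sequentially"
          unfolding filterlim_at using s by (auto simp: less_imp_neq[symmetric])
        from filterlim_compose[OF glim[OF w] this]
        have "\<forall>\<^sub>F k in sequentially. B \<le> real_of_ereal (Y (s k) \<omega>)" by (simp add: filterlim_at_top)
        then obtain n where "\<And>k. k \<ge> n \<Longrightarrow> B \<le> real_of_ereal (Y (s k) \<omega>)" by (auto simp: eventually_sequentially)
        then show "\<omega> \<in> (\<Union>n. \<Inter>k\<in>{n..}. D k)" using w by (auto simp: D_def)
      qed (auto simp: D_def)
      ultimately show ?thesis by (simp add: prob_space)
    qed
    define L where "L = (\<Inter>n. \<Union>k\<in>{n..}. A k)"
    have Lm: "L \<in> events" unfolding L_def using A(1) by (intro sets.countable_INT) auto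
    have big: "prob (\<Union>k\<in>{n..}. A k) \<ge> 1 - \<epsilon>" for n
    proof -
      have "\<forall>\<^sub>F n in sequentially. prob (\<Inter>k\<in>{n..}. D k) > 1 - \<epsilon>'"
        using \<epsilon>'(1) by (intro order_tendstoD(1)[OF Dlim]) auto
      then obtain m where m: "\<And>k. k \<ge> m \<Longrightarrow> prob (\<Inter>k\<in>{k..}. D k) > 1 - \<epsilon>'"
        by (auto simp: eventually_sequentially)
      define k where "k = max m n"
      have "1 - \<epsilon>' < prob (\<Inter>k\<in>{k..}. D k)" using m[of k] by (simp add: k_def)
      also have "\<dots> \<le> prob (D k)" using Dm by (intro finite_measure_mono) auto
      finally have Dk: "1 - \<epsilon>' \<le> prob (D k)" by simp
      have "(1 - \<epsilon>') * (1 - \<epsilon>') = 1 - 2 * \<epsilon>' + \<epsilon>' * \<epsilon>'" by (simp add: algebra_simps)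
      moreover have "0 \<le> \<epsilon>' * \<epsilon>'" by simp
      ultimately have "1 - \<epsilon> \<le> (1 - \<epsilon>') * (1 - \<epsilon>')" using \<epsilon>' by linarith
      also have "\<dots> \<le> (1 - \<epsilon>') * prob (D k)" using Dk \<epsilon>' by (intro mult_left_mono) auto
      also have "\<dots> \<le> prob (A k)" by (rule A(2))
      also have "\<dots> \<le> prob (\<Union>k\<in>{n..}. A k)" using A(1) by (intro finite_measure_mono UN_upper) (auto simp: k_def)
      finally show ?thesis .
    qed
    have "(\<lambda>n. prob (\<Union>k\<in>{n..}. A k)) \<longlonglongrightarrow> prob L"
      unfolding L_def using A(1) by (intro finite_Lim_measure_decseq decseq_SucI UN_mono) auto
    then have "prob L \<ge> 1 - \<epsilon>" using big by (intro LIMSEQ_le_const) auto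
    moreover have "\<forall>\<^sub>F v in at_right 0. \<bar>phi \<gamma> R (real_of_ereal (Y v \<omega>)) - v\<bar> \<le> e * phi \<gamma> R (real_of_ereal (Y v \<omega>))"
      if w: "\<omega> \<in> L" for \<omega>
    proof (rule near_flow_from_0[where B = B and s = s, OF B(1) e _ _ s])
      have wM: "\<omega> \<in> space M" using w by (auto simp: L_def A_def)
      show "filterlim (\<lambda>t. real_of_ereal (Y t \<omega>)) at_top (at_right 0)" by (rule glim[OF wM])
      show "((\<lambda>t. real_of_ereal (Y t \<omega>)) \<longlongrightarrow> real_of_ereal (Y v \<omega>)) (at_right v)"
        if "v > 0" "B < real_of_ereal (Y v \<omega>)" for v using grc[OF wM that(1)] that B(1) by simp
      show "\<exists>\<^sub>F k in sequentially. near_flow e B (\<lambda>t. real_of_ereal (Y (s k + t) \<omega>))"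
        unfolding frequently_sequentially using w by (auto simp: L_def A_def)
    qed
    ultimately show "\<exists>A\<in>events. prob A \<ge> 1 - \<epsilon> \<and> (\<forall>\<omega>\<in>A. \<forall>\<^sub>F v in at_right 0.
       \<bar>phi \<gamma> R (real_of_ereal (Y v \<omega>)) - v\<bar> \<le> e * phi \<gamma> R (real_of_ereal (Y v \<omega>)))"
      using Lm by (intro bexI[of _ L]) auto
  qed
qed

text \<open>Intersecting the almost sure events over countably many errors gives
  \<open>phi (Y t) / t -> 1\<close>; inverting \<open>phi\<close> with \<open>c = 1\<close> gives
  the speed.\<close>

lemma P_infty_speed:
  fixes Lev :: "real \<Rightarrow> 'b measure" and Zs :: "real \<Rightarrow> real \<Rightarrow> 'b \<Rightarrow> real"
    and M :: "'a measure" and Y :: "real \<Rightarrow> 'a \<Rightarrow> ereal"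
  assumes proc: "P_infty_process R Lev Zs M Y"
    and lev: "\<And>y. y \<ge> 0 \<Longrightarrow> sp_levy (Lev y) (Zs y) y \<Psi>"
    and \<psi>: "\<delta> > 0" "l0 > 0" "C > 0" "\<And>l. 0 < l \<Longrightarrow> l < l0 \<Longrightarrow> \<Psi> l - \<gamma> * l \<le> C * l powr (1 + \<delta>)"
      "\<And>l. l > 0 \<Longrightarrow> \<Psi> l - \<gamma> * l \<ge> 0"
  shows "AE \<omega> in M. ((\<lambda>t. real_of_ereal (Y t \<omega>) / phi_inv \<gamma> R t) \<longlongrightarrow> 1) (at_right 0)"
proof -
  have "AE \<omega> in M. \<forall>n::nat. \<forall>\<^sub>F v in at_right 0.
     \<bar>phi \<gamma> R (real_of_ereal (Y v \<omega>)) - v\<bar> \<le> 1 / real (Suc (Suc n)) * phi \<gamma> R (real_of_ereal (Y v \<omega>))"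
    unfolding AE_all_countable by (intro allI P_infty_phi_near_time[OF proc lev \<psi>]) auto
  then show ?thesis
    using AE_space
  proof eventually_elim
    case (elim \<omega>)
    define g where "g v = real_of_ereal (Y v \<omega>)" for v
    have "((\<lambda>t. Y t \<omega>) \<longlongrightarrow> \<infinity>) (at_right 0)" "\<And>t. t > 0 \<Longrightarrow> Y t \<omega> < \<infinity>"
      using proc elim(2) by (auto simp: P_infty_process_def)
    then have g0: "\<forall>\<^sub>F t in at_right 0. 0 < g t"
    proof -
      have "\<forall>\<^sub>F t in at_right 0. 0 < Y t \<omega>"
        using order_tendstoD(1)[OF \<open>((\<lambda>t. Y t \<omega>) \<longlongrightarrow> \<infinity>) (at_right 0)\<close>] by simp
      then show ?thesis using eventually_at_right_less[of "0::real"]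
      proof eventually_elim
        case (elim t)
        then show ?case using \<open>\<And>t. t > 0 \<Longrightarrow> Y t \<omega> < \<infinity>\<close>[of t] by (cases "Y t \<omega>") (auto simp: g_def)
      qed
    qed
    have "((\<lambda>t. phi \<gamma> R (g t) / t) \<longlongrightarrow> 1) (at_right 0)"
      unfolding tendsto_iff
    proof (intro allI impI)
      fix e :: real assume "e > 0"
      then obtain n where n: "1 / real (Suc n) < e / 2" using nat_approx_posE[of "e / 2"] by (auto simp del: of_nat_Suc)
      \<comment> \<open>The double successor ensures \<open>h <= 1 / 2\<close>, so that
        \<open>phi (g v) <= 2 * v\<close> and an error relative to \<open>phi (g v)\<close> becomes
        one relative to \<open>v\<close>.\<close>
      define h where "h = 1 / real (Suc (Suc n))"
      have h: "0 < h" "h \<le> 1 / 2" "h < e / 2"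
      proof -
        have "h \<le> 1 / real (Suc n)" unfolding h_def by (intro divide_left_mono) auto
        then show "h < e / 2" using n by simp
      qed (auto simp: h_def field_simps)
      have "\<forall>\<^sub>F v in at_right 0. \<bar>phi \<gamma> R (g v) - v\<bar> \<le> h * phi \<gamma> R (g v)"
        using elim(1) by (simp add: g_def h_def)
      then show "\<forall>\<^sub>F t in at_right 0. dist (phi \<gamma> R (g t) / t) 1 < e"
        using eventually_at_right_less[of "0::real"] g0
      proof eventually_elim
        case (elim v)
        define p where "p = phi \<gamma> R (g v)"
        have p: "0 \<le> p" "\<bar>p - v\<bar> \<le> h * p" "0 < v" using elim phi_nonneg[of "g v"] by (auto simp: p_def)
        have "h * p \<le> 1 / 2 * p" using h p by (intro mult_right_mono) auto
        then have "p \<le> 2 * v" using p by linarith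
        then have "h * p \<le> h * (2 * v)" using h by (intro mult_left_mono) auto
        also have "\<dots> < e * v" using h p by simp
        finally have "\<bar>p - v\<bar> < e * v" using p by simp
        then have "\<bar>(p - v) / v\<bar> < e" using p by (simp add: abs_divide field_simps)
        moreover have "p / v - 1 = (p - v) / v" using p by (simp add: field_simps)
        ultimately show ?case by (simp add: dist_real_def p_def)
      qed
    qed
    from phi_inverse_asymptotics[OF _ g0 this] show ?case by (simp add: g_def)
  qed
qed

end

theorem theorem3p4:
  fixes \<gamma> \<sigma> \<theta> :: real and \<pi> :: "real measure" and R :: "real \<Rightarrow> real"
    and Lev :: "real \<Rightarrow> 'b measure" and Zs :: "real \<Rightarrow> real \<Rightarrow> 'b \<Rightarrow> real"
    and M :: "'a measure" and Y :: "real \<Rightarrow> 'a \<Rightarrow> ereal"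
  assumes "\<gamma> > 0" and "\<sigma> \<ge> 0" and "levy_measure \<pi>"
    and "continuous_on {0..} R" and "\<And>x. x > 0 \<Longrightarrow> R x > 0"
    and "\<theta> > 1" and "regvar_at_top R \<theta>"
    and "\<And>y. y \<ge> 0 \<Longrightarrow> sp_levy (Lev y) (Zs y) y (Psi \<gamma> \<sigma> \<pi>)"
    and "P_infty_process R Lev Zs M Y"
    and "(\<exists>\<delta> c. 0 < \<delta> \<and> \<delta> < 1 \<and> c > 0 \<and>
            (\<lambda>l. Psi \<gamma> \<sigma> \<pi> l - \<gamma> * l) \<sim>[at_right 0] (\<lambda>l. c * l powr (1 + \<delta>)) \<and>
            (\<lambda>z. Vfun R z (1 / sqrt z)) \<in> O[at_top](\<lambda>z. z powr (- \<delta> / 2)))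
       \<or> (\<exists>\<nu>. 0 < \<nu> \<and> integrable \<pi> (\<lambda>z. exp (\<nu> * z) - 1 - \<nu> * z) \<and>
            Psi \<gamma> \<sigma> \<pi> (- \<nu>) = 0 \<and>
            (\<integral>\<^sup>+ u. indicator {0<..1} u * ennreal u \<partial>\<pi>) < \<infinity> \<and>
            (\<lambda>z. Vfun R z (2 * ln (ln z) / (\<nu> * z))) \<in> O[at_top](\<lambda>z. (ln z) powr (-2)))"
  shows "(AE \<omega> in M. ((\<lambda>t. real_of_ereal (Y t \<omega>) / phi_inv \<gamma> R t) \<longlongrightarrow> 1) (at_right 0))
         \<and> regvar_at_0 (phi_inv \<gamma> R) (- 1 / (\<theta> - 1))"
proof -
  interpret regular_rate \<gamma> \<theta> R using assms(1,4-7) by unfold_locales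
  \<comment> \<open>Each alternative yields an upper power bound for \<psi> at 0: the asymptotic
    relation with its own \<delta>, the exponential moment with \<open>\<delta> = 1\<close> at all
    \<open>l > 0\<close>, so that \<open>l0 = 1\<close> is an arbitrary choice there.\<close>
  obtain \<delta> l0 C :: real where \<psi>: "\<delta> > 0" "l0 > 0" "C > 0"
    "\<And>l. 0 < l \<Longrightarrow> l < l0 \<Longrightarrow> Psi \<gamma> \<sigma> \<pi> l - \<gamma> * l \<le> C * l powr (1 + \<delta>)"
    using assms(10)
  proof (elim disjE exE conjE)
    fix \<delta> c assume "0 < \<delta>" "0 < c" "(\<lambda>l. Psi \<gamma> \<sigma> \<pi> l - \<gamma> * l) \<sim>[at_right 0] (\<lambda>l. c * l powr (1 + \<delta>))"
      and that: "\<And>\<delta> l0 C. 0 < \<delta> \<Longrightarrow> 0 < l0 \<Longrightarrow> 0 < C \<Longrightarrow>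
        (\<And>l. 0 < l \<Longrightarrow> l < l0 \<Longrightarrow> Psi \<gamma> \<sigma> \<pi> l - \<gamma> * l \<le> C * l powr (1 + \<delta>)) \<Longrightarrow> thesis"
    then show thesis using asymp_equiv_powr_bound[of "\<lambda>l. Psi \<gamma> \<sigma> \<pi> l - \<gamma> * l" c "1 + \<delta>"] by metis
  next
    fix \<nu> assume "0 < \<nu>" "integrable \<pi> (\<lambda>z. exp (\<nu> * z) - 1 - \<nu> * z)"
      and that: "\<And>\<delta> l0 C. 0 < \<delta> \<Longrightarrow> 0 < l0 \<Longrightarrow> 0 < C \<Longrightarrow>
        (\<And>l. 0 < l \<Longrightarrow> l < l0 \<Longrightarrow> Psi \<gamma> \<sigma> \<pi> l - \<gamma> * l \<le> C * l powr (1 + \<delta>)) \<Longrightarrow> thesis"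
    then show thesis using Psi_bound_exponential_moment[OF assms(3), of \<nu> \<gamma> \<sigma>] that[of 1 1] by (metis zero_less_one)
  qed
  show ?thesis
    using P_infty_speed[OF assms(9,8) \<psi> Psi_minus_drift_nonneg] phi_inv_regvar by simp
qed

end
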